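(* Let $\phi(x,y)=a_1x^2+a_2xy+a_3y^2$ with $a_i\in\mathbb{Q}$ and $a_2^2-4a_1a_3\ne0$, let $0<s<1$ and $C\ge1$. There exist constants $\epsilon=\epsilon(\phi,s)>0$, $K=K(s)>0$ and $c_0=c_0(\phi,s)>0$ such that the following holds for all $\delta>0$. Let $A\subset[0,1]$ be a $\delta$-separated set with $\#A=\lceil\delta^{-s}\rceil$ such that $\#(A\cap I)\le C\,l^s\,\#A$ for every interval $I$ of length $l\ge\delta$. Then for every $B\subseteq A$ with $\#B\ge\delta^\epsilon\#A$, $$\mathcal{E}_\delta(B+B)+\mathcal{E}_\delta(\phi(B,B))\ \ge\ c_0\,C^{-K}\,\delta^{-\epsilon}\,\#A,$$ where $B+B=\{b+b':b,b'\in B\}$ and $\phi(B,B)=\{\phi(b,b'):b,b'\in B\}$.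
   Context: $\mathcal{E}_\delta(E)$ denotes the $\delta$-covering number of $E\subset\mathbb{R}$ (minimal number of intervals of length $\delta$ covering $E$). A set is $\delta$-separated if distinct points are at distance $\ge\delta$. *)

theory Defs
  imports Complex_Main
begin

definition covering_number :: "real \<Rightarrow> real set \<Rightarrow> nat" where
  "covering_number \<delta> E =
     (LEAST n. \<exists>F. finite F \<and> card F = n \<and> E \<subseteq> (\<Union>x\<in>F. {x..x+\<delta>}))"

definition delta_separated :: "real \<Rightarrow> real set \<Rightarrow> bool" where
  "delta_separated \<delta> A \<longleftrightarrow> (\<forall>x\<in>A. \<forall>y\<in>A. x \<noteq> y \<longrightarrow> \<bar>x - y\<bar> \<ge> \<delta>)"

definition sumset :: "real set \<Rightarrow> real set" where
  "sumset B = {b + b' | b b'. b \<in> B \<and> b' \<in> B}"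

definition quad_form :: "real \<Rightarrow> real \<Rightarrow> real \<Rightarrow> real \<Rightarrow> real \<Rightarrow> real" where
  "quad_form a1 a2 a3 x y = a1 * x^2 + a2 * x * y + a3 * y^2"

definition form_image :: "(real \<Rightarrow> real \<Rightarrow> real) \<Rightarrow> real set \<Rightarrow> real set" where
  "form_image \<phi> B = {\<phi> b b' | b b'. b \<in> B \<and> b' \<in> B}"

end

theory Submission
  imports Defs "HOL-Library.Set_Algebras" "HOL-Analysis.Convex"
begin

text \<open>Suppose that \<open>B + B\<close> and \<open>\<phi>(B, B)\<close> are both small and pass to integers by scaling with
  \<open>R = 1 / \<delta>\<close>. Solutions of \<open>\<phi>(x, y) = \<phi>(x', y')\<close> in \<open>B\<close> abound, and in the coordinates
  \<open>p = u - u'\<close>, \<open>q = u + u'\<close> of \<open>u = (x, y)\<close>, \<open>u' = (x', y')\<close> the equation is bilinear, so \<open>q\<close> lies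
  on a line whose slope is fixed by \<open>p1 / p2\<close>. Hence for a popular \<open>p\<close> a large part of a bounded
  sumset of \<open>B\<close> is mapped into another one by a slope \<open>t = p1 / p2\<close>, and Ruzsa covering together
  with Pluennecke's inequality bounds \<open>B + t B\<close>. For some fixed \<open>p2\<close> the slopes obtained in this way
  form (up to translation) a set \<open>S\<close> with \<open>p2 S \<subseteq> B - B\<close> that inherits size and non-concentration
  from \<open>B\<close>, so all sums \<open>S + v S + u S\<close> with \<open>u, v\<close> bounded combinations of differences of \<open>S\<close> are
  small.

  Such a set does not exist, by the dichotomy of Bourgain-Katz-Tao and Guth-Katz-Zahl for the
  quotients of differences \<open>Q = (S - S) / (S - S)\<close>. The sums \<open>S + v S\<close> force \<open>S\<close> to be regular at
  all scales, which turns smallness of \<open>S + v S + u S\<close> at one scale into smallness of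
  \<open>S + (u / v) S\<close> at all coarser scales. If some \<open>y / 2\<close> or \<open>(y + 1) / 2\<close> with \<open>y \<in> Q\<close> is far from
  \<open>Q\<close>, then \<open>(d, d') \<mapsto> d + t d'\<close> with this slope \<open>t\<close> is nearly injective on \<open>S \<times> S\<close>. Otherwise \<open>Q\<close>
  is dense in the unit interval, and an average over slopes shows that \<open>S + q S\<close> is large for some
  \<open>q \<in> Q\<close>. Both contradict smallness.\<close>

section \<open>The inequalities of Pluennecke and Ruzsa\<close>

text \<open>Rationality of the coefficients enters through integrality: a multiple of the form has
  integer coefficients, so its gradient at a sum of two points of \<open>B \<times> B\<close> lies,
  up to a fixed translation, in a difference set \<open>n B - n B\<close> with \<open>n\<close>
  bounded by the coefficients, and Pluennecke's inequality controls such sets. Fixing the second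
  difference \<open>d0\<close> gives all slopes the same denominator \<open>H\<close>: the slope set
  is itself a piece of \<open>(B - B) / H\<close>, so \<open>S + v S + u S\<close> is a translate of
  a part of \<open>B - B + v (B - B) + u (B - B)\<close> scaled by \<open>1 / H\<close>. A bound for
  multiplication by slopes can therefore be applied to the slopes themselves. The obstacle is
  bookkeeping: every step loses a power of the doubling constant. All losses are kept as powers of
  one parameter, \<open>K\<close> for \<open>B\<close> and \<open>L = K ^ E0\<close> for
  \<open>S\<close>, and the outcome \<open>R powr (s * (1 - s) / 10) \<le> K ^ E\<close> has an
  \<open>E\<close> fixed before \<open>R\<close> and \<open>K\<close>. A sufficiently small
  \<open>\<epsilon>\<close>, chosen after \<open>E\<close>, contradicts it for large
  \<open>R\<close>.\<close>

lemma card_sum_singleton: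
  fixes X :: "'a::ab_group_add set"
  shows "card ({c} + X) = card X"
proof -
  have "{c} + X = (+) c ` X" by (auto simp: set_plus_def)
  then show ?thesis by (simp add: card_image)
qed

lemma card_le_card_plus:
  fixes A B :: "'a::ab_group_add set"
  assumes "finite A" "finite B" "B \<noteq> {}"
  shows "card A \<le> card (A + B)"
proof -
  obtain b where "b \<in> B" using assms by auto
  then have "{b} + A \<subseteq> A + B" by (auto simp: set_plus_def add.commute)
  then have "card ({b} + A) \<le> card (A + B)"
    by (rule card_mono[OF finite_set_plus[OF assms(1,2)]])
  then show ?thesis by (simp add: card_sum_singleton)
qed

text \<open>Petridis' argument: \<open>X\<close> has the smallest ratio
  \<open>card (Y + B) / card Y\<close> among its nonempty subsets, and this controls the growth
  after adding any \<open>C\<close>. In the induction a new \<open>c\<close> creates at most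
  \<open>card (X + B) - card (Y + B)\<close> new sums, where \<open>Y\<close> collects the
  \<open>x\<close> whose translate \<open>c + x + B\<close> is already present. Minimality compares
  this with the new points of \<open>C + X\<close>.\<close>

lemma petridis:
  fixes X B C :: "'a::ab_group_add set"
  assumes fin: "finite X" "finite B" "finite C"
    and min: "\<And>Y. Y \<subseteq> X \<Longrightarrow> card (X + B) * card Y \<le> card (Y + B) * card X"
  shows "card (C + (X + B)) * card X \<le> card (X + B) * card (C + X)"
  using fin(3)
proof (induction C)
  case empty
  then show ?case by (simp add: set_plus_def)
next
  case (insert c C)
  define Y where "Y = {x\<in>X. {c + x} + B \<subseteq> C + (X + B)}"
  define W where "W = {x\<in>X. c + x \<in> C + X}"
  have YX: "Y \<subseteq> X" and finY: "finite Y" using fin by (auto simp: Y_def)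
  have finXB: "finite (X + B)" and finYB: "finite (Y + B)"
    using fin finY by (auto intro: finite_set_plus)
  have WY: "W \<subseteq> Y"
  proof
    fix x assume "x \<in> W"
    then have x: "x \<in> X" "c + x \<in> C + X" by (auto simp: W_def)
    then have "{c + x} + B \<subseteq> (C + X) + B" by (auto simp: set_plus_def)
    then show "x \<in> Y" using x by (simp add: Y_def add.assoc)
  qed
  have YB: "Y + B \<subseteq> X + B" using YX by (auto simp: set_plus_def)
  have sub1: "insert c C + (X + B) \<subseteq> (C + (X + B)) \<union> ({c} + ((X + B) - (Y + B)))"
  proof
    fix z assume "z \<in> insert c C + (X + B)"
    then obtain d w where dw: "d \<in> insert c C" "w \<in> X + B" "z = d + w"
      by (auto simp: set_plus_def)
    show "z \<in> (C + (X + B)) \<union> ({c} + ((X + B) - (Y + B)))"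
    proof (cases "d = c \<and> w \<notin> Y + B")
      case True
      then show ?thesis using dw by (auto simp: set_plus_def)
    next
      case False
      show ?thesis
      proof (cases "d \<in> C")
        case True
        then show ?thesis using dw by (auto simp: set_plus_def)
      next
        case dC: False
        then have "w \<in> Y + B" "d = c" using dw False by auto
        then obtain y b where "y \<in> Y" "b \<in> B" "w = y + b" by (auto simp: set_plus_def)
        then have "z \<in> {c + y} + B" using dw \<open>d = c\<close> by (auto simp: set_plus_def add.assoc)
        then show ?thesis using \<open>y \<in> Y\<close> by (auto simp: Y_def)
      qed
    qed
  qed
  have "card (insert c C + (X + B)) \<le> card ((C + (X + B)) \<union> ({c} + ((X + B) - (Y + B))))"
    using insert finXB by (intro card_mono[OF _ sub1]) (auto intro: finite_set_plus)
  also have "\<dots> \<le> card (C + (X + B)) + card ({c} + ((X + B) - (Y + B)))"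
    by (rule card_Un_le)
  also have "card ({c} + ((X + B) - (Y + B))) = card (X + B) - card (Y + B)"
    using YB finYB by (simp add: card_sum_singleton card_Diff_subset)
  finally have up: "card (insert c C + (X + B)) \<le> card (C + (X + B)) + (card (X + B) - card (Y + B))" .
  \<comment> \<open>The other side grows by exactly \<open>card X - card W\<close>, which is at
    least \<open>card X - card Y\<close> because \<open>W \<subseteq> Y\<close>.\<close>
  have eq: "insert c C + X = (C + X) \<union> ({c} + (X - W))"
    by (auto simp: set_plus_def W_def)
  have "card (insert c C + X) = card (C + X) + card ({c} + (X - W))"
    unfolding eq
  proof (rule card_Un_disjoint)
    show "(C + X) \<inter> ({c} + (X - W)) = {}"
      by (auto simp: W_def elim!: set_plus_elim) (metis set_plus_intro)
  qed (use insert fin in \<open>auto intro: finite_set_plus\<close>)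
  also have "card ({c} + (X - W)) = card X - card W"
    using fin by (simp add: card_sum_singleton card_Diff_subset W_def)
  finally have low: "card (insert c C + X) = card (C + X) + (card X - card W)" .
  have cW: "card W \<le> card Y" using WY finY by (rule card_mono[rotated])
  have cY: "card Y \<le> card X" using YX fin by (simp add: card_mono)
  have cYB: "card (Y + B) \<le> card (X + B)" using YB finXB by (simp add: card_mono)
  have m: "card (X + B) * card Y \<le> card (Y + B) * card X" by (rule min[OF YX])
  have "card (insert c C + (X + B)) * card X
      \<le> (card (C + (X + B)) + (card (X + B) - card (Y + B))) * card X"
    using up by (rule mult_le_mono1)
  also have "\<dots> = card (C + (X + B)) * card X + (card (X + B) * card X - card (Y + B) * card X)"
    by (simp add: algebra_simps diff_mult_distrib2)
  also have "\<dots> \<le> card (X + B) * card (C + X) + (card (X + B) * card X - card (X + B) * card Y)"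
    using insert.IH m by linarith
  also have "\<dots> = card (X + B) * (card (C + X) + (card X - card Y))"
    by (simp add: algebra_simps diff_mult_distrib2)
  also have "\<dots> \<le> card (X + B) * card (insert c C + X)"
    unfolding low using cW by (intro mult_le_mono2) linarith
  finally show ?case .
qed

text \<open>Fix one representation \<open>d = x - z\<close> of every difference. Then
  \<open>(d, y) \<mapsto> (x + y, y + z)\<close> is injective, since subtracting the coordinates
  recovers \<open>d\<close>, hence \<open>x\<close>, \<open>z\<close> and \<open>y\<close>.\<close>

lemma ruzsa_triangle:
  fixes X Y Z :: "'a::ab_group_add set"
  assumes "finite X" "finite Y" "finite Z"
  shows "card {x - z | x z. x \<in> X \<and> z \<in> Z} * card Y \<le> card (X + Y) * card (Y + Z)"
proof -
  define D where "D = {x - z | x z. x \<in> X \<and> z \<in> Z}"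
  have "\<forall>d\<in>D. \<exists>p. fst p \<in> X \<and> snd p \<in> Z \<and> d = fst p - snd p"
    by (auto simp: D_def)
  then obtain f where f: "\<And>d. d \<in> D \<Longrightarrow> fst (f d) \<in> X \<and> snd (f d) \<in> Z \<and> d = fst (f d) - snd (f d)"
    by metis
  define g where "g = (\<lambda>(d, y). (fst (f d) + y, y + snd (f d)))"
  have "inj_on g (D \<times> Y)"
  proof (rule inj_onI)
    fix p q assume "p \<in> D \<times> Y" "q \<in> D \<times> Y" "g p = g q"
    then obtain d y d' y' where pq: "p = (d, y)" "q = (d', y')" "d \<in> D" "d' \<in> D"
      and e: "fst (f d) + y = fst (f d') + y'" "y + snd (f d) = y' + snd (f d')"
      by (auto simp: g_def)
    have "d = (fst (f d) + y) - (y + snd (f d))" using f[OF pq(3)] by (simp add: algebra_simps)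
    also have "\<dots> = d'" unfolding e using f[OF pq(4)] by (simp add: algebra_simps)
    finally have "d = d'" .
    then show "p = q" using e pq by simp
  qed
  moreover have "g ` (D \<times> Y) \<subseteq> (X + Y) \<times> (Y + Z)"
    using f by (auto simp: g_def set_plus_def)
  ultimately have "card (D \<times> Y) \<le> card ((X + Y) \<times> (Y + Z))"
    using assms by (intro card_inj_on_le[of g]) (auto intro: finite_set_plus)
  then show ?thesis by (simp add: card_cartesian_product D_def)
qed

section \<open>Iterated sum and difference sets\<close>

primrec nfold :: "'a::ab_group_add set \<Rightarrow> nat \<Rightarrow> 'a set" where
  "nfold B 0 = {0}"
| "nfold B (Suc k) = nfold B k + B"

text \<open>This is \<open>k B - k B\<close>. Building it from differences makes it invariant under
  translation of \<open>B\<close> and symmetric, and lengths simply add under sums.\<close>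

primrec dset :: "'a::ab_group_add set \<Rightarrow> nat \<Rightarrow> 'a set" where
  "dset B 0 = {0}"
| "dset B (Suc k) = {z + (b - b') | z b b'. z \<in> dset B k \<and> b \<in> B \<and> b' \<in> B}"

lemma finite_nfold: "finite B \<Longrightarrow> finite (nfold B k)"
  by (induction k) (auto intro: finite_set_plus)

lemma finite_dset: 
  assumes "finite B" shows "finite (dset B k)"
proof (induction k)
  case (Suc k)
  have "dset B (Suc k) = (\<lambda>(z, b, b'). z + (b - b')) ` (dset B k \<times> B \<times> B)"
    by (force simp: image_def)
  then show ?case using Suc assms by simp
qed simp

lemma dset_eq: "dset B k = {x - z | x z. x \<in> nfold B k \<and> z \<in> nfold B k}"
proof (induction k)
  case (Suc k)
  show ?case
  proof (intro equalityI subsetI)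
    fix w assume "w \<in> dset B (Suc k)"
    then obtain x z b b' where *: "x \<in> nfold B k" "z \<in> nfold B k" "b \<in> B" "b' \<in> B"
      and w: "w = x - z + (b - b')" using Suc.IH by auto
    have "w = (x + b) - (z + b')" using w by simp
    then show "w \<in> {x - z |x z. x \<in> nfold B (Suc k) \<and> z \<in> nfold B (Suc k)}"
      using * by (force simp: set_plus_def)
  next
    fix w assume "w \<in> {x - z |x z. x \<in> nfold B (Suc k) \<and> z \<in> nfold B (Suc k)}"
    then obtain x z b b' where *: "x \<in> nfold B k" "z \<in> nfold B k" "b \<in> B" "b' \<in> B"
      and w: "w = (x + b) - (z + b')" by (auto simp: set_plus_def)
    have "w = (x - z) + (b - b')" using w by simp
    moreover have "x - z \<in> dset B k" using * Suc.IH by auto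
    ultimately show "w \<in> dset B (Suc k)" using *(3,4) unfolding dset.simps by blast
  qed
qed simp

lemma dset_add: "x \<in> dset B k \<Longrightarrow> y \<in> dset B l \<Longrightarrow> x + y \<in> dset B (k + l)"
proof (induction l arbitrary: y)
  case (Suc l)
  then obtain z b b' where "z \<in> dset B l" "b \<in> B" "b' \<in> B" "y = z + (b - b')" by auto
  then have "x + y = (x + z) + (b - b')" "x + z \<in> dset B (k + l)"
    using Suc.IH[of z] Suc.prems by (auto simp: algebra_simps)
  then show ?case using \<open>b \<in> B\<close> \<open>b' \<in> B\<close> unfolding add_Suc_right dset.simps by blast
qed simp

lemma dset_uminus: "x \<in> dset B k \<Longrightarrow> - x \<in> dset B k"
  unfolding dset_eq by force

lemma dset_diff: "x \<in> dset B k \<Longrightarrow> y \<in> dset B l \<Longrightarrow> x - y \<in> dset B (k + l)"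
  using dset_add[OF _ dset_uminus] by (metis diff_conv_add_uminus)

lemma dset_1: "b \<in> B \<Longrightarrow> b' \<in> B \<Longrightarrow> b - b' \<in> dset B 1"
  by force

lemma zero_in_dset: "B \<noteq> {} \<Longrightarrow> 0 \<in> dset B k"
  by (induction k) force+

lemma dset_mono: "B \<noteq> {} \<Longrightarrow> k \<le> l \<Longrightarrow> dset B k \<subseteq> dset B l"
  using dset_add[OF _ zero_in_dset, of _ B k "l - k"] by auto

lemma dset_mult_int:
  fixes B :: "int set"
  assumes "x \<in> dset B k"
  shows "m * x \<in> dset B (nat \<bar>m\<bar> * k)"
proof -
  have *: "int n * x \<in> dset B (n * k)" for n
  proof (induction n)
    case (Suc n)
    then have "int n * x + x \<in> dset B (n * k + k)" using dset_add assms by blast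
    then show ?case by (simp add: algebra_simps)
  qed simp
  show ?thesis
  proof (cases "m \<ge> 0")
    case True
    then show ?thesis using *[of "nat m"] by simp
  next
    case False
    then show ?thesis using dset_uminus[OF *[of "nat (- m)"]] by simp
  qed
qed

text \<open>For a nonempty \<open>X \<subseteq> B\<close> with the smallest ratio
  \<open>card (X + B) / card X\<close>, repeated use of \<open>petridis\<close> gives
  \<open>card (k B + X) \<le> K ^ k * card X\<close>. The triangle inequality through
  \<open>X\<close> combines two such bounds into one for \<open>k B - k B\<close>.\<close>

lemma pluennecke_dset:
  fixes B :: "'a::ab_group_add set"
  assumes fin: "finite B" and ne: "B \<noteq> {}" and K: "real (card (B + B)) \<le> K * real (card B)"
  shows "real (card (dset B k)) \<le> K ^ (2 * k) * real (card B)"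
proof -
  define r where "r = (\<lambda>X. real (card (X + B)) / real (card X))"
  have "finite (Pow B - {{}})" "Pow B - {{}} \<noteq> {}" using fin ne by auto
  then obtain X where X: "X \<in> Pow B - {{}}" and Xmin: "\<And>Y. Y \<in> Pow B - {{}} \<Longrightarrow> r X \<le> r Y"
    by (metis (no_types, lifting) arg_min_if_finite(1) arg_min_least)
  have finX: "finite X" and X0: "X \<noteq> {}" and XB: "X \<subseteq> B" using X fin finite_subset by auto
  have cX: "card X > 0" using finX X0 by (simp add: card_gt_0_iff)
  have cB: "card B > 0" using fin ne by (simp add: card_gt_0_iff)
  have rX: "r X \<le> K"
  proof -
    have "r X \<le> r B" using Xmin ne by auto
    also have "\<dots> \<le> K" using K cB by (simp add: r_def divide_le_eq)
    finally show ?thesis .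
  qed
  have min: "card (X + B) * card Y \<le> card (Y + B) * card X" if "Y \<subseteq> X" for Y
  proof (cases "Y = {}")
    case False
    then have "r X \<le> r Y" using Xmin XB that by auto
    moreover have "card Y > 0" using False that finX by (simp add: card_gt_0_iff finite_subset)
    ultimately have "real (card (X + B)) * real (card Y) \<le> real (card (Y + B)) * real (card X)"
      using cX by (simp add: r_def field_simps)
    then show ?thesis by (metis of_nat_le_iff of_nat_mult)
  qed simp
  have step: "real (card (nfold B k + X)) \<le> K ^ k * real (card X)" for k
  proof (induction k)
    case (Suc k)
    have "card (nfold B k + (X + B)) * card X \<le> card (X + B) * card (nfold B k + X)"
      by (intro petridis finX fin finite_nfold min)
    then have "real (card (nfold B k + (X + B))) * real (card X) \<le> real (card (X + B)) * real (card (nfold B k + X))"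
      by (metis of_nat_le_iff of_nat_mult)
    then have "real (card (nfold B k + (X + B))) \<le> r X * real (card (nfold B k + X))"
      using cX by (simp add: r_def field_simps)
    also have "\<dots> \<le> K * (K ^ k * real (card X))"
      using rX Suc by (intro mult_mono) (auto simp: r_def intro: order_trans[OF _ rX])
    also have "nfold B k + (X + B) = nfold B (Suc k) + X"
      by (simp only: nfold.simps add.assoc add.commute[of X B])
    finally show ?case by (simp add: algebra_simps)
  qed (simp add: card_sum_singleton)
  have "card (dset B k) * card X \<le> card (nfold B k + X) * card (X + nfold B k)"
    unfolding dset_eq by (intro ruzsa_triangle finite_nfold fin finX)
  then have "real (card (dset B k)) * real (card X) \<le> real (card (nfold B k + X)) * real (card (nfold B k + X))"
    by (metis of_nat_le_iff of_nat_mult add.commute)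
  also have "\<dots> \<le> (K ^ k * real (card X)) * (K ^ k * real (card X))"
    using step[of k] by (intro mult_mono) (auto intro: order_trans[OF _ step])
  finally have "real (card (dset B k)) \<le> K ^ (2 * k) * real (card X)"
    using cX by (simp add: power_mult power2_eq_square field_simps power_mult_distrib)
  also have "\<dots> \<le> K ^ (2 * k) * real (card B)"
    using XB fin by (intro mult_left_mono) (auto simp: card_mono power_mult)
  finally show ?thesis .
qed

text \<open>\<open>T\<close> is a largest subset of \<open>B\<close> with pairwise disjoint
  translates \<open>t + X\<close>. Disjointness bounds its size; maximality forces every
  \<open>b + X\<close> to meet some \<open>t + X\<close>, which puts \<open>b\<close> into
  \<open>t + X - X\<close>.\<close>

lemma ruzsa_covering:
  fixes B X :: "'a::ab_group_add set"
  assumes "finite B" "finite X" "X \<noteq> {}"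
  obtains T where "T \<subseteq> B" "card T * card X \<le> card (B + X)"
    "\<And>b. b \<in> B \<Longrightarrow> \<exists>t\<in>T. \<exists>x\<in>X. \<exists>y\<in>X. b = t + (x - y)"
proof -
  define P where "P = (\<lambda>T. T \<subseteq> B \<and> (\<forall>s\<in>T. \<forall>t\<in>T. s \<noteq> t \<longrightarrow> ({s} + X) \<inter> ({t} + X) = {}))"
  have "P {}" by (simp add: P_def)
  moreover have "\<forall>T. P T \<longrightarrow> card T \<le> card B" using assms by (simp add: P_def card_mono)
  ultimately obtain T where T: "P T" and max: "\<And>S. P S \<Longrightarrow> card S \<le> card T"
    using ex_has_greatest_nat[of P "{}" card "Suc (card B)"] by (auto simp: less_Suc_eq_le)
  have TB: "T \<subseteq> B" and finT: "finite T" using T assms finite_subset by (auto simp: P_def)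
  have "card T * card X = card (\<Union>t\<in>T. {t} + X)"
    using T assms finT
    by (subst card_UN_disjoint) (auto simp: P_def card_sum_singleton intro: finite_set_plus)
  also have "\<dots> \<le> card (B + X)"
    using TB assms by (intro card_mono) (auto intro: finite_set_plus simp: set_plus_def)
  finally have c: "card T * card X \<le> card (B + X)" .
  have cov: "\<exists>t\<in>T. \<exists>x\<in>X. \<exists>y\<in>X. b = t + (x - y)" if b: "b \<in> B" for b
  proof (cases "b \<in> T")
    case True
    obtain x where "x \<in> X" using assms by auto
    then show ?thesis using True by (intro bexI[of _ b] bexI[of _ x]) auto
  next
    case False
    have "\<not> P (insert b T)" using max[of "insert b T"] False finT by auto
    moreover have "P (insert b T)" if "\<forall>t\<in>T. ({b} + X) \<inter> ({t} + X) = {}"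
      using T b that unfolding P_def by (metis Int_commute insert_iff insert_subset)
    ultimately obtain t where "t \<in> T" "({b} + X) \<inter> ({t} + X) \<noteq> {}"
      by blast
    then obtain x y where "x \<in> X" "y \<in> X" "b + y = t + x" by (auto simp: set_plus_def)
    then show ?thesis using \<open>t \<in> T\<close> by (metis add_diff_cancel_right' add_diff_eq)
  qed
  show ?thesis by (rule that[OF TB c cov])
qed

section \<open>Quotients of differences\<close>

definition separated :: "real \<Rightarrow> real set \<Rightarrow> bool" where
  "separated r X \<longleftrightarrow> (\<forall>x\<in>X. \<forall>y\<in>X. x \<noteq> y \<longrightarrow> r \<le> \<bar>x - y\<bar>)"

text \<open>Counts the cells \<open>[i r, (i + 1) r)\<close> met by \<open>X\<close>. Being the
  cardinality of an image, it scales exactly and is compared with \<open>card X\<close> by counting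
  fibres.\<close>

definition cov :: "real \<Rightarrow> real set \<Rightarrow> nat" where
  "cov r X = card ((\<lambda>x. \<lfloor>x / r\<rfloor>) ` X)"

lemma floor_div_eqD:
  fixes x y r :: real
  assumes "0 < r" "\<lfloor>x / r\<rfloor> = \<lfloor>y / r\<rfloor>"
  shows "\<bar>x - y\<bar> < r"
proof -
  have "\<bar>x / r - y / r\<bar> < 1" using assms(2) by linarith
  then have "\<bar>x - y\<bar> / r < 1" using assms(1) by (simp add: diff_divide_distrib[symmetric])
  then show ?thesis using assms(1) by (simp add: divide_less_eq)
qed

lemma cov_mono: "finite Y \<Longrightarrow> X \<subseteq> Y \<Longrightarrow> cov r X \<le> cov r Y"
  unfolding cov_def by (intro card_mono finite_imageI image_mono)

lemma separated_card_le_cov: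
  assumes "finite X" "P \<subseteq> X" "separated r P" "0 < r"
  shows "card P \<le> cov r X"
proof -
  have "inj_on (\<lambda>x. \<lfloor>x / r\<rfloor>) P"
    using floor_div_eqD[OF assms(4)] assms(3) unfolding inj_on_def separated_def by (meson not_le)
  then have "card P = cov r P" by (simp add: cov_def card_image)
  then show ?thesis using cov_mono assms by metis
qed

lemma card_le_fibers:
  fixes m :: real
  assumes "finite X" "\<And>x. x \<in> X \<Longrightarrow> real (card {y\<in>X. f y = f x}) \<le> m"
  shows "real (card X) \<le> real (card (f ` X)) * m"
proof -
  have "real (card X) = (\<Sum>i\<in>f ` X. \<Sum>x\<in>{x. x \<in> X \<and> f x = i}. 1)"
    using sum.image_gen[OF assms(1), of "\<lambda>_. 1::real" f] by simp
  also have "\<dots> \<le> (\<Sum>i\<in>f ` X. m)"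
    by (intro sum_mono) (use assms(2) in auto)
  finally show ?thesis by simp
qed

lemma card_image_le_fibers:
  assumes "finite X" "\<And>x. x \<in> X \<Longrightarrow> card (f ` {y\<in>X. g y = g x}) \<le> m"
  shows "card (f ` X) \<le> m * card (g ` X)"
proof -
  have "f ` X = (\<Union>j\<in>g ` X. f ` {y\<in>X. g y = j})" by auto
  then have "card (f ` X) \<le> (\<Sum>j\<in>g ` X. card (f ` {y\<in>X. g y = j}))"
    using card_UN_le[of "g ` X" "\<lambda>j. f ` {y\<in>X. g y = j}"] assms(1) by simp
  also have "\<dots> \<le> (\<Sum>j\<in>g ` X. m)" by (intro sum_mono) (use assms(2) in auto)
  finally show ?thesis by (simp add: mult.commute)
qed

text \<open>Keep one point per cell, and only the cells in the most frequent residue class of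
  indices mod 5. Indices at distance 5 or more put the points at least \<open>4 * r\<close> apart,
  which leaves room for perturbations of size \<open>r\<close> when sums are to be kept
  distinct.\<close>

lemma separated_subset:
  assumes "finite X" "0 < r"
  obtains P where "P \<subseteq> X" "separated (4 * r) P" "cov r X \<le> 5 * card P"
proof -
  define c where "c = (\<lambda>x. \<lfloor>x / r\<rfloor>)"
  define I where "I = c ` X"
  have finI: "finite I" using assms by (simp add: I_def)
  define f where "f = inv_into X c"
  have f: "f i \<in> X \<and> c (f i) = i" if "i \<in> I" for i
    using that by (simp add: f_def I_def inv_into_into f_inv_into_f)
  define J where "J = (\<lambda>k. {i\<in>I. i mod 5 = k})"
  have "i mod 5 \<in> {0..4}" for i :: int
    using pos_mod_sign[of 5 i] pos_mod_bound[of 5 i] unfolding atLeastAtMost_iff by linarith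
  then have "I = (\<Union>k\<in>{0..4}. J k)" unfolding J_def by blast
  then have "card I \<le> (\<Sum>k\<in>{0..4::int}. card (J k))"
    using card_UN_le[of "{0..4::int}" J] by simp
  also have "\<dots> \<le> (\<Sum>k\<in>{0..4::int}. Max (card ` J ` {0..4}))"
    by (intro sum_mono Max_ge) auto
  finally have le: "card I \<le> 5 * Max (card ` J ` {0..4})" by simp
  have "Max (card ` J ` {0..4}) \<in> card ` J ` {0..4}" by (intro Max_in) auto
  then obtain k where "Max (card ` J ` {0..4}) = card (J k)" by blast
  then have k: "card I \<le> 5 * card (J k)" using le by simp
  define P where "P = f ` J k"
  have inj: "inj_on f (J k)"
    by (rule inj_on_inverseI[of _ c]) (use f in \<open>auto simp: J_def\<close>)
  show ?thesis
  proof
    show "P \<subseteq> X" using f by (auto simp: P_def J_def)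
    show "cov r X \<le> 5 * card P"
      using k card_image[OF inj] by (simp add: P_def cov_def I_def c_def)
    have *: "4 * r \<le> \<bar>f i - f j\<bar>" if ij: "i \<in> J k" "j \<in> J k" "i < j" for i j
    proof -
      have "5 dvd j - i" using ij mod_eq_dvd_iff[of j 5 i] by (simp add: J_def)
      then have "5 \<le> j - i" using ij(3) by (simp add: zdvd_imp_le)
      moreover have "\<lfloor>f i / r\<rfloor> = i" "\<lfloor>f j / r\<rfloor> = j" using f ij by (auto simp: J_def c_def)
      ultimately have "4 \<le> f j / r - f i / r" by linarith
      then have "4 \<le> (f j - f i) / r" by (simp add: diff_divide_distrib)
      then show ?thesis using assms(2) by (simp add: le_divide_eq)
    qed
    show "separated (4 * r) P"
      unfolding separated_def P_def
    proof (safe)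
      fix i j assume "i \<in> J k" "j \<in> J k" "f i \<noteq> f j"
      then show "4 * r \<le> \<bar>f i - f j\<bar>"
        using *[of i j] *[of j i] by (cases i j rule: linorder_cases) (auto simp: abs_minus_commute)
    qed
  qed
qed

lemma cov_le_2:
  assumes "finite X" "0 < w" "\<And>x y. x \<in> X \<Longrightarrow> y \<in> X \<Longrightarrow> \<bar>x - y\<bar> \<le> w"
  shows "cov w X \<le> 2"
proof (cases "X = {}")
  case False
  define I where "I = (\<lambda>x. \<lfloor>x / w\<rfloor>) ` X"
  have I: "finite I" "I \<noteq> {}" using assms False by (auto simp: I_def)
  have "I \<subseteq> {Min I, Min I + 1}"
  proof
    fix i assume i: "i \<in> I"
    obtain x y where xy: "x \<in> X" "y \<in> X" "i = \<lfloor>x / w\<rfloor>" "Min I = \<lfloor>y / w\<rfloor>"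
      using i Min_in[OF I] by (auto simp: I_def)
    have "x / w - y / w \<le> 1" using assms(3)[OF xy(1,2)] assms(2)
      by (simp add: diff_divide_distrib[symmetric] divide_le_eq)
    moreover have "Min I \<le> i" using i I by simp
    ultimately show "i \<in> {Min I, Min I + 1}" unfolding xy(3,4) by (auto, linarith)
  qed
  then have "card I \<le> card {Min I, Min I + 1}" by (intro card_mono) auto
  then show ?thesis by (simp add: cov_def I_def)
qed (simp add: cov_def)

text \<open>The \<open>\<lambda>\<close>-cells of \<open>S\<close>, the \<open>w\<close>-cells of \<open>Z\<close> and the points of \<open>S\<close> within \<open>w\<close> of a
  representative are read off at three different scales, so the sums are pairwise \<open>\<delta>\<close>-separated.\<close>

lemma cov_sum_lower:
  fixes m :: real
  assumes fin: "finite S" "finite Z" and sepS: "separated \<delta> S"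
    and sc: "0 < \<delta>" "\<delta> \<le> w" "w \<le> l"
    and P: "P \<subseteq> S" "separated (4 * l) P" "\<And>x. x \<in> P \<Longrightarrow> m \<le> real (card (S \<inter> {x - w..x + w}))"
    and Q: "Q \<subseteq> Z" "separated (4 * w) Q" and Z: "Z \<subseteq> {a..a + l}"
  shows "real (card P) * real (card Q) * m \<le> real (cov \<delta> {x + z | x z. x \<in> S \<and> z \<in> Z})"
proof -
  define T where "T = (SIGMA p:P. Q \<times> (S \<inter> {p - w..p + w}))"
  define g where "g = (\<lambda>(p::real, z, x). x + z :: real)"
  have finP: "finite P" "finite Q" using P Q fin finite_subset by blast+
  have *: "\<delta> \<le> \<bar>g t - g t'\<bar>" if t: "t \<in> T" "t' \<in> T" "t \<noteq> t'" for t t'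
  proof -
    obtain p z x p' z' x' where tt: "t = (p, z, x)" "t' = (p', z', x')" by (metis prod_cases3)
    have m: "p \<in> P" "z \<in> Q" "x \<in> S" "\<bar>x - p\<bar> \<le> w" "p' \<in> P" "z' \<in> Q" "x' \<in> S" "\<bar>x' - p'\<bar> \<le> w"
      using t tt by (auto simp: T_def)
    have "z \<in> {a..a + l}" "z' \<in> {a..a + l}" using Q(1) Z m(2,6) by blast+
    then have zz: "\<bar>z - z'\<bar> \<le> l" by auto
    show ?thesis
    proof (cases "p = p'")
      case False
      \<comment> \<open>Passing from \<open>p - p'\<close> to \<open>x - x'\<close> costs at most
        \<open>2 * w \<le> 2 * l\<close>, and \<open>z - z'\<close> costs at most \<open>l\<close>;
        a distance of \<open>l \<ge> \<delta>\<close> remains.\<close>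
      then have "4 * l \<le> \<bar>p - p'\<bar>" using P m by (auto simp: separated_def)
      then show ?thesis using m zz sc unfolding tt g_def by simp
    next
      case pp: True
      show ?thesis
      proof (cases "z = z'")
        case False
        then have "4 * w \<le> \<bar>z - z'\<bar>" using Q m by (auto simp: separated_def)
        then show ?thesis using m sc pp unfolding tt g_def by simp
      next
        case True
        then have "x \<noteq> x'" using t tt pp by auto
        then show ?thesis using sepS m True unfolding tt g_def by (auto simp: separated_def)
      qed
    qed
  qed
  have inj: "inj_on g T" using * sc(1) by (intro inj_onI) fastforce
  have "separated \<delta> (g ` T)" unfolding separated_def using * by blast
  moreover have "g ` T \<subseteq> {x + z | x z. x \<in> S \<and> z \<in> Z}"
    using Q(1) by (auto simp: g_def T_def)
  moreover have "finite {x + z | x z. x \<in> S \<and> z \<in> Z}"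
    using fin by (intro finite_image_set2) auto
  ultimately have "card (g ` T) \<le> cov \<delta> {x + z | x z. x \<in> S \<and> z \<in> Z}"
    using separated_card_le_cov sc(1) by blast
  then have up: "card T \<le> cov \<delta> {x + z | x z. x \<in> S \<and> z \<in> Z}"
    using card_image[OF inj] by simp
  have "real (card P) * real (card Q) * m = (\<Sum>p\<in>P. real (card Q) * m)" by simp
  also have "\<dots> \<le> (\<Sum>p\<in>P. real (card Q) * real (card (S \<inter> {p - w..p + w})))"
    using P(3) by (intro sum_mono mult_left_mono) auto
  also have "\<dots> = real (card T)"
    unfolding T_def using finP fin by (simp add: card_cartesian_product)
  finally show ?thesis using up by linarith
qed

lemma cov_scale:
  assumes "0 < v"
  shows "cov r ((*) v ` X) = cov (r / v) X"
  unfolding cov_def image_image using assms by (simp add: field_simps)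

text \<open>The slope set at unit scale, with all assumptions holding up to a factor
  \<open>L\<close>; the aim is a lower bound for \<open>L\<close> by a power of
  \<open>1 / \<delta>\<close>. The coefficients in \<open>slopes\<close> are sums of two differences
  because halves of a quotient \<open>(d1 - d2) / (d3 - d4)\<close> are written over the denominator
  \<open>2 * (d3 - d4)\<close>.\<close>

locale slope_config =
  fixes S :: "real set" and \<delta> s L :: real
  assumes s: "0 < s" "s < 1" and \<delta>: "0 < \<delta>" "\<delta> < 1" and L: "1 \<le> L"
    and S: "finite S" "S \<noteq> {}" "S \<subseteq> {0..1}" and sepS: "separated \<delta> S"
    and frostman: "\<And>x l. \<delta> \<le> l \<Longrightarrow> real (card (S \<inter> {x..x + l})) \<le> L * l powr s * real (card S)"
    and card_upper: "real (card S) \<le> L * \<delta> powr (- s)"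
    and slopes: "\<And>d1 d2 d3 d4 d5 d6 d7 d8. {d1, d2, d3, d4, d5, d6, d7, d8} \<subseteq> S \<Longrightarrow>
      real (cov \<delta> {x + (((d1 - d2) + (d3 - d4)) * y + ((d5 - d6) + (d7 - d8)) * z) | x y z.
        x \<in> S \<and> y \<in> S \<and> z \<in> S}) \<le> L * real (card S)"
begin

lemma card_S: "0 < real (card S)" using S by (simp add: card_gt_0_iff)

lemma frostman_cov:
  assumes "\<delta> \<le> r" "X \<subseteq> S"
  shows "real (card X) \<le> real (cov r X) * (L * r powr s * real (card S))"
  unfolding cov_def
proof (rule card_le_fibers)
  show "finite X" using assms S finite_subset by blast
  fix x assume "x \<in> X"
  have "{y \<in> X. \<lfloor>y / r\<rfloor> = \<lfloor>x / r\<rfloor>} \<subseteq> S \<inter> {of_int \<lfloor>x / r\<rfloor> * r..of_int \<lfloor>x / r\<rfloor> * r + r}"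
  proof safe
    fix y assume "y \<in> X" and e: "\<lfloor>y / r\<rfloor> = \<lfloor>x / r\<rfloor>"
    have "of_int \<lfloor>x / r\<rfloor> \<le> y / r" "y / r \<le> of_int \<lfloor>x / r\<rfloor> + 1" unfolding e[symmetric] by linarith+
    then show "y \<in> {of_int \<lfloor>x / r\<rfloor> * r..of_int \<lfloor>x / r\<rfloor> * r + r}"
      using assms \<delta> by (simp add: field_simps)
  qed (use assms in auto)
  then have "real (card {y \<in> X. \<lfloor>y / r\<rfloor> = \<lfloor>x / r\<rfloor>}) \<le> real (card (S \<inter> {of_int \<lfloor>x / r\<rfloor> * r..of_int \<lfloor>x / r\<rfloor> * r + r}))"
    using S by (simp add: card_mono)
  also have "\<dots> \<le> L * r powr s * real (card S)" by (rule frostman[OF assms(1)])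
  finally show "real (card {y \<in> X. \<lfloor>y / r\<rfloor> = \<lfloor>x / r\<rfloor>}) \<le> L * r powr s * real (card S)" .
qed

text \<open>With \<open>v = d - d'\<close> the set \<open>v S\<close> has length at most
  \<open>v\<close>, so \<open>cov_sum_lower\<close> bounds
  \<open>cov v S * cov (\<delta> / v) S\<close> by the size of \<open>S + v S\<close>.
  Non-concentration bounds the second factor from below. The \<open>25\<close> stems from two
  passages to separated subsets, and \<open>L ^ 3\<close> from one use each of
  \<open>slopes\<close>, \<open>card_upper\<close> and \<open>frostman\<close>.\<close>

lemma cov_difference:
  assumes "d \<in> S" "d' \<in> S" "d' < d"
  shows "real (cov (d - d') S) \<le> 25 * L ^ 3 * (d - d') powr (- s)"
proof -
  define v where "v = d - d'"
  have v: "0 < v" "v \<le> 1" "\<delta> \<le> v"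
  proof -
    have "d \<in> {0..1}" "d' \<in> {0..1}" using assms S by blast+
    then show "0 < v" "v \<le> 1" using assms by (auto simp: v_def)
    have "\<delta> \<le> \<bar>d - d'\<bar>" using sepS assms unfolding separated_def by force
    then show "\<delta> \<le> v" using assms by (simp add: v_def)
  qed
  define Z where "Z = (*) v ` S"
  have finZ: "finite Z" using S by (simp add: Z_def)
  have Z01: "Z \<subseteq> {0..0 + v}"
  proof
    fix z assume "z \<in> Z"
    then obtain x where "x \<in> {0..1}" "z = v * x" using S(3) by (auto simp: Z_def)
    then show "z \<in> {0..0 + v}" using v by (simp add: mult_left_le)
  qed
  obtain P where P: "P \<subseteq> S" "separated (4 * v) P" "cov v S \<le> 5 * card P"
    using separated_subset[OF S(1) v(1)] by metis
  obtain Q where Q: "Q \<subseteq> Z" "separated (4 * \<delta>) Q" "cov \<delta> Z \<le> 5 * card Q"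
    using separated_subset[OF finZ \<delta>(1)] by metis
  have one: "1 \<le> real (card (S \<inter> {x - \<delta>..x + \<delta>}))" if "x \<in> P" for x
  proof -
    have "x \<in> S \<inter> {x - \<delta>..x + \<delta>}" using that P \<delta> by auto
    then have "card (S \<inter> {x - \<delta>..x + \<delta>}) > 0" using S by (auto simp: card_gt_0_iff)
    then show ?thesis by linarith
  qed
  have "real (card P) * real (card Q) * 1 \<le> real (cov \<delta> {x + z | x z. x \<in> S \<and> z \<in> Z})"
    by (rule cov_sum_lower[OF S(1) finZ sepS \<delta>(1) order_refl v(3) P(1,2) one Q(1,2) Z01])
  also have "{x + z | x z. x \<in> S \<and> z \<in> Z} =
      {x + (((d - d') + (d - d)) * y + ((d - d) + (d - d)) * z) | x y z. x \<in> S \<and> y \<in> S \<and> z \<in> S}"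
    using assms by (auto simp: Z_def v_def)
  also have "real (cov \<delta> \<dots>) \<le> L * real (card S)" by (rule slopes) (use assms in auto)
  finally have PQ: "real (card P) * real (card Q) \<le> L * real (card S)" by simp
  have "real (cov v S) * real (cov (\<delta> / v) S) \<le> (5 * real (card P)) * (5 * real (card Q))"
    using P(3) Q(3) cov_scale[OF v(1), of \<delta> S] unfolding Z_def by (intro mult_mono) auto
  then have prod: "real (cov v S) * real (cov (\<delta> / v) S) \<le> 25 * L * real (card S)" using PQ by simp
  have "real (card S) \<le> real (cov (\<delta> / v) S) * (L * (\<delta> / v) powr s * real (card S))"
    by (rule frostman_cov) (use v \<delta> in \<open>auto simp: le_divide_eq\<close>)
  then have "1 \<le> real (cov (\<delta> / v) S) * (L * (\<delta> / v) powr s)" using card_S by (simp add: field_simps)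
  then have "real (cov v S) \<le> real (cov v S) * (real (cov (\<delta> / v) S) * (L * (\<delta> / v) powr s))"
    using mult_left_mono[of 1 _ "real (cov v S)"] by simp
  also have "\<dots> = (real (cov v S) * real (cov (\<delta> / v) S)) * (L * (\<delta> / v) powr s)" by simp
  also have "\<dots> \<le> (25 * L * real (card S)) * (L * (\<delta> / v) powr s)"
    using prod L by (intro mult_right_mono) auto
  also have "\<dots> \<le> (25 * L * (L * \<delta> powr (- s))) * (L * (\<delta> / v) powr s)"
    using card_upper L by (intro mult_right_mono mult_left_mono) auto
  also have "\<dots> = 25 * L ^ 3 * v powr (- s)"
    using v \<delta> by (simp add: powr_divide powr_minus field_simps power3_eq_cube)
  finally show ?thesis by (simp add: v_def)
qed

text \<open>Regularity at every scale: the smallest difference exceeding \<open>w\<close> replaces \<open>w\<close>.\<close>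

lemma cov_upper:
  assumes w: "0 < w" "w \<le> 1"
  shows "real (cov w S) \<le> 50 * L ^ 3 * w powr (- s)"
proof -
  define V where "V = {v. w < v \<and> (\<exists>d\<in>S. \<exists>d'\<in>S. v = d - d')}"
  have "finite {d - d' | d d'. d \<in> S \<and> d' \<in> S}" using S by (intro finite_image_set2) auto
  then have finV: "finite V" by (rule rev_finite_subset) (auto simp: V_def)
  have L3: "1 \<le> L ^ 3" using L by simp
  show ?thesis
  proof (cases "V = {}")
    case True
    have "\<bar>x - y\<bar> \<le> w" if "x \<in> S" "y \<in> S" for x y
    proof (rule ccontr)
      assume "\<not> \<bar>x - y\<bar> \<le> w"
      then have "x - y \<in> V \<or> y - x \<in> V" using that by (auto simp: V_def abs_if split: if_splits)
      then show False using True by blast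
    qed
    then have "cov w S \<le> 2" by (intro cov_le_2 S w)
    then have "real (cov w S) \<le> 2" by simp
    also have "2 \<le> 50 * (L ^ 3 * w powr (- s))"
    proof -
      have "1 \<le> w powr (- s)"
        using powr_mono'[of "- s" 0 w] w s by (simp)
      then have "1 * 1 \<le> L ^ 3 * w powr (- s)" using L3 L by (intro mult_mono) auto
      then show ?thesis by linarith
    qed
    finally show ?thesis by simp
  next
    case False
    define v where "v = Min V"
    have "v \<in> V" using Min_in[OF finV False] by (simp add: v_def)
    then obtain d d' where d: "d \<in> S" "d' \<in> S" "v = d - d'" and wv: "w < v" by (auto simp: V_def)
    \<comment> \<open>No difference of \<open>S\<close> lies strictly between \<open>w\<close> and
      \<open>v\<close>, so the part of \<open>S\<close> in a \<open>v\<close>-cell has diameter at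
      most \<open>w\<close> and meets at most two \<open>w\<close>-cells.\<close>
    have near: "\<bar>x - y\<bar> \<le> w" if "x \<in> S" "y \<in> S" "\<lfloor>x / v\<rfloor> = \<lfloor>y / v\<rfloor>" for x y
    proof (rule ccontr)
      assume n: "\<not> \<bar>x - y\<bar> \<le> w"
      have "\<bar>x - y\<bar> < v" using floor_div_eqD that(3) w wv by auto
      moreover have "\<bar>x - y\<bar> \<in> V" using n that(1,2) by (auto simp: V_def abs_if split: if_splits)
      then have "v \<le> \<bar>x - y\<bar>" using finV by (simp add: v_def)
      ultimately show False by simp
    qed
    have "cov w S \<le> 2 * cov v S"
      unfolding cov_def
    proof (rule card_image_le_fibers[OF S(1)])
      fix x assume "x \<in> S"
      have "cov w {y \<in> S. \<lfloor>y / v\<rfloor> = \<lfloor>x / v\<rfloor>} \<le> 2"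
        using S w near by (intro cov_le_2) auto
      then show "card ((\<lambda>x. \<lfloor>x / w\<rfloor>) ` {y \<in> S. \<lfloor>y / v\<rfloor> = \<lfloor>x / v\<rfloor>}) \<le> 2" by (simp add: cov_def)
    qed
    then have "real (cov w S) \<le> 2 * real (cov v S)" by simp
    also have "\<dots> \<le> 2 * (25 * L ^ 3 * v powr (- s))"
      using cov_difference[of d d'] d wv w by simp
    also have "\<dots> \<le> 2 * (25 * L ^ 3 * w powr (- s))"
      using L wv w s by (intro mult_left_mono powr_mono2') auto
    finally show ?thesis by simp
  qed
qed

text \<open>A quotient \<open>u / v\<close> of differences has small \<open>S + (u / v) S\<close> at every scale \<open>D \<ge> \<delta> / v\<close>.
  The sum \<open>S + (v S + u S)\<close> controls this only through the points of \<open>S\<close> around which \<open>S\<close> is as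
  dense at scale \<open>v D\<close> as it is on average; regularity bounds that average from below.\<close>

lemma cov_quotient_slope:
  assumes d: "{d1, d2, d3, d4, d5, d6, d7, d8} \<subseteq> S"
    and v: "v = (d1 - d2) + (d3 - d4)" and u: "u = (d5 - d6) + (d7 - d8)"
    and uv: "0 < v" "0 \<le> u" "u \<le> v"
    and D: "0 < D" "D \<le> 1 / 2" "\<delta> \<le> v * D"
  shows "real (cov D {x + u / v * y | x y. x \<in> S \<and> y \<in> S}) \<le> 10000 * L ^ 5 * D powr (- s)"
proof -
  define X where "X = {x + u / v * y | x y. x \<in> S \<and> y \<in> S}"
  define w where "w = v * D"
  have "v \<le> 2"
  proof -
    have "d1 \<le> 1" "d3 \<le> 1" "0 \<le> d2" "0 \<le> d4" using d S(3) by auto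
    then show ?thesis using v by linarith
  qed
  then have w: "0 < w" "\<delta> \<le> w" "w \<le> 2 * v" "w \<le> 1"
    using D uv mult_mono[of v 2 D "1 / 2"] mult_left_mono[of D "1 / 2" v] by (auto simp: w_def)
  define Z where "Z = {v * x + u * y | x y. x \<in> S \<and> y \<in> S}"
  have finZ: "finite Z" and finX: "finite X" unfolding Z_def X_def using S by (auto intro: finite_image_set2)
  have ZX: "Z = (*) v ` X"
  proof (intro equalityI subsetI)
    fix z assume "z \<in> Z"
    then obtain x y where "x \<in> S" "y \<in> S" "z = v * (x + u / v * y)" using uv by (auto simp: Z_def field_simps)
    then show "z \<in> (*) v ` X" unfolding X_def by blast
  next
    fix z assume "z \<in> (*) v ` X"
    then obtain x y where "x \<in> S" "y \<in> S" "z = v * (x + u / v * y)" by (auto simp: X_def)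
    moreover from this have "z = v * x + u * y" using uv by (simp add: distrib_left)
    ultimately show "z \<in> Z" unfolding Z_def by blast
  qed
  have Z02: "Z \<subseteq> {0..0 + 2 * v}"
  proof
    fix z assume "z \<in> Z"
    then obtain x y where xy: "x \<in> {0..1}" "y \<in> {0..1}" "z = v * x + u * y"
      using S(3) unfolding Z_def by blast
    then have "0 \<le> v * x" "0 \<le> u * y" "v * x \<le> v * 1" "u * y \<le> v * 1"
      using uv xy mult_mono[of u v y 1] mult_left_mono[of x 1 v] by auto
    then show "z \<in> {0..0 + 2 * v}" using xy by auto
  qed
  obtain Q where Q: "Q \<subseteq> Z" "separated (4 * w) Q" "cov w Z \<le> 5 * card Q"
    using separated_subset[OF finZ w(1)] by metis
  have covZ: "cov w Z = cov D X"
    unfolding ZX cov_scale[OF uv(1)] using uv by (simp add: w_def)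
  define n where "n = real (card S)"
  \<comment> \<open>Half of the average number of points per \<open>w\<close>-cell: the points with
    sparser neighbourhoods make up at most half of \<open>S\<close>.\<close>
  define m where "m = n / (2 * real (cov w S))"
  have n: "0 < n" using card_S by (simp add: n_def)
  have cw: "0 < real (cov w S)" using S by (simp add: cov_def card_gt_0_iff)
  have m: "n * w powr s \<le> 100 * L ^ 3 * m"
  proof -
    have "real (cov w S) * w powr s \<le> 50 * L ^ 3"
      using mult_right_mono[OF cov_upper[OF w(1,4)], of "w powr s"] w(1)
      by (simp add: mult.assoc powr_add[symmetric])
    then have "n * (real (cov w S) * w powr s) \<le> n * (50 * L ^ 3)" using n by (intro mult_left_mono) auto
    then show ?thesis using cw by (simp add: m_def field_simps)
  qed
  define S' where "S' = {x\<in>S. m \<le> real (card (S \<inter> {x - w..x + w}))}"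
  have S': "S' \<subseteq> S" "finite S'" using S by (auto simp: S'_def)
  have "real (card (S - S')) \<le> real (cov w (S - S')) * m"
    unfolding cov_def
  proof (rule card_le_fibers)
    fix x assume x: "x \<in> S - S'"
    have "{y \<in> S - S'. \<lfloor>y / w\<rfloor> = \<lfloor>x / w\<rfloor>} \<subseteq> S \<inter> {x - w..x + w}"
      using floor_div_eqD[OF w(1)] by (fastforce simp: abs_diff_le_iff abs_less_iff)
    then have "card {y \<in> S - S'. \<lfloor>y / w\<rfloor> = \<lfloor>x / w\<rfloor>} \<le> card (S \<inter> {x - w..x + w})"
      using S by (intro card_mono) auto
    then show "real (card {y \<in> S - S'. \<lfloor>y / w\<rfloor> = \<lfloor>x / w\<rfloor>}) \<le> m"
      using x by (auto simp: S'_def)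
  qed (use S in auto)
  also have "\<dots> \<le> real (cov w S) * m"
    using cov_mono[of S "S - S'" w] S n by (intro mult_right_mono) (auto simp: m_def)
  also have "\<dots> = n / 2" using cw by (simp add: m_def)
  finally have "n / 2 \<le> real (card S')"
    using S' S by (simp add: card_Diff_subset n_def of_nat_diff card_mono)
  also have "\<dots> \<le> real (cov (2 * v) S') * (L * (2 * v) powr s * n)"
    unfolding n_def by (rule frostman_cov) (use S' w in auto)
  finally have S'low: "1 / 2 \<le> real (cov (2 * v) S') * (L * (2 * v) powr s)"
    using n by (simp add: field_simps)
  \<comment> \<open>The coarse scale is \<open>2 * v\<close>, the length of the interval containing
    \<open>Z\<close>; this uses \<open>u \<le> v\<close>.\<close>
  obtain P where P: "P \<subseteq> S'" "separated (4 * (2 * v)) P" "cov (2 * v) S' \<le> 5 * card P"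
    using separated_subset[OF S'(2), of "2 * v"] uv by auto
  have "real (card P) * real (card Q) * m \<le> real (cov \<delta> {x + z | x z. x \<in> S \<and> z \<in> Z})"
    by (rule cov_sum_lower[OF S(1) finZ sepS \<delta>(1) w(2,3) _ P(2) _ Q(1,2) Z02]) (use P S' in \<open>auto simp: S'_def\<close>)
  also have "{x + z | x z. x \<in> S \<and> z \<in> Z} =
      {x + (((d1 - d2) + (d3 - d4)) * y + ((d5 - d6) + (d7 - d8)) * z) | x y z. x \<in> S \<and> y \<in> S \<and> z \<in> S}"
    unfolding Z_def v u by blast
  also have "real (cov \<delta> \<dots>) \<le> L * n" unfolding n_def by (rule slopes[OF d])
  finally have PQ: "real (card P) * real (card Q) * m \<le> L * n" .
  have P1: "1 \<le> 10 * L * (2 * v) powr s * real (card P)"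
  proof -
    have "1 / 2 \<le> (5 * real (card P)) * (L * (2 * v) powr s)"
    proof -
      have "real (cov (2 * v) S') * (L * (2 * v) powr s) \<le> (5 * real (card P)) * (L * (2 * v) powr s)"
        using P(3) L by (intro mult_right_mono) auto
      then show ?thesis using S'low by linarith
    qed
    then show ?thesis by (simp add: field_simps)
  qed
  have "real (card Q) * (n * w powr s) \<le> real (card Q) * (100 * L ^ 3 * m)"
    using m by (intro mult_left_mono) auto
  also have "\<dots> \<le> (10 * L * (2 * v) powr s * real (card P)) * (real (card Q) * (100 * L ^ 3 * m))"
    using P1 L n mult_right_mono[OF P1, of "real (card Q) * (100 * L ^ 3 * m)"] by (simp add: m_def)
  also have "\<dots> = 1000 * L ^ 4 * (2 * v) powr s * (real (card P) * real (card Q) * m)"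
    by (simp add: eval_nat_numeral)
  also have "\<dots> \<le> 1000 * L ^ 4 * (2 * v) powr s * (L * n)"
    using PQ L by (intro mult_left_mono) auto
  finally have "n * (real (card Q) * w powr s) \<le> n * (1000 * L ^ 5 * (2 * v) powr s)"
    by (simp add: eval_nat_numeral mult_ac)
  then have "real (card Q) * w powr s \<le> 1000 * L ^ 5 * (2 * v) powr s" using n by simp
  then have "real (card Q) * (v powr s * D powr s) \<le> 1000 * L ^ 5 * (2 powr s * v powr s)"
    using uv D by (simp add: w_def powr_mult)
  then have "real (card Q) * D powr s \<le> 1000 * L ^ 5 * 2 powr s"
    using uv by (simp add: field_simps)
  also have "\<dots> \<le> 1000 * L ^ 5 * 2"
    using L s powr_mono[of s 1 "2::real"] by (intro mult_left_mono) auto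
  finally have "real (card Q) \<le> 2000 * L ^ 5 * D powr (- s)"
    using D by (simp add: powr_minus field_simps)
  then show ?thesis using Q(3) unfolding covZ X_def by simp
qed

end

lemma card_Int_abs_le:
  fixes S :: "real set"
  assumes "finite S" "\<And>x. x \<in> X \<Longrightarrow> x \<in> S \<and> \<bar>x - c\<bar> \<le> l"
  shows "card X \<le> card (S \<inter> {c - l..c - l + 2 * l})"
proof -
  have "X \<subseteq> S \<inter> {c - l..c - l + 2 * l}"
  proof
    fix x assume "x \<in> X"
    then have "x \<in> S" "\<bar>x - c\<bar> \<le> l" using assms(2) by blast+
    then show "x \<in> S \<inter> {c - l..c - l + 2 * l}" by auto
  qed
  then show ?thesis using assms(1) by (intro card_mono) auto
qed

section \<open>Gaps in the set of quotients, and density of the quotients\<close>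

context slope_config
begin

lemma frostman_abs:
  assumes "\<And>x. x \<in> X \<Longrightarrow> x \<in> S \<and> \<bar>x - c\<bar> \<le> l" "\<delta> \<le> 2 * l"
  shows "real (card X) \<le> L * (2 * l) powr s * real (card S)"
  using card_Int_abs_le[OF S(1) assms(1)] frostman[OF assms(2), of "c - l"] by (smt (verit) of_nat_mono)

text \<open>Suppose two pairs have images in the same \<open>D\<close>-cell and second coordinates
  at least \<open>r\<close> apart. Dividing by that distance puts \<open>t\<close> within
  \<open>D / r \<le> \<rho>\<close> of a quotient, contrary to \<open>gap\<close>. Hence a cell only
  contains pairs whose second coordinates differ by at most \<open>r\<close> and whose first
  coordinates differ by at most \<open>2 * r\<close>, and non-concentration in both coordinates
  bounds their number.\<close>

lemma cov_gap_slope: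
  assumes r: "\<delta> \<le> r" "0 < D" "D \<le> r" "D \<le> \<rho> * r" and t: "0 \<le> t" "t \<le> 1"
    and gap: "\<And>d1 d2 d3 d4. {d1, d2, d3, d4} \<subseteq> S \<Longrightarrow> r \<le> d3 - d4 \<Longrightarrow> \<rho> < \<bar>t - (d1 - d2) / (d3 - d4)\<bar>"
  shows "1 \<le> real (cov D {x + t * y | x y. x \<in> S \<and> y \<in> S}) * (8 * L\<^sup>2 * r powr (2 * s))"
proof -
  define c where "c = cov D {x + t * y | x y. x \<in> S \<and> y \<in> S}"
  define n where "n = real (card S)"
  have n: "0 < n" using card_S by (simp add: n_def)
  have r0: "0 < r" using r by linarith
  define g where "g = (\<lambda>(x, y). \<lfloor>(x + t * y) / D\<rfloor>)"
  define m where "m = (L * (2 * (2 * r)) powr s * n) * (L * (2 * r) powr s * n)"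
  have "real (card (S \<times> S)) \<le> real (card (g ` (S \<times> S))) * m"
  proof (rule card_le_fibers)
    fix p assume p: "p \<in> S \<times> S"
    obtain x y where xy: "p = (x, y)" "x \<in> S" "y \<in> S" using p by auto
    define F where "F = {q \<in> S \<times> S. g q = g p}"
    have F: "\<bar>x' - x\<bar> \<le> 2 * r \<and> \<bar>y' - y\<bar> \<le> r" if q: "(x', y') \<in> F" for x' y'
    proof -
      have S': "x' \<in> S" "y' \<in> S" and "\<lfloor>(x' + t * y') / D\<rfloor> = \<lfloor>(x + t * y) / D\<rfloor>"
        using q xy by (auto simp: F_def g_def)
      then have near: "\<bar>(x' + t * y') - (x + t * y)\<bar> < D" using floor_div_eqD r(2) by blast
      have no: False if e: "e \<in> S" "e' \<in> S" "f \<in> S" "f' \<in> S" "r \<le> f - f'"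
        "\<bar>(e - e') + t * (f - f')\<bar> < D" for e e' f f'
      proof -
        have "t - (e' - e) / (f - f') = ((e - e') + t * (f - f')) / (f - f')"
          using e(5) r0 by (simp add: field_simps)
        then have "\<bar>t - (e' - e) / (f - f')\<bar> = \<bar>(e - e') + t * (f - f')\<bar> / (f - f')"
          using e(5) r0 by (simp add: abs_divide)
        also have "\<dots> \<le> D / (f - f')" using e(5,6) r0 by (intro divide_right_mono) auto
        also have "\<dots> \<le> D / r" using e(5) r0 r(2) by (intro divide_left_mono) auto
        also have "\<dots> \<le> \<rho>" using r(4) r0 by (simp add: divide_le_eq)
        finally show False using gap[of e' e f f'] e by auto
      qed
      have yy: "\<bar>y' - y\<bar> < r"
      proof (rule ccontr)
        assume "\<not> \<bar>y' - y\<bar> < r"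
        then consider "r \<le> y' - y" | "r \<le> y - y'" by linarith
        then show False
        proof cases
          case 1
          then show False using no[OF S'(1) xy(2) S'(2) xy(3)] near by (simp add: algebra_simps)
        next
          case 2
          then show False using no[OF xy(2) S'(1) xy(3) S'(2)] near
            by (simp add: algebra_simps abs_minus_commute)
        qed
      qed
      have "\<bar>t * (y' - y)\<bar> \<le> 1 * \<bar>y' - y\<bar>" unfolding abs_mult using t by (intro mult_right_mono) auto
      then have "\<bar>x' - x\<bar> \<le> D + r" using near yy by (simp add: algebra_simps)
      then show ?thesis using yy r(3) by simp
    qed
    have "F \<subseteq> fst ` F \<times> snd ` F" by (force simp: image_iff)
    moreover have finF: "finite F" unfolding F_def using S by auto
    ultimately have "card F \<le> card (fst ` F) * card (snd ` F)"
      using card_mono[of "fst ` F \<times> snd ` F" F] by (simp add: card_cartesian_product)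
    then have "real (card F) \<le> real (card (fst ` F)) * real (card (snd ` F))"
      by (metis of_nat_le_iff of_nat_mult)
    also have "\<dots> \<le> m" unfolding m_def n_def
    proof (intro mult_mono)
      show "real (card (fst ` F)) \<le> L * (2 * (2 * r)) powr s * real (card S)"
        by (rule frostman_abs[of _ x]) (use F r r0 in \<open>auto simp: F_def\<close>)
      show "real (card (snd ` F)) \<le> L * (2 * r) powr s * real (card S)"
        by (rule frostman_abs[of _ y]) (use F r r0 in \<open>auto simp: F_def\<close>)
    qed (use L in auto)
    finally show "real (card {q \<in> S \<times> S. g q = g p}) \<le> m" by (simp add: F_def)
  qed (use S in auto)
  moreover have "card (g ` (S \<times> S)) = c"
  proof -
    have "(\<lambda>x. \<lfloor>x / D\<rfloor>) ` {x + t * y | x y. x \<in> S \<and> y \<in> S} = g ` (S \<times> S)"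
      by (force simp: g_def image_iff)
    then show ?thesis by (simp add: c_def cov_def)
  qed
  ultimately have "n * n \<le> real c * m"
    by (simp add: n_def card_cartesian_product)
  also have "m = (n * n) * (L\<^sup>2 * (8 powr s * r powr (2 * s)))"
  proof -
    have e8: "(8::real) powr s = 4 powr s * 2 powr s" using powr_mult[of 4 2 s] by simp
    have "(2 * (2 * r)) powr s * (2 * r) powr s = ((2 * (2 * r)) * (2 * r)) powr s"
      using r0 by (simp add: powr_mult e8)
    also have "(2 * (2 * r)) * (2 * r) = 8 * (r * r)" by simp
    also have "(8 * (r * r)) powr s = 8 powr s * r powr (2 * s)"
      using r0 by (simp add: powr_mult powr_add[symmetric])
    finally show ?thesis unfolding m_def by (simp add: power2_eq_square mult_ac)
  qed
  finally have "n * n * 1 \<le> n * n * (real c * (L\<^sup>2 * (8 powr s * r powr (2 * s))))"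
    by (simp add: mult_ac)
  then have "1 \<le> real c * (L\<^sup>2 * (8 powr s * r powr (2 * s)))"
    using n by simp
  also have "\<dots> \<le> real c * (L\<^sup>2 * (8 * r powr (2 * s)))"
    using s powr_mono[of s 1 "8::real"] by (intro mult_left_mono mult_right_mono) auto
  finally show ?thesis by (simp add: c_def mult_ac)
qed

end

text \<open>Binary expansion: \<open>z\<close> is half of \<open>2 z\<close> or half of
  \<open>(2 z - 1) + 1\<close>, so an approximation of the doubled point yields one of
  \<open>z\<close>. Each step halves the error and adds \<open>\<rho>\<close>, a recursion with
  fixed point \<open>2 * \<rho>\<close>; the third \<open>\<rho>\<close> absorbs the remaining
  \<open>(1 / 2) ^ k\<close>.\<close>

lemma dense_of_halves:
  fixes Q :: "real set" and \<rho> z :: real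
  assumes Q: "0 \<in> Q" "1 \<in> Q" and rho: "0 < \<rho>"
    and half: "\<And>y. y \<in> Q \<Longrightarrow> 0 \<le> y \<Longrightarrow> y \<le> 1 \<Longrightarrow> \<exists>q\<in>Q. \<bar>y / 2 - q\<bar> \<le> \<rho>"
      "\<And>y. y \<in> Q \<Longrightarrow> 0 \<le> y \<Longrightarrow> y \<le> 1 \<Longrightarrow> \<exists>q\<in>Q. \<bar>(y + 1) / 2 - q\<bar> \<le> \<rho>"
    and z: "0 \<le> z" "z \<le> 1"
  shows "\<exists>q\<in>Q. 0 \<le> q \<and> q \<le> 1 \<and> \<bar>z - q\<bar> \<le> 3 * \<rho>"
proof -
  \<comment> \<open>An approximation outside the unit interval is replaced by the endpoint next to
    it, which belongs to \<open>Q\<close> and is closer to \<open>w\<close>.\<close>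
  have clip: "\<exists>q\<in>Q. 0 \<le> q \<and> q \<le> 1 \<and> \<bar>w - q\<bar> \<le> e" if "0 \<le> w" "w \<le> 1" "q \<in> Q" "\<bar>w - q\<bar> \<le> e" for w q e
  proof -
    consider "q < 0" | "0 \<le> q" "q \<le> 1" | "1 < q" by linarith
    then show ?thesis
    proof cases
      case 1 then show ?thesis using that Q by (intro bexI[of _ 0]) auto
    next
      case 2 then show ?thesis using that by auto
    next
      case 3 then show ?thesis using that Q by (intro bexI[of _ 1]) auto
    qed
  qed
  have "\<forall>z. 0 \<le> z \<longrightarrow> z \<le> 1 \<longrightarrow> (\<exists>q\<in>Q. 0 \<le> q \<and> q \<le> 1 \<and> \<bar>z - q\<bar> \<le> (1 / 2) ^ k + 2 * \<rho>)" for k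
  proof (induction k)
    case 0
    show ?case using Q rho by (auto intro!: bexI[of _ 0])
  next
    case (Suc k)
    show ?case
    proof (intro allI impI)
      fix z :: real assume z: "0 \<le> z" "z \<le> 1"
      show "\<exists>q\<in>Q. 0 \<le> q \<and> q \<le> 1 \<and> \<bar>z - q\<bar> \<le> (1 / 2) ^ Suc k + 2 * \<rho>"
      proof (cases "z \<le> 1 / 2")
        case True
        then have "0 \<le> 2 * z" "2 * z \<le> 1" using z by auto
        then obtain y where y: "y \<in> Q" "0 \<le> y" "y \<le> 1" "\<bar>2 * z - y\<bar> \<le> (1 / 2) ^ k + 2 * \<rho>" using Suc by blast
        obtain q where q: "q \<in> Q" "\<bar>y / 2 - q\<bar> \<le> \<rho>" using half(1) y by blast
        have "\<bar>z - y / 2\<bar> \<le> (1 / 2) ^ Suc k + \<rho>" using y(4) by (simp add: abs_le_iff field_simps)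
        then have "\<bar>z - q\<bar> \<le> (1 / 2) ^ Suc k + 2 * \<rho>" using q(2) by linarith
        then show ?thesis using clip z q by blast
      next
        case False
        then have "0 \<le> 2 * z - 1" "2 * z - 1 \<le> 1" using z by auto
        then obtain y where y: "y \<in> Q" "0 \<le> y" "y \<le> 1" "\<bar>2 * z - 1 - y\<bar> \<le> (1 / 2) ^ k + 2 * \<rho>" using Suc by blast
        obtain q where q: "q \<in> Q" "\<bar>(y + 1) / 2 - q\<bar> \<le> \<rho>" using half(2) y by blast
        have "\<bar>z - (y + 1) / 2\<bar> \<le> (1 / 2) ^ Suc k + \<rho>" using y(4) by (simp add: abs_le_iff field_simps)
        then have "\<bar>z - q\<bar> \<le> (1 / 2) ^ Suc k + 2 * \<rho>" using q(2) by linarith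
        then show ?thesis using clip z q by blast
      qed
    qed
  qed
  moreover obtain k where "(1 / 2 :: real) ^ k < \<rho>" using real_arch_pow_inv[OF rho, of "1 / 2"] by auto
  ultimately obtain q where "q \<in> Q" "0 \<le> q" "q \<le> 1" "\<bar>z - q\<bar> \<le> (1 / 2) ^ k + 2 * \<rho>" using z by blast
  then show ?thesis using \<open>(1 / 2 :: real) ^ k < \<rho>\<close> by (intro bexI[of _ q]) auto
qed

text \<open>Cauchy-Schwarz over the cells: the squares of the fibre sizes add up to the number of
  pairs in a common cell, and such pairs have values at distance below \<open>r\<close>.\<close>

lemma card_le_energy:
  fixes f :: "'a \<Rightarrow> real"
  assumes "finite A" "0 < r"
  shows "(real (card A))\<^sup>2 \<le> real (cov r (f ` A)) * real (card {p \<in> A \<times> A. \<bar>f (fst p) - f (snd p)\<bar> < r})"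
proof -
  define c where "c = (\<lambda>a. \<lfloor>f a / r\<rfloor>)"
  define I where "I = c ` A"
  define F where "F = (\<lambda>i. {a\<in>A. c a = i})"
  have finI: "finite I" "\<And>i. finite (F i)" using assms by (auto simp: I_def F_def)
  have "real (card A) = (\<Sum>i\<in>I. \<Sum>x\<in>{x. x \<in> A \<and> c x = i}. 1)"
    unfolding I_def using sum.image_gen[OF assms(1), of "\<lambda>_. 1::real" c] by simp
  also have "\<dots> = (\<Sum>i\<in>I. 1 * real (card (F i)))" by (simp add: F_def)
  finally have "(real (card A))\<^sup>2 = (\<Sum>i\<in>I. 1 * real (card (F i)))\<^sup>2" by simp
  also have "\<dots> \<le> (\<Sum>i\<in>I. 1\<^sup>2) * (\<Sum>i\<in>I. (real (card (F i)))\<^sup>2)"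
    by (rule Cauchy_Schwarz_ineq_sum)
  also have "(\<Sum>i\<in>I. 1\<^sup>2) = real (cov r (f ` A))" by (simp add: I_def c_def cov_def image_image)
  also have "(\<Sum>i\<in>I. (real (card (F i)))\<^sup>2) = real (card (\<Union>i\<in>I. F i \<times> F i))"
    by (subst card_UN_disjoint) (auto simp: finI(1) assms(1) F_def card_cartesian_product power2_eq_square)
  also have "card (\<Union>i\<in>I. F i \<times> F i) \<le> card {p \<in> A \<times> A. \<bar>f (fst p) - f (snd p)\<bar> < r}"
  proof (rule card_mono)
    show "(\<Union>i\<in>I. F i \<times> F i) \<subseteq> {p \<in> A \<times> A. \<bar>f (fst p) - f (snd p)\<bar> < r}"
      using floor_div_eqD[OF assms(2)] by (auto simp: F_def c_def)
  qed (use assms in auto)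
  finally show ?thesis by (simp add: mult_left_mono)
qed

context slope_config
begin

definition quads :: "(real \<times> real \<times> real \<times> real) set" where "quads = S \<times> S \<times> S \<times> S"

text \<open>Compares \<open>a + t * c\<close> with \<open>b + t * d\<close>, so counting close
  elements of \<open>quads\<close> gives the energy of \<open>(x, y) \<mapsto> x + t * y\<close> on
  \<open>S \<times> S\<close> at scale \<open>\<rho>\<close>.\<close>

definition close :: "real \<Rightarrow> real \<Rightarrow> real \<times> real \<times> real \<times> real \<Rightarrow> bool" where
  "close \<rho> t = (\<lambda>(a, b, c, d). \<bar>(a - b) + t * (c - d)\<bar> < \<rho>)"

lemma card_quads: "real (card quads) = real (card S) ^ 4" "finite quads"
  using S by (auto simp: quads_def card_cartesian_product eval_nat_numeral)

text \<open>An average over \<open>N\<close> almost equally spaced slopes: pairs with \<open>\<bar>c - d\<bar> \<le> h\<close> are rare, the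
  others put the slope into an interval of length \<open>2 \<rho> / h\<close>.\<close>

lemma exists_slope_small_energy:
  assumes rho: "0 < \<rho>" "\<rho> \<le> 1 / 8" "\<delta> \<le> \<rho>" and h: "\<rho> \<le> h" "h \<le> 1"
    and dense: "\<And>z. 0 \<le> z \<Longrightarrow> z \<le> 1 \<Longrightarrow> \<exists>q\<in>Q. 0 \<le> q \<and> q \<le> 1 \<and> \<bar>z - q\<bar> \<le> 3 * \<rho>"
  obtains q where "q \<in> Q" "0 \<le> q" "q \<le> 1"
    "real (card {p \<in> quads. close \<rho> q p}) \<le> (4 * L\<^sup>2 * h powr s * \<rho> powr s + 32 * \<rho> / h) * real (card S) ^ 4"
proof -
  define n where "n = real (card S)"
  have n: "0 < n" using card_S by (simp add: n_def)
  have h0: "0 < h" using rho h by linarith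
  \<comment> \<open>The targets \<open>8 * \<rho> * j\<close> are met up to
    \<open>3 * \<rho>\<close>, so distinct slopes \<open>q j\<close> stay at least
    \<open>2 * \<rho>\<close> apart.\<close>
  define N where "N = nat \<lfloor>1 / (8 * \<rho>)\<rfloor>"
  have "1 \<le> 1 / (8 * \<rho>)" using rho by (simp add: field_simps)
  then have N: "1 \<le> N" "real N \<le> 1 / (8 * \<rho>)" "1 / (8 * \<rho>) \<le> 2 * real N"
  proof -
    have k: "1 \<le> \<lfloor>1 / (8 * \<rho>)\<rfloor>" using \<open>1 \<le> 1 / (8 * \<rho>)\<close> by linarith
    then have "real N = of_int \<lfloor>1 / (8 * \<rho>)\<rfloor>" unfolding N_def by linarith
    then show "1 \<le> N" "real N \<le> 1 / (8 * \<rho>)" "1 / (8 * \<rho>) \<le> 2 * real N" using k by linarith+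
  qed
  define q where "q = (\<lambda>j::nat. SOME q. q \<in> Q \<and> 0 \<le> q \<and> q \<le> 1 \<and> \<bar>8 * \<rho> * real j - q\<bar> \<le> 3 * \<rho>)"
  have q: "q j \<in> Q \<and> 0 \<le> q j \<and> q j \<le> 1 \<and> \<bar>8 * \<rho> * real j - q j\<bar> \<le> 3 * \<rho>" if "j < N" for j
  proof -
    have "8 * \<rho> * real j \<le> 8 * \<rho> * real N" using that rho by (intro mult_left_mono) auto
    also have "\<dots> \<le> 1" using N(2) rho by (simp add: field_simps)
    finally have "\<exists>q. q \<in> Q \<and> 0 \<le> q \<and> q \<le> 1 \<and> \<bar>8 * \<rho> * real j - q\<bar> \<le> 3 * \<rho>"
      using dense[of "8 * \<rho> * real j"] rho by (auto simp: Bex_def)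
    then show ?thesis unfolding q_def by (rule someI_ex)
  qed
  define small where "small = {p \<in> quads. \<bar>fst (snd (snd p)) - snd (snd (snd p))\<bar> \<le> h}"
  define T where "T = 4 * L\<^sup>2 * h powr s * \<rho> powr s"
  \<comment> \<open>Given \<open>a\<close>, \<open>c\<close> and \<open>d\<close>, the point
    \<open>b\<close> lies in an interval of length \<open>2 * \<rho>\<close>; given
    \<open>c\<close>, the point \<open>d\<close> lies in one of length \<open>2 * h\<close>. Both
    counts hold for every slope.\<close>
  have small: "real (card {p \<in> small. close \<rho> t p}) \<le> T * n ^ 4" for t
  proof -
    define E where "E = {p \<in> small. close \<rho> t p}"
    define f where "f = (\<lambda>(a::real, b::real, c::real, d::real). (a, c, d))"
    define W where "W = {p \<in> S \<times> S. \<bar>snd p - fst p\<bar> \<le> h}"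
    have finE: "finite E" unfolding E_def small_def using card_quads(2) by auto
    have "real (card E) \<le> real (card (f ` E)) * (L * (2 * \<rho>) powr s * n)"
    proof (rule card_le_fibers[OF finE])
      fix p assume "p \<in> E"
      obtain a b c d where p: "p = (a, b, c, d)" by (metis prod_cases4)
      define F where "F = {y \<in> E. f y = f p}"
      have inj: "inj_on (\<lambda>(a, b, c, d). b) F" by (auto simp: F_def f_def p inj_on_def)
      have "real (card ((\<lambda>(a, b, c, d). b) ` F)) \<le> L * (2 * \<rho>) powr s * real (card S)"
      proof (rule frostman_abs)
        fix x assume "x \<in> (\<lambda>(a, b, c, d). b) ` F"
        then have "(a, x, c, d) \<in> E" by (auto simp: F_def f_def p)
        then show "x \<in> S \<and> \<bar>x - (a + t * (c - d))\<bar> \<le> \<rho>"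
          by (auto simp: E_def small_def quads_def close_def)
      qed (use rho in auto)
      then show "real (card {y \<in> E. f y = f p}) \<le> L * (2 * \<rho>) powr s * n"
        using card_image[OF inj] by (simp add: F_def n_def)
    qed
    also have "\<dots> \<le> (n * (n * (L * (2 * h) powr s * n))) * (L * (2 * \<rho>) powr s * n)"
    proof (rule mult_right_mono)
      have W: "real (card W) \<le> real (card (fst ` W)) * (L * (2 * h) powr s * n)"
      proof (rule card_le_fibers)
        fix p assume "p \<in> W"
        define F where "F = {y \<in> W. fst y = fst p}"
        have inj: "inj_on snd F" by (auto simp: F_def inj_on_def)
        have "real (card (snd ` F)) \<le> L * (2 * h) powr s * real (card S)"
          by (rule frostman_abs[of _ "fst p"]) (use rho h in \<open>auto simp: F_def W_def\<close>)
        then show "real (card {y \<in> W. fst y = fst p}) \<le> L * (2 * h) powr s * n"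
          using card_image[OF inj] by (simp add: F_def n_def)
      qed (use S in \<open>auto simp: W_def\<close>)
      have "fst ` W \<subseteq> S" by (auto simp: W_def)
      then have "real (card (fst ` W)) \<le> n" using S by (simp add: n_def card_mono)
      then have W': "real (card W) \<le> n * (L * (2 * h) powr s * n)"
        using L n by (intro order_trans[OF W] mult_right_mono) auto
      have "f ` E \<subseteq> S \<times> W"
        by (auto simp: f_def E_def small_def quads_def W_def abs_minus_commute)
      then have "card (f ` E) \<le> card (S \<times> W)" using S by (intro card_mono) (auto simp: W_def)
      then have "real (card (f ` E)) \<le> n * real (card W)"
        by (simp add: card_cartesian_product n_def flip: of_nat_mult)
      also have "\<dots> \<le> n * (n * (L * (2 * h) powr s * n))" using W' n by (intro mult_left_mono) auto
      finally show "real (card (f ` E)) \<le> n * (n * (L * (2 * h) powr s * n))" .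
    qed (use L n in auto)
    also have "\<dots> = (2 powr s * 2 powr s) * (L\<^sup>2 * h powr s * \<rho> powr s) * n ^ 4"
      using h0 rho by (simp add: powr_mult eval_nat_numeral mult_ac)
    also have "\<dots> \<le> 4 * (L\<^sup>2 * h powr s * \<rho> powr s) * n ^ 4"
    proof (intro mult_right_mono)
      have "2 powr s \<le> (2::real)" using s powr_mono[of s 1 "2::real"] by auto
      then show "2 powr s * 2 powr s \<le> (4::real)" using mult_mono[of "2 powr s" 2 "2 powr s" "2::real"] by auto
    qed auto
    finally show ?thesis by (simp add: E_def T_def mult_ac)
  qed
  have large: "real (card {j \<in> {..<N}. close \<rho> (q j) p}) \<le> 2 / h" if p: "p \<in> quads - small" for p
  proof -
    obtain a b c d where pe: "p = (a, b, c, d)" by (metis prod_cases4)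
    have cd: "h < \<bar>c - d\<bar>" using p pe by (auto simp: small_def)
    define J where "J = {j \<in> {..<N}. close \<rho> (q j) p}"
    have diff: "\<bar>real i - real j\<bar> \<le> 1 / h" if ij: "i \<in> J" "j \<in> J" for i j
    proof -
      have c: "\<bar>(a - b) + q i * (c - d)\<bar> < \<rho>" "\<bar>(a - b) + q j * (c - d)\<bar> < \<rho>"
        using ij by (auto simp: J_def close_def pe)
      have "\<bar>q i - q j\<bar> * h \<le> \<bar>q i - q j\<bar> * \<bar>c - d\<bar>" using cd by (intro mult_left_mono) auto
      also have "\<dots> = \<bar>((a - b) + q i * (c - d)) - ((a - b) + q j * (c - d))\<bar>"
        by (simp add: abs_mult[symmetric] algebra_simps)
      also have "\<dots> \<le> 2 * \<rho>" using c by linarith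
      finally have qq: "\<bar>q i - q j\<bar> \<le> 2 * \<rho> / h" using h0 by (simp add: le_divide_eq)
      have "\<bar>8 * \<rho> * real i - q i\<bar> \<le> 3 * \<rho>" "\<bar>8 * \<rho> * real j - q j\<bar> \<le> 3 * \<rho>"
        using q ij by (auto simp: J_def)
      then have "\<bar>8 * \<rho> * real i - 8 * \<rho> * real j\<bar> \<le> 2 * \<rho> / h + 6 * \<rho>" using qq by linarith
      also have "8 * \<rho> * real i - 8 * \<rho> * real j = 8 * \<rho> * (real i - real j)" by (simp add: algebra_simps)
      also have "\<bar>8 * \<rho> * (real i - real j)\<bar> = 8 * \<rho> * \<bar>real i - real j\<bar>" using rho by (simp add: abs_mult)
      also have "2 * \<rho> / h + 6 * \<rho> \<le> 8 * \<rho> * (1 / h)" using h h0 rho by (simp add: field_simps)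
      finally show ?thesis by (rule mult_left_le_imp_le) (use rho in simp)
    qed
    show ?thesis
    proof (cases "J = {}")
      case True
      show ?thesis unfolding J_def[symmetric] True using h0 by simp
    next
      case False
      have finJ: "finite J" by (simp add: J_def)
      have "J \<subseteq> {Min J..Min J + nat \<lfloor>1 / h\<rfloor>}"
      proof
        fix j assume j: "j \<in> J"
        have "real j - real (Min J) \<le> 1 / h" using diff[OF j Min_in[OF finJ False]] by linarith
        then have "int j - int (Min J) \<le> \<lfloor>1 / h\<rfloor>" by (simp add: le_floor_iff)
        then show "j \<in> {Min J..Min J + nat \<lfloor>1 / h\<rfloor>}" using finJ j by auto
      qed
      then have "card J \<le> card {Min J..Min J + nat \<lfloor>1 / h\<rfloor>}" by (intro card_mono) auto
      then have "real (card J) \<le> real (nat \<lfloor>1 / h\<rfloor>) + 1" by simp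
      also have "real (nat \<lfloor>1 / h\<rfloor>) \<le> 1 / h" using h0 by simp
      also have "1 / h + 1 \<le> 2 / h" using h h0 by (simp add: field_simps)
      finally show ?thesis by (simp add: J_def)
    qed
  qed
  have cardsum: "real (card {x\<in>A. P x}) = (\<Sum>x\<in>A. if P x then 1 else 0)" if "finite A" for A :: "'z set" and P
    using that by (simp add: sum.If_cases Int_def)
  define M where "M = (T + 32 * \<rho> / h) * n ^ 4"
  have "\<exists>j<N. real (card {p \<in> quads. close \<rho> (q j) p}) \<le> M"
  proof (rule ccontr)
    assume "\<not> ?thesis"
    then have "M < real (card {p \<in> quads. close \<rho> (q j) p})" if "j < N" for j using that by auto
    then have "(\<Sum>j<N. M) < (\<Sum>j<N. real (card {p \<in> quads. close \<rho> (q j) p}))"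
      using N(1) by (intro sum_strict_mono) (auto simp: lessThan_empty_iff)
    also have "\<dots> \<le> (\<Sum>j<N. real (card {p \<in> small. close \<rho> (q j) p}) + real (card {p \<in> quads - small. close \<rho> (q j) p}))"
    proof (rule sum_mono)
      fix j
      have eq: "{p \<in> quads. close \<rho> (q j) p} = {p \<in> small. close \<rho> (q j) p} \<union> {p \<in> quads - small. close \<rho> (q j) p}"
        by (auto simp: small_def)
      then show "real (card {p \<in> quads. close \<rho> (q j) p}) \<le> real (card {p \<in> small. close \<rho> (q j) p}) + real (card {p \<in> quads - small. close \<rho> (q j) p})"
        by (simp only: eq of_nat_add[symmetric] of_nat_le_iff card_Un_le)
    qed
    also have "\<dots> \<le> (\<Sum>j<N. T * n ^ 4) + (\<Sum>j<N. real (card {p \<in> quads - small. close \<rho> (q j) p}))"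
      unfolding sum.distrib by (intro add_mono sum_mono small order_refl)
    also have "(\<Sum>j<N. real (card {p \<in> quads - small. close \<rho> (q j) p})) = (\<Sum>p\<in>quads - small. real (card {j \<in> {..<N}. close \<rho> (q j) p}))"
      unfolding cardsum[OF finite_Diff[OF card_quads(2)]] cardsum[OF finite_lessThan] by (rule sum.swap)
    also have "\<dots> \<le> (\<Sum>p\<in>quads - small. 2 / h)" by (intro sum_mono large)
    also have "\<dots> = real (card (quads - small)) * (2 / h)" by simp
    also have "\<dots> \<le> n ^ 4 * (2 / h)"
    proof (rule mult_right_mono)
      have "card (quads - small) \<le> card quads" using card_quads(2) by (intro card_mono) auto
      then show "real (card (quads - small)) \<le> n ^ 4" using card_quads(1) by (simp add: n_def flip: of_nat_le_iff)
    qed (use h0 in auto)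
    \<comment> \<open>As \<open>N\<close> is at least \<open>1 / (16 * \<rho>)\<close>, averaging
      over the \<open>N\<close> slopes turns \<open>2 / h\<close> into
      \<open>32 * \<rho> / h\<close>.\<close>
    also have "n ^ 4 * (2 / h) \<le> n ^ 4 * (real N * (32 * \<rho> / h))"
    proof (rule mult_left_mono)
      have "2 \<le> real N * (32 * \<rho>)" using N(3) rho by (simp add: field_simps)
      then have "2 / h \<le> real N * (32 * \<rho>) / h" using h0 by (intro divide_right_mono) auto
      then show "2 / h \<le> real N * (32 * \<rho> / h)" by simp
    qed (use n in auto)
    finally show False by (simp add: M_def algebra_simps)
  qed
  then obtain j where "j < N" "real (card {p \<in> quads. close \<rho> (q j) p}) \<le> M" by blast
  then show ?thesis using q[of j] that[of "q j"] by (simp add: M_def T_def n_def)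
qed

end

context slope_config
begin

text \<open>The scales below satisfy \<open>r * D = \<delta>\<close>, so that \<open>D\<close> is
  admissible for denominators at least \<open>r\<close>, and \<open>\<rho> * r = D\<close>, as a gap
  of width \<open>\<rho>\<close> requires. A gap gives
  \<open>1 \<le> 80000 * L ^ 7 * \<delta> powr (s / 5)\<close>; density gives
  \<open>1 \<le> 360000 * L ^ 7 * \<delta> powr (s * (1 - s) / 10)\<close>, the weaker bound, which
  sets the exponent. In both cases \<open>L ^ 5\<close> comes from \<open>cov_quotient_slope\<close>
  and \<open>L\<^sup>2\<close> from two uses of non-concentration.\<close>

lemma constant_lower_bound: "\<delta> powr (- (s * (1 - s) / 10)) \<le> 1000000 * L ^ 7"
proof -
  define x where "x = s * (1 - s) / 10"
  have x: "0 \<le> x" "x \<le> s / 5" "x \<le> 1"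
  proof -
    have "0 \<le> s * (1 - s)" "s * (1 - s) \<le> s * 1" using s by (auto intro!: mult_left_mono)
    then show "0 \<le> x" "x \<le> s / 5" "x \<le> 1" using s unfolding x_def by linarith+
  qed
  have L7: "1 \<le> L ^ 7" "L \<le> L ^ 7" using L power_increasing[of 1 7 L] by auto
  have le: "\<delta> powr (- x) \<le> \<delta> powr (- y)" if "x \<le> y" for y
    using that \<delta> by (intro powr_mono') auto
  show ?thesis
    unfolding x_def[symmetric]
  \<comment> \<open>Since \<open>32768 = 8 ^ 5\<close>, this ensures
    \<open>\<rho> \<le> 1 / 8\<close>; for larger \<open>\<delta>\<close> the numerical constant
    suffices.\<close>
  proof (cases "\<delta> \<le> 1 / 32768")
    case False
    have "\<delta> powr (- x) \<le> \<delta> powr (- 1)" by (rule le[OF x(3)])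
    also have "\<dots> \<le> 1000000 * 1" using False \<delta> by (simp add: powr_minus_divide field_simps)
    also have "\<dots> \<le> 1000000 * L ^ 7" using L7 by (intro mult_left_mono) auto
    finally show "\<delta> powr (- x) \<le> 1000000 * L ^ 7" .
  next
    case True
    define r where "r = \<delta> powr (2 / 5)"
    define D where "D = \<delta> powr (3 / 5)"
    define \<rho> where "\<rho> = \<delta> powr (1 / 5)"
    have pos: "0 < r" "0 < D" "0 < \<rho>" using \<delta> by (auto simp: r_def D_def \<rho>_def)
    have rD: "r * D = \<delta>" and \<rho>r: "\<rho> * r = D" and DD: "D * 1 \<le> \<rho> * 1"
      and Dr: "D \<le> r" and dr: "\<delta> \<le> r" and d\<rho>: "\<delta> \<le> r * \<rho>" and d\<rho>': "\<delta> \<le> \<rho>"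
      using \<delta> powr_mono'[of "2 / 5" 1 \<delta>] powr_mono'[of "1 / 5" 1 \<delta>] powr_mono'[of "3 / 5" 1 \<delta>]
      by (auto simp: r_def D_def \<rho>_def powr_add[symmetric] intro!: powr_mono')
    have rho8: "\<rho> \<le> 1 / 8"
    proof -
      have "\<rho> \<le> (1 / 32768) powr (1 / 5)" unfolding \<rho>_def using True \<delta> by (intro powr_mono2) auto
      also have "(1 / 32768 :: real) = (1 / 8) powr 5" by (simp add: powr_numeral power_divide)
      also have "\<dots> powr (1 / 5) = 1 / 8" by (simp only: powr_powr) simp
      finally show ?thesis .
    qed
    \<comment> \<open>Small denominators are excluded because the quotient bound only holds at
      scales above \<open>\<delta>\<close> divided by the denominator. If no difference reaches
      \<open>r\<close>, then \<open>S\<close> is so concentrated that the Frostman bound alone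
      finishes.\<close>
    define Q where "Q = {(d1 - d2) / (d3 - d4) | d1 d2 d3 d4. {d1, d2, d3, d4} \<subseteq> S \<and> r \<le> d3 - d4}"
    show "\<delta> powr (- x) \<le> 1000000 * L ^ 7"
    proof (cases "\<exists>d\<in>S. \<exists>d'\<in>S. r \<le> d - d'")
      case False
      obtain c where c: "c \<in> S" using S by auto
      have "real (card S) \<le> L * (2 * r) powr s * real (card S)"
      proof (rule frostman_abs)
        fix y assume "y \<in> S"
        then show "y \<in> S \<and> \<bar>y - c\<bar> \<le> r" using False c by (force simp: abs_le_iff)
      qed (use dr pos in linarith)
      then have "1 \<le> L * (2 powr s * r powr s)" using card_S pos by (simp add: powr_mult)
      also have "\<dots> \<le> L * (2 * r powr s)"
        using L powr_mono[of s 1 "2::real"] s by (intro mult_left_mono mult_right_mono) auto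
      finally have "\<delta> powr (- (2 / 5 * s)) \<le> 2 * L"
        using \<delta> by (simp add: r_def powr_powr powr_minus field_simps)
      moreover have "\<delta> powr (- x) \<le> \<delta> powr (- (2 / 5 * s))" by (intro le) (use x s in linarith)
      ultimately show ?thesis using L7 L by linarith
    next
      case True
      then obtain e e' where e: "e \<in> S" "e' \<in> S" "r \<le> e - e'" by blast
      have "0 = (e - e) / (e - e')" "1 = (e - e') / (e - e')" using e pos by auto
      then have Q01: "0 \<in> Q" "1 \<in> Q" unfolding Q_def using e by blast+
      have gap: "\<delta> powr (- x) \<le> 1000000 * L ^ 7"
        if t: "0 \<le> t" "t \<le> 1" "\<forall>q\<in>Q. \<rho> < \<bar>t - q\<bar>"
          and d: "{d1, d2, d3, d4, d5} \<subseteq> S" "r \<le> d3 - d4"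
          and te: "t = ((d1 - d2) + (d5 - d4)) / ((d3 - d4) + (d3 - d4))" for t d1 d2 d3 d4 d5
      proof -
        define c where "c = real (cov D {x + t * y | x y. x \<in> S \<and> y \<in> S})"
        have v: "0 < (d3 - d4) + (d3 - d4)" using d pos by linarith
        have u: "0 \<le> (d1 - d2) + (d5 - d4)" "(d1 - d2) + (d5 - d4) \<le> (d3 - d4) + (d3 - d4)"
          using t(1,2) v unfolding te by (auto simp: zero_le_divide_iff divide_le_eq_1)
        have vD: "\<delta> \<le> ((d3 - d4) + (d3 - d4)) * D"
          using mult_right_mono[of r "(d3 - d4) + (d3 - d4)" D] rD d(2) pos by simp
        have c1: "c \<le> 10000 * L ^ 5 * D powr (- s)"
          unfolding c_def te
          by (rule cov_quotient_slope[of d3 d4 d3 d4 d1 d2 d5 d4, OF _ refl refl v u pos(2) _ vD])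
            (use d DD rho8 in auto)
        have "1 \<le> c * (8 * L\<^sup>2 * r powr (2 * s))"
          unfolding c_def
        proof (rule cov_gap_slope[OF dr pos(2) Dr _ t(1,2)])
          show "D \<le> \<rho> * r" by (simp add: \<rho>r)
          fix f1 f2 f3 f4 assume "{f1, f2, f3, f4} \<subseteq> S" "r \<le> f3 - f4"
          then have "(f1 - f2) / (f3 - f4) \<in> Q" unfolding Q_def by blast
          then show "\<rho> < \<bar>t - (f1 - f2) / (f3 - f4)\<bar>" using t(3) by blast
        qed
        also have "\<dots> \<le> (10000 * L ^ 5 * D powr (- s)) * (8 * L\<^sup>2 * r powr (2 * s))"
          using c1 by (intro mult_right_mono) auto
        also have "\<dots> = 80000 * L ^ 7 * (D powr (- s) * r powr (2 * s))" by (simp add: eval_nat_numeral)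
        also have "D powr (- s) * r powr (2 * s) = \<delta> powr (s / 5)"
          using \<delta> by (simp add: D_def r_def powr_powr powr_add[symmetric])
        finally have "\<delta> powr (- (s / 5)) \<le> 80000 * L ^ 7"
          using \<delta> by (simp add: powr_minus field_simps)
        then show ?thesis using le[OF x(2)] L7 by linarith
      qed
      show ?thesis
      proof (rule ccontr)
        assume contra: "\<not> \<delta> powr (- x) \<le> 1000000 * L ^ 7"
        have half: "\<exists>q\<in>Q. \<bar>(y + i) / 2 - q\<bar> \<le> \<rho>" if y: "y \<in> Q" "0 \<le> y" "y \<le> 1" and i: "i = 0 \<or> i = 1" for y i
        proof (rule ccontr)
          assume n: "\<not> ?thesis"
          obtain d1 d2 d3 d4 where d: "{d1, d2, d3, d4} \<subseteq> S" "r \<le> d3 - d4" "y = (d1 - d2) / (d3 - d4)"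
            using y unfolding Q_def by blast
          \<comment> \<open>Then \<open>d5 - d4\<close> is \<open>i * (d3 - d4)\<close>, so one
            expression covers both \<open>y / 2\<close> and \<open>(y + 1) / 2\<close>.\<close>
          define d5 where "d5 = (if i = 0 then d4 else d3)"
          have te: "(y + i) / 2 = ((d1 - d2) + (d5 - d4)) / ((d3 - d4) + (d3 - d4))"
            using d(2,3) pos i by (auto simp: d5_def field_simps)
          have t01: "0 \<le> (y + i) / 2" "(y + i) / 2 \<le> 1" using y i by auto
          have far: "\<forall>q\<in>Q. \<rho> < \<bar>(y + i) / 2 - q\<bar>" using n by (meson not_le)
          have "{d1, d2, d3, d4, d5} \<subseteq> S" using d(1) unfolding d5_def by auto
          from gap[OF t01 far this d(2) te] have "\<delta> powr (- x) \<le> 1000000 * L ^ 7" .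
          then show False using contra by blast
        qed
        have dense: "\<exists>q\<in>Q. 0 \<le> q \<and> q \<le> 1 \<and> \<bar>z - q\<bar> \<le> 3 * \<rho>" if "0 \<le> z" "z \<le> 1" for z
          by (rule dense_of_halves[OF Q01 pos(3) _ _ that]) (use half[of _ 0] half[of _ 1] in auto)
        \<comment> \<open>With \<open>h = \<rho> powr a\<close> the two energy terms have exponents
          \<open>s + a * s\<close> and \<open>1 - a\<close>; this \<open>a\<close> ensures
          \<open>s + a * s \<le> 1 - a\<close>, so the first term dominates, and it gains
          \<open>a * s\<close> over the trivial exponent \<open>s\<close>.\<close>
        define a where "a = (1 - s) / 2"
        have a: "0 < a" "a < 1" using s by (auto simp: a_def)
        define h where "h = \<rho> powr a"
        have h: "\<rho> \<le> h" "h \<le> 1"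
          unfolding h_def using a pos rho8 powr_mono'[of a 1 \<rho>] powr_mono'[of 0 a \<rho>] by auto
        obtain q where q: "q \<in> Q" "0 \<le> q" "q \<le> 1" and
          E: "real (card {p \<in> quads. close \<rho> q p}) \<le> (4 * L\<^sup>2 * h powr s * \<rho> powr s + 32 * \<rho> / h) * real (card S) ^ 4"
          using exists_slope_small_energy[OF pos(3) rho8 d\<rho>' h dense] by blast
        define n where "n = real (card S)"
        have n: "0 < n" using card_S by (simp add: n_def)
        have "4 * L\<^sup>2 * h powr s * \<rho> powr s + 32 * \<rho> / h \<le> 36 * L\<^sup>2 * \<rho> powr (s + a * s)"
        proof -
          have "h powr s * \<rho> powr s = \<rho> powr (s + a * s)"
            by (simp add: h_def powr_powr powr_add[symmetric] add.commute)
          moreover have "\<rho> / h \<le> \<rho> powr (s + a * s)"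
          proof -
            have "\<rho> / h = \<rho> powr (1 - a)" using pos by (simp add: h_def powr_diff)
            also have "\<dots> \<le> \<rho> powr (s + a * s)"
            proof (rule powr_mono')
              have "s + a * s \<le> s + a * 1" using a s by (intro add_left_mono mult_left_mono) auto
              also have "\<dots> = 1 - a" by (simp add: a_def field_simps)
              finally show "s + a * s \<le> 1 - a" .
            qed (use pos rho8 in auto)
            finally show ?thesis .
          qed
          moreover have "\<rho> powr (s + a * s) \<le> L\<^sup>2 * \<rho> powr (s + a * s)"
            using L one_le_power[of L 2] mult_right_mono[of 1 "L\<^sup>2" "\<rho> powr (s + a * s)"] by simp
          ultimately show ?thesis by (simp add: mult.assoc)
        qed
        then have E': "real (card {p \<in> quads. close \<rho> q p}) \<le> 36 * L\<^sup>2 * \<rho> powr (s + a * s) * n ^ 4"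
          using n by (intro order_trans[OF E]) (auto simp: n_def intro!: mult_right_mono)
        define f where "f = (\<lambda>(x, y). x + q * y)"
        define c where "c = real (cov \<rho> {x + q * y | x y. x \<in> S \<and> y \<in> S})"
        obtain d1 d2 d3 d4 where d: "{d1, d2, d3, d4} \<subseteq> S" "r \<le> d3 - d4" "q = (d1 - d2) / (d3 - d4)"
          using q unfolding Q_def by blast
        have qe: "q = ((d1 - d2) + (d1 - d1)) / ((d3 - d4) + (d3 - d3))" using d by simp
        have v: "0 < (d3 - d4) + (d3 - d3)" using d pos by linarith
        have u: "0 \<le> (d1 - d2) + (d1 - d1)" "(d1 - d2) + (d1 - d1) \<le> (d3 - d4) + (d3 - d3)"
          using q(2,3) v unfolding qe by (auto simp: zero_le_divide_iff divide_le_eq_1)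
        have vr: "\<delta> \<le> ((d3 - d4) + (d3 - d3)) * \<rho>"
          by (rule order_trans[OF d\<rho>], rule mult_right_mono) (use d(2) pos in auto)
        have c1: "c \<le> 10000 * L ^ 5 * \<rho> powr (- s)"
          unfolding c_def qe
          by (rule cov_quotient_slope[of d3 d4 d3 d3 d1 d2 d1 d1, OF _ refl refl v u pos(3) _ vr])
            (use d rho8 in auto)
        have "(real (card (S \<times> S)))\<^sup>2 \<le> real (cov \<rho> (f ` (S \<times> S))) *
            real (card {p \<in> (S \<times> S) \<times> (S \<times> S). \<bar>f (fst p) - f (snd p)\<bar> < \<rho>})"
          using S pos by (intro card_le_energy) auto
        also have "f ` (S \<times> S) = {x + q * y | x y. x \<in> S \<and> y \<in> S}" by (force simp: f_def image_iff)
        also have "card {p \<in> (S \<times> S) \<times> (S \<times> S). \<bar>f (fst p) - f (snd p)\<bar> < \<rho>} = card {p \<in> quads. close \<rho> q p}"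
          by (rule bij_betw_same_card[of "\<lambda>((a, c), (b, d)). (a, b, c, d)"], rule bij_betwI[of _ _ _ "\<lambda>(a, b, c, d). ((a, c), (b, d))"])
            (auto simp: quads_def close_def f_def algebra_simps)
        finally have "(n * n)\<^sup>2 \<le> c * real (card {p \<in> quads. close \<rho> q p})"
          by (simp add: n_def c_def card_cartesian_product)
        also have "\<dots> \<le> (10000 * L ^ 5 * \<rho> powr (- s)) * (36 * L\<^sup>2 * \<rho> powr (s + a * s) * n ^ 4)"
          using c1 E' L by (intro mult_mono) (auto simp: c_def)
        also have "\<dots> = 360000 * L ^ 7 * (\<rho> powr (- s) * \<rho> powr (s + a * s)) * n ^ 4"
          by (simp add: eval_nat_numeral)
        also have "\<rho> powr (- s) * \<rho> powr (s + a * s) = \<delta> powr x"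
        proof -
          have "\<rho> powr (- s) * \<rho> powr (s + a * s) = \<rho> powr (a * s)" using pos by (simp add: powr_add[symmetric])
          also have "\<dots> = \<delta> powr (1 / 5 * (a * s))" by (simp only: \<rho>_def powr_powr)
          also have "1 / 5 * (a * s) = x" by (simp add: x_def a_def)
          finally show ?thesis .
        qed
        finally have "n ^ 4 * 1 \<le> n ^ 4 * (360000 * L ^ 7 * \<delta> powr x)"
          by (simp add: eval_nat_numeral mult_ac)
        then have "1 \<le> 360000 * L ^ 7 * \<delta> powr x" using n by simp
        then have "\<delta> powr (- x) \<le> 360000 * L ^ 7" using \<delta> by (simp add: powr_minus field_simps)
        then show False using contra L7 by linarith
      qed
    qed
  qed
qed

end

section \<open>Slopes from a quadratic form\<close>

lemma card_le_fibers_inj: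
  fixes m :: real
  assumes "finite A" "finite C" "f ` A \<subseteq> C" "0 \<le> m"
    and "\<And>x. x \<in> A \<Longrightarrow> real (card (g ` {y\<in>A. f y = f x})) \<le> m"
    and inj: "\<And>x y. x \<in> A \<Longrightarrow> y \<in> A \<Longrightarrow> f x = f y \<Longrightarrow> g x = g y \<Longrightarrow> x = y"
  shows "real (card A) \<le> real (card C) * m"
proof -
  have "real (card A) \<le> real (card (f ` A)) * m"
  proof (rule card_le_fibers[OF assms(1)])
    fix x assume x: "x \<in> A"
    have "inj_on g {y\<in>A. f y = f x}" using inj by (auto simp: inj_on_def)
    then show "real (card {y\<in>A. f y = f x}) \<le> m" using assms(5)[OF x] card_image by metis
  qed
  also have "\<dots> \<le> real (card C) * m" using assms by (intro mult_right_mono) (auto simp: card_mono)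
  finally show ?thesis .
qed

lemma pigeonhole_fiber:
  assumes "finite A" "A \<noteq> {}" "finite C" "f ` A \<subseteq> C"
  obtains x where "x \<in> A" "card A \<le> card C * card {y\<in>A. f y = f x}"
proof -
  define F where "F = (\<lambda>x. card {y\<in>A. f y = f x})"
  have "Max (F ` A) \<in> F ` A" using assms by (intro Max_in) auto
  then obtain x where x: "x \<in> A" "Max (F ` A) = F x" by auto
  have "real (card A) \<le> real (card (f ` A)) * real (F x)"
    using assms x(2)[symmetric] by (intro card_le_fibers) (auto simp: F_def intro!: Max_ge)
  also have "\<dots> \<le> real (card C) * real (F x)" using assms by (intro mult_right_mono) (auto simp: card_mono)
  finally show ?thesis using that x(1) by (simp add: F_def flip: of_nat_mult)
qed

lemma card_int_diameter:
  fixes X :: "int set"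
  assumes "\<And>x y. x \<in> X \<Longrightarrow> y \<in> X \<Longrightarrow> \<bar>real_of_int (x - y)\<bar> \<le> d" "0 \<le> d"
  shows "real (card X) \<le> d + 1"
proof (cases "X = {} \<or> infinite X")
  case False
  then have "X \<subseteq> {Min X..Min X + \<lfloor>d\<rfloor>}"
  proof (intro subsetI)
    fix x assume x: "x \<in> X"
    have "\<bar>real_of_int (x - Min X)\<bar> \<le> d" using assms(1)[OF x Min_in] x False by blast
    then have "x - Min X \<le> \<lfloor>d\<rfloor>" by (simp add: le_floor_iff)
    then show "x \<in> {Min X..Min X + \<lfloor>d\<rfloor>}" using False x by simp
  qed
  then have "card X \<le> card {Min X..Min X + \<lfloor>d\<rfloor>}" by (intro card_mono) auto
  also have "\<dots> = nat (\<lfloor>d\<rfloor> + 1)" by simp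
  finally have "real (card X) \<le> real (nat (\<lfloor>d\<rfloor> + 1))" by simp
  also have "\<dots> \<le> d + 1" using assms(2) by linarith
  finally show ?thesis .
qed (use assms in auto)

text \<open>The integer model with \<open>R = 1 / \<delta>\<close>. A single \<open>K\<close> bounds
  all losses and the coefficients; because \<open>K \<ge> 1000\<close>, a numerical factor can be
  paid for by one more power of \<open>K\<close>.\<close>

locale form_config =
  fixes B :: "int set" and A1 A2 A3 :: int and a :: nat and R K s :: real
  assumes s: "0 < s" "s < 1" and K: "1000 \<le> K" and R: "1 \<le> R"
    and B: "finite B" "B \<noteq> {}" "\<And>b. b \<in> B \<Longrightarrow> 0 \<le> b \<and> real_of_int b \<le> R"
    and doubling: "real (card (B + B)) \<le> K * real (card B)"
    and frostman: "\<And>x l. 1 \<le> l \<Longrightarrow> real (card {b\<in>B. x \<le> real_of_int b \<and> real_of_int b \<le> x + l}) \<le> K * (l / R) powr s * real (card B)"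
    and card_upper: "real (card B) \<le> K * R powr s"
    and form_values: "real (cov R ((\<lambda>(x, y). real_of_int (A1 * x\<^sup>2 + A2 * x * y + A3 * y\<^sup>2)) ` (B \<times> B))) \<le> K * real (card B)"
    and disc: "A2\<^sup>2 \<noteq> 4 * A1 * A3"
    and coeffs: "\<bar>A1\<bar> + \<bar>A2\<bar> + \<bar>A3\<bar> \<le> int a" "real a \<le> K"
begin

abbreviation "N \<equiv> real (card B)"
definition "m1 = nat \<lceil>2 / s\<rceil>"
definition "m2 = nat \<lceil>(real m1 + 3) / s\<rceil>"

text \<open>With these exponents non-concentration makes negligible the points with \<open>y\<close> or
  \<open>2 A1 x + A2 y\<close> below \<open>k1 R\<close> and the pairs of points with \<open>\<bar>y - y'\<bar> < k2 R\<close>.\<close>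

definition "k1 = 1 / K ^ m1"
definition "k2 = 1 / K ^ m2"
definition "form x y = A1 * x\<^sup>2 + A2 * x * y + A3 * y\<^sup>2" for x y :: int
text \<open>\<open>al\<close> and \<open>be\<close> are the partial derivatives of the form;
  \<open>form_diff\<close> is its polarization.\<close>

definition "al x y = 2 * A1 * x + A2 * y" for x y :: int
definition "be x y = A2 * x + 2 * A3 * y" for x y :: int

lemma N: "0 < N" using B by (simp add: card_gt_0_iff)

lemma K0: "0 < K" "1 \<le> K" using K by auto

lemma k: "0 < k1" "0 < k2" "k1 \<le> 1" "k2 \<le> 1"
  using K0 by (auto simp: k1_def k2_def)

lemma powr_k:
  assumes "real p \<le> real m * s"
  shows "(1 / K ^ m) powr s \<le> 1 / K ^ p"
proof -
  have "K ^ p = K powr real p" using K0 by (simp add: powr_realpow)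
  also have "\<dots> \<le> K powr (real m * s)" using assms K0 by (intro powr_mono) auto
  also have "\<dots> = (K ^ m) powr s" using K0 by (simp add: powr_powr powr_realpow[symmetric])
  finally show ?thesis using K0 by (simp add: powr_divide frac_le)
qed

text \<open>One power of \<open>K\<close> pays for the Frostman constant, the other makes the bad
  set a small proportion of all pairs.\<close>

lemma k1_powr: "k1 powr s \<le> 1 / K ^ 2"
  unfolding k1_def
proof (rule powr_k)
  have "2 / s \<le> real m1" unfolding m1_def by linarith
  then show "real 2 \<le> real m1 * s" using s by (simp add: divide_le_eq)
qed

text \<open>The exponent pays for \<open>1 / k1 = K ^ m1\<close>, the Frostman constant, the loss of
  \<open>K\<close> in \<open>card_sol\<close> and the numerical factors.\<close>

lemma k2_powr: "k2 powr s \<le> 1 / K ^ (m1 + 3)"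
  unfolding k2_def
proof (rule powr_k)
  have "(real m1 + 3) / s \<le> real m2" unfolding m2_def by linarith
  then show "real (m1 + 3) \<le> real m2 * s" using s by (simp add: divide_le_eq)
qed

lemma frostman_abs:
  assumes "\<And>x. x \<in> X \<Longrightarrow> x \<in> B \<and> \<bar>real_of_int x - c\<bar> \<le> l" "1 \<le> 2 * l"
  shows "real (card X) \<le> K * (2 * l / R) powr s * N"
proof -
  have "X \<subseteq> {b\<in>B. c - l \<le> real_of_int b \<and> real_of_int b \<le> c - l + 2 * l}"
  proof
    fix x assume "x \<in> X"
    then have "x \<in> B" "\<bar>real_of_int x - c\<bar> \<le> l" using assms(1) by blast+
    then show "x \<in> {b\<in>B. c - l \<le> real_of_int b \<and> real_of_int b \<le> c - l + 2 * l}" by auto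
  qed
  then have "card X \<le> card {b\<in>B. c - l \<le> real_of_int b \<and> real_of_int b \<le> c - l + 2 * l}"
    using B by (intro card_mono) auto
  then show ?thesis using frostman[OF assms(2), of "c - l"] by linarith
qed

lemma form_diff: "(x - x') * al (x + x') (y + y') + (y - y') * be (x + x') (y + y') = 2 * (form x y - form x' y')"
  by (simp add: form_def al_def be_def algebra_simps power2_eq_square)

lemma al_bound:
  assumes "\<bar>real_of_int x\<bar> \<le> 2 * R" "\<bar>real_of_int y\<bar> \<le> 2 * R"
  shows "\<bar>real_of_int (al x y)\<bar> \<le> 4 * K * R"
proof -
  have c: "\<bar>real_of_int A1\<bar> + \<bar>real_of_int A2\<bar> \<le> K"
  proof -
    have "real_of_int (\<bar>A1\<bar> + \<bar>A2\<bar> + \<bar>A3\<bar>) \<le> real_of_int (int a)" using coeffs(1) by (simp only: of_int_le_iff)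
    then show ?thesis using coeffs(2) by simp
  qed
  have "\<bar>real_of_int (al x y)\<bar> \<le> \<bar>2 * real_of_int A1 * x\<bar> + \<bar>real_of_int A2 * y\<bar>"
    unfolding al_def by simp
  also have "\<dots> \<le> (2 * \<bar>real_of_int A1\<bar>) * (2 * R) + \<bar>real_of_int A2\<bar> * (2 * R)"
    unfolding abs_mult using assms by (intro add_mono mult_mono) auto
  also have "\<dots> \<le> (\<bar>real_of_int A1\<bar> + \<bar>real_of_int A2\<bar>) * (4 * R)"
    using R by (simp add: algebra_simps)
  also have "\<dots> \<le> K * (4 * R)" using c R by (intro mult_right_mono) auto
  finally show ?thesis by simp
qed

definition "good = {(x, y) \<in> B \<times> B. k1 * R \<le> real_of_int y \<and> k1 * R \<le> \<bar>real_of_int (al x y)\<bar>}"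

lemma finite_good: "finite good" using B by (auto simp: good_def intro: finite_subset[of _ "B \<times> B"])

text \<open>Each of the two bad sets contains at most a quarter of all pairs. Small \<open>y\<close>
  lie in one interval of length \<open>k1 * R\<close>; for fixed \<open>y\<close>, a small
  \<open>al\<close> confines \<open>x\<close> to an interval around the zero of a linear function.
  If \<open>A1 = 0\<close>, then \<open>al\<close> equals \<open>A2 * y\<close> with
  \<open>A2 \<noteq> 0\<close> by \<open>disc\<close>, so it is at least as large as
  \<open>y\<close> and only the first bad set matters.\<close>

lemma card_good:
  assumes kR: "1 \<le> k1 * R"
  shows "N\<^sup>2 / 2 \<le> real (card good)"
proof -
  define Y where "Y = {(x, y) \<in> B \<times> B. real_of_int y \<le> k1 * R}"
  define Z where "Z = (if A1 = 0 then {} else {(x, y) \<in> B \<times> B. \<bar>real_of_int (al x y)\<bar> < k1 * R})"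
  have KN: "K * k1 powr s * N \<le> N / 4"
  proof -
    have "K * k1 powr s \<le> K * (1 / K ^ 2)" using k1_powr K0 by (intro mult_left_mono) auto
    also have "\<dots> \<le> 1 / 4" using K by (simp add: power2_eq_square field_simps)
    finally show ?thesis using N mult_right_mono[of "K * k1 powr s" "1 / 4" N] by simp
  qed
  have fin: "finite Y" "finite Z" using B by (auto simp: Y_def Z_def intro: finite_subset[of _ "B \<times> B"])
  have Y: "real (card Y) \<le> N * (N / 4)"
  proof (rule card_le_fibers_inj[of Y B fst _ snd])
    fix p assume "p \<in> Y"
    have "real (card (snd ` {q \<in> Y. fst q = fst p})) \<le> K * (2 * (k1 * R / 2) / R) powr s * N"
    proof (rule frostman_abs)
      fix x assume "x \<in> snd ` {q \<in> Y. fst q = fst p}"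
      then have x: "x \<in> B" "real_of_int x \<le> k1 * R" by (auto simp: Y_def)
      then have "0 \<le> real_of_int x" using B(3) by auto
      then show "x \<in> B \<and> \<bar>real_of_int x - k1 * R / 2\<bar> \<le> k1 * R / 2" using x by linarith
    qed (use kR in simp)
    also have "\<dots> = K * k1 powr s * N" using R by simp
    finally show "real (card (snd ` {q \<in> Y. fst q = fst p})) \<le> N / 4" using KN by linarith
  qed (use fin B in \<open>auto simp: Y_def\<close>)
  have Z: "real (card Z) \<le> N * (N / 4)"
  proof (cases "A1 = 0")
    case False
    then have A1: "1 \<le> \<bar>real_of_int A1\<bar>" by linarith
    show ?thesis
    proof (rule card_le_fibers_inj[of Z B snd _ fst])
      fix p assume "p \<in> Z"
      define z where "z = - real_of_int A2 * snd p / (2 * A1)"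
      have "real (card (fst ` {q \<in> Z. snd q = snd p})) \<le> K * (2 * (k1 * R / 2) / R) powr s * N"
      proof (rule frostman_abs[of _ z])
        fix x assume "x \<in> fst ` {q \<in> Z. snd q = snd p}"
        then have x: "x \<in> B" "\<bar>real_of_int (al x (snd p))\<bar> < k1 * R" using False by (auto simp: Z_def)
        have "2 * real_of_int A1 * (real_of_int x - z) = real_of_int (al x (snd p))"
          using False by (simp add: z_def al_def field_simps)
        then have "2 * \<bar>real_of_int A1\<bar> * \<bar>real_of_int x - z\<bar> < k1 * R"
          using x(2) by (metis abs_mult abs_numeral)
        moreover have "2 * 1 * \<bar>real_of_int x - z\<bar> \<le> 2 * \<bar>real_of_int A1\<bar> * \<bar>real_of_int x - z\<bar>"
          using A1 by (intro mult_right_mono mult_left_mono) auto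
        ultimately show "x \<in> B \<and> \<bar>real_of_int x - z\<bar> \<le> k1 * R / 2"
          using x(1) by simp
      qed (use kR in simp)
      also have "\<dots> = K * k1 powr s * N" using R by simp
      finally show "real (card (fst ` {q \<in> Z. snd q = snd p})) \<le> N / 4" using KN by linarith
    qed (use fin B False in \<open>auto simp: Z_def\<close>)
  qed (simp add: Z_def)
  have "B \<times> B \<subseteq> good \<union> (Y \<union> Z)"
  proof
    fix p assume "p \<in> B \<times> B"
    then obtain x y where p: "p = (x, y)" "x \<in> B" "y \<in> B" by auto
    show "p \<in> good \<union> (Y \<union> Z)"
    proof (cases "A1 = 0")
      case True
      have "A2 \<noteq> 0" using disc True by auto
      then have "1 \<le> \<bar>real_of_int A2\<bar>" by linarith
      then have "1 * real_of_int y \<le> \<bar>real_of_int A2\<bar> * real_of_int y" using B(3)[OF p(3)] by (intro mult_right_mono) auto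
      then have "real_of_int y \<le> \<bar>real_of_int (al x y)\<bar>" unfolding al_def using True B(3)[OF p(3)] by (simp add: abs_mult)
      then show ?thesis using p by (auto simp: good_def Y_def)
    next
      case False
      then show ?thesis using p by (auto simp: good_def Y_def Z_def)
    qed
  qed
  then have "card (B \<times> B) \<le> card (good \<union> (Y \<union> Z))" using fin finite_good by (intro card_mono) auto
  also have "\<dots> \<le> card good + (card Y + card Z)"
    using card_Un_le[of good "Y \<union> Z"] card_Un_le[of Y Z] by linarith
  finally have "real (card (B \<times> B)) \<le> real (card good) + (real (card Y) + real (card Z))" by linarith
  then show ?thesis using Y Z by (simp add: card_cartesian_product power2_eq_square)
qed

definition "sol = {((x, y), (x', y')) \<in> good \<times> good. \<bar>real_of_int (form x y - form x' y')\<bar> < R}"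

lemma finite_sol: "finite sol" using finite_good by (auto simp: sol_def intro: finite_subset[of _ "good \<times> good"])

lemma solD:
  assumes "((x, y), (x', y')) \<in> sol"
  shows "x \<in> B" "y \<in> B" "x' \<in> B" "y' \<in> B" "k1 * R \<le> real_of_int y" "k1 * R \<le> real_of_int y'"
    "k1 * R \<le> \<bar>real_of_int (al x' y')\<bar>" "\<bar>real_of_int (form x y - form x' y')\<bar> < R"
  using assms by (auto simp: sol_def good_def)

lemma card_sol:
  assumes kR: "1 \<le> k1 * R"
  shows "N ^ 3 / (4 * K) \<le> real (card sol)"
proof -
  define f where "f = (\<lambda>(x, y). real_of_int (form x y))"
  have "(N\<^sup>2 / 2)\<^sup>2 \<le> (real (card good))\<^sup>2" using card_good[OF kR] by (intro power_mono) auto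
  also have "\<dots> \<le> real (cov R (f ` good)) * real (card {p \<in> good \<times> good. \<bar>f (fst p) - f (snd p)\<bar> < R})"
    using finite_good R by (intro card_le_energy) auto
  also have "{p \<in> good \<times> good. \<bar>f (fst p) - f (snd p)\<bar> < R} = sol"
    by (auto simp: sol_def f_def)
  also have "real (cov R (f ` good)) * real (card sol) \<le> (K * N) * real (card sol)"
  proof (rule mult_right_mono)
    have "cov R (f ` good) \<le> cov R (f ` (B \<times> B))"
      using B by (intro cov_mono) (auto simp: good_def)
    then show "real (cov R (f ` good)) \<le> K * N" using form_values by (simp add: f_def form_def)
  qed auto
  finally have "N * (N ^ 3 / 4) \<le> N * (K * real (card sol))"
    by (simp add: power_divide eval_nat_numeral mult_ac)
  then have "N ^ 3 / 4 \<le> K * real (card sol)" using N by simp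
  then show ?thesis using K0 by (simp add: field_simps)
qed

text \<open>On each side of its vertex a quadratic polynomial with derivative at least \<open>k1 R\<close> is injective
  up to an error \<open>O(1 / k1)\<close>.\<close>

lemma card_form_fiber:
  assumes "\<And>x. x \<in> X \<Longrightarrow> \<bar>real_of_int (form x y) - c\<bar> < R \<and> k1 * R \<le> \<bar>real_of_int (al x y)\<bar>" "finite X"
  shows "real (card X) \<le> 6 / k1"
proof -
  have *: "real (card Y) \<le> 2 / k1 + 1" if Y: "Y \<subseteq> X" "\<And>x x'. x \<in> Y \<Longrightarrow> x' \<in> Y \<Longrightarrow> 0 \<le> al x y \<longleftrightarrow> 0 \<le> al x' y" for Y
  proof (rule card_int_diameter)
    fix x x' assume x: "x \<in> Y" "x' \<in> Y"
    have 1: "\<bar>real_of_int (form x y) - c\<bar> < R" "\<bar>real_of_int (form x' y) - c\<bar> < R"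
      "k1 * R \<le> \<bar>real_of_int (al x y)\<bar>" "k1 * R \<le> \<bar>real_of_int (al x' y)\<bar>" using x Y(1) assms by blast+
    have 2: "2 * (k1 * R) \<le> \<bar>real_of_int (al x y + al x' y)\<bar>"
      using 1(3,4) Y(2)[OF x] by (cases "0 \<le> al x y") auto
    have "2 * (form x y - form x' y) = (x - x') * (al x y + al x' y)"
      by (simp add: form_def al_def algebra_simps power2_eq_square)
    then have "2 * (real_of_int (form x y) - real_of_int (form x' y)) = real_of_int (x - x') * real_of_int (al x y + al x' y)"
      by (metis of_int_diff of_int_mult of_int_numeral)
    then have "\<bar>real_of_int (x - x')\<bar> * \<bar>real_of_int (al x y + al x' y)\<bar> =
        2 * \<bar>real_of_int (form x y) - real_of_int (form x' y)\<bar>"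
      by (metis abs_mult abs_numeral)
    also have "\<bar>real_of_int (form x y) - real_of_int (form x' y)\<bar> \<le> 2 * R" using 1(1,2) by argo
    finally have "\<bar>real_of_int (x - x')\<bar> * \<bar>real_of_int (al x y + al x' y)\<bar> \<le> 4 * R" by simp
    then have "\<bar>real_of_int (x - x')\<bar> * (2 * (k1 * R)) \<le> 4 * R"
      using 2 by (meson abs_ge_zero mult_left_mono order_trans)
    then show "\<bar>real_of_int (x - x')\<bar> \<le> 2 / k1" using R k by (simp add: field_simps)
  qed (use k in simp)
  have "X = {x\<in>X. 0 \<le> al x y} \<union> {x\<in>X. \<not> 0 \<le> al x y}" by auto
  then have "real (card X) \<le> real (card {x\<in>X. 0 \<le> al x y}) + real (card {x\<in>X. \<not> 0 \<le> al x y})"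
    by (metis card_Un_le of_nat_add of_nat_le_iff)
  also have "\<dots> \<le> (2 / k1 + 1) + (2 / k1 + 1)" by (intro add_mono *) auto
  also have "\<dots> \<le> 6 / k1" using k by (simp add: field_simps)
  finally show ?thesis .
qed

text \<open>Solutions with \<open>y'\<close> near \<open>y\<close> are rare: non-concentration
  limits the triples \<open>(x, y, y')\<close>, and each triple leaves at most \<open>6 / k1\<close>
  values of \<open>x'\<close> by \<open>card_form_fiber\<close>. The choice of \<open>k2\<close>
  brings this below half of the bound in \<open>card_sol\<close>.\<close>

lemma card_sol_far:
  assumes kR: "1 \<le> k1 * R" "1 \<le> k2 * R"
  shows "N ^ 3 / (8 * K) \<le> real (card {((x, y), (x', y')) \<in> sol. k2 * R \<le> \<bar>real_of_int (y - y')\<bar>})"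
proof -
  define far where "far = {((x, y), (x', y')) \<in> sol. k2 * R \<le> \<bar>real_of_int (y - y')\<bar>}"
  define near where "near = {((x, y), (x', y')) \<in> sol. \<bar>real_of_int (y - y')\<bar> \<le> k2 * R}"
  define C where "C = {((x, y), y') \<in> (B \<times> B) \<times> B. \<bar>real_of_int (y - y')\<bar> \<le> k2 * R}"
  have finC: "finite C" using B by (auto simp: C_def intro: finite_subset[of _ "(B \<times> B) \<times> B"])
  have fin: "finite near" "finite far" using finite_sol by (auto simp: near_def far_def intro: finite_subset[of _ sol])
  have C: "real (card C) \<le> real (card (B \<times> B)) * (K * (2 * k2) powr s * N)"
  proof (rule card_le_fibers_inj[of C _ fst _ snd])
    fix p assume "p \<in> C"
    obtain x y y' where p: "p = ((x, y), y')" by (metis prod.exhaust)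
    have "real (card (snd ` {q \<in> C. fst q = fst p})) \<le> K * (2 * (k2 * R) / R) powr s * N"
    proof (rule frostman_abs)
      fix z assume "z \<in> snd ` {q \<in> C. fst q = fst p}"
      then have "((x, y), z) \<in> C" by (auto simp: p)
      then show "z \<in> B \<and> \<bar>real_of_int z - real_of_int y\<bar> \<le> k2 * R" by (auto simp: C_def abs_minus_commute)
    qed (use kR in simp)
    then show "real (card (snd ` {q \<in> C. fst q = fst p})) \<le> K * (2 * k2) powr s * N" using R by simp
  qed (use finC B K0 in \<open>auto simp: C_def\<close>)
  have "real (card near) \<le> real (card C) * (6 / k1)"
  proof (rule card_le_fibers_inj[of near _ "\<lambda>(u, x', y'). (u, y')" _ "\<lambda>(u, x', y'). x'"])
    fix p assume "p \<in> near"
    obtain x y x' y' where p: "p = ((x, y), (x', y'))" by (metis prod.exhaust)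
    show "real (card ((\<lambda>(u, x', y'). x') ` {q \<in> near. (\<lambda>(u, x', y'). (u, y')) q = (\<lambda>(u, x', y'). (u, y')) p})) \<le> 6 / k1"
    proof (rule card_form_fiber)
      fix z assume "z \<in> (\<lambda>(u, x', y'). x') ` {q \<in> near. (\<lambda>(u, x', y'). (u, y')) q = (\<lambda>(u, x', y'). (u, y')) p}"
      then have "((x, y), (z, y')) \<in> sol" by (auto simp: near_def p)
      then show "\<bar>real_of_int (form z y') - real_of_int (form x y)\<bar> < R \<and> k1 * R \<le> \<bar>real_of_int (al z y')\<bar>"
        using solD by (metis abs_minus_commute of_int_diff)
    qed (use fin in auto)
  qed (use fin finC k in \<open>auto simp: near_def C_def dest: solD\<close>)
  also have "\<dots> \<le> (real (card (B \<times> B)) * (K * (2 * k2) powr s * N)) * (6 / k1)"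
    using C k by (intro mult_right_mono) auto
  also have "\<dots> = N ^ 3 * (6 * K * K ^ m1 * (2 powr s * k2 powr s))"
    using k by (simp add: powr_mult card_cartesian_product k1_def eval_nat_numeral mult_ac)
  also have "\<dots> \<le> N ^ 3 * (6 * K * K ^ m1 * (2 * (1 / K ^ (m1 + 3))))"
    using N K0 k2_powr powr_mono[of s 1 "2::real"] s by (intro mult_left_mono mult_mono) auto
  also have "\<dots> = N ^ 3 * (12 / (K * K))"
    using K0 by (simp add: power_add eval_nat_numeral)
  also have "\<dots> \<le> N ^ 3 * (1 / (8 * K))"
    using N K by (intro mult_left_mono) (auto simp: field_simps)
  finally have near: "real (card near) \<le> N ^ 3 / (8 * K)" by simp
  have "sol \<subseteq> far \<union> near" by (auto simp: far_def near_def)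
  then have "card sol \<le> card far + card near"
    using fin by (meson card_Un_le card_mono finite_UnI order_trans)
  then have "real (card sol) \<le> real (card far) + real (card near)" by linarith
  moreover have "N ^ 3 / (4 * K) = N ^ 3 / (8 * K) + N ^ 3 / (8 * K)" by simp
  ultimately show ?thesis using card_sol[OF kR(1)] near unfolding far_def[symmetric] by linarith
qed

end

lemma card_floor_le:
  fixes Y T :: "real set" and W :: "int set"
  assumes fin: "finite T" "finite W" and c: "0 \<le> c"
    and Y: "\<And>y. y \<in> Y \<Longrightarrow> \<exists>t\<in>T. \<exists>w\<in>W. \<bar>y - t - real_of_int w\<bar> \<le> c"
  shows "real (card (floor ` Y)) \<le> real (card T) * real (card W) * (2 * c + 2)"
proof -
  define g where "g = (\<lambda>(t::real, w::int, i::int). w + \<lfloor>t - c\<rfloor> + i)"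
  define I where "I = {0..\<lfloor>2 * c\<rfloor> + 1}"
  have "floor ` Y \<subseteq> g ` (T \<times> W \<times> I)"
  proof
    fix z assume "z \<in> floor ` Y"
    then obtain y where y: "y \<in> Y" "z = \<lfloor>y\<rfloor>" by auto
    then obtain t w where tw: "t \<in> T" "w \<in> W" "\<bar>y - t - real_of_int w\<bar> \<le> c" using Y by blast
    have "w + \<lfloor>t - c\<rfloor> \<le> z" unfolding y(2) le_floor_iff using tw(3) by (simp add: abs_le_iff) linarith
    moreover have "z - (w + \<lfloor>t - c\<rfloor>) \<le> \<lfloor>2 * c\<rfloor> + 1" using tw(3) y(2) by linarith
    ultimately have "z = g (t, w, z - (w + \<lfloor>t - c\<rfloor>))" "z - (w + \<lfloor>t - c\<rfloor>) \<in> I" by (auto simp: g_def I_def)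
    then show "z \<in> g ` (T \<times> W \<times> I)" using tw by blast
  qed
  then have "card (floor ` Y) \<le> card (T \<times> W \<times> I)"
    by (rule surj_card_le[rotated]) (use fin in \<open>simp add: I_def\<close>)
  also have "\<dots> = card T * (card W * card I)" by (simp add: card_cartesian_product)
  finally have "real (card (floor ` Y)) \<le> real (card T) * (real (card W) * real (card I))"
    by (metis of_nat_le_iff of_nat_mult)
  also have "real (card I) \<le> 2 * c + 2" unfolding I_def using c by simp
  finally show ?thesis by (simp add: mult_left_mono mult.assoc)
qed

section \<open>Solutions with a fixed second difference\<close>

locale form_direction = form_config +
  fixes d0 :: int
  assumes kR: "1 \<le> k1 * R" "1 < k2 * R" and d0: "k2 * R \<le> \<bar>real_of_int d0\<bar>"
    and many: "N\<^sup>2 / (8 * K ^ 3) \<le> real (card {((x, y), (x', y')) \<in> sol. y - y' = d0})"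
begin

definition "H = \<bar>real_of_int d0\<bar>"
definition "Sd = {((x, y), (x', y')) \<in> sol. y - y' = d0}"
definition "D1 = dset B 1"
definition "e = 4 + 2 * m1 + m2"

lemma H: "1 < H" "H \<le> R" "k2 * R \<le> H"
proof -
  show "1 < H" "k2 * R \<le> H" using kR d0 by (auto simp: H_def)
  have "0 < real (card {((x, y), (x', y')) \<in> sol. y - y' = d0})"
    using N K0 by (intro less_le_trans[OF _ many]) auto
  then have "{((x, y), (x', y')) \<in> sol. y - y' = d0} \<noteq> {}" by (metis card.empty less_irrefl of_nat_0)
  then obtain x y x' y' where *: "((x, y), (x', y')) \<in> sol" "y - y' = d0" by auto
  then have "0 \<le> y" "real_of_int y \<le> R" "0 \<le> y'" "real_of_int y' \<le> R" using solD[OF *(1)] B(3) by auto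
  moreover have "real_of_int d0 = real_of_int y - real_of_int y'" using *(2) by auto
  ultimately show "H \<le> R" unfolding H_def by linarith
qed

lemma finite_Sd: "finite Sd" using finite_sol by (auto simp: Sd_def intro: finite_subset[of _ sol])

lemma SdD:
  assumes "((x, y), (x', y')) \<in> Sd"
  shows "((x, y), (x', y')) \<in> sol" "y - y' = d0"
    "\<bar>real_of_int ((x - x') * al (x + x') (y + y') + d0 * be (x + x') (y + y'))\<bar> \<le> 2 * R"
    "\<bar>real_of_int (al (x + x') (y + y'))\<bar> \<le> 4 * K * R" "k1 * R \<le> real_of_int (y + y')"
proof -
  show *: "((x, y), (x', y')) \<in> sol" "y - y' = d0" using assms by (auto simp: Sd_def)
  have i: "0 \<le> x" "real_of_int x \<le> R" "0 \<le> y" "real_of_int y \<le> R" "0 \<le> x'" "real_of_int x' \<le> R" "0 \<le> y'" "real_of_int y' \<le> R"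
    using solD(1-4)[OF *(1)] B(3) by auto
  show "\<bar>real_of_int (al (x + x') (y + y'))\<bar> \<le> 4 * K * R" using i by (intro al_bound) auto
  show "k1 * R \<le> real_of_int (y + y')" using solD(5)[OF *(1)] i by auto
  have eq: "(x - x') * al (x + x') (y + y') + d0 * be (x + x') (y + y') = 2 * (form x y - form x' y')"
    using form_diff[of x x' y y'] *(2) by simp
  show "\<bar>real_of_int ((x - x') * al (x + x') (y + y') + d0 * be (x + x') (y + y'))\<bar> \<le> 2 * R"
    unfolding eq of_int_mult abs_mult using solD(8)[OF *(1)] by simp
qed

text \<open>For fixed \<open>y, y'\<close> the quotient \<open>be / al\<close> is a Moebius function of \<open>x + x'\<close> with
  determinant a multiple of the discriminant, so \<open>x - x'\<close> determines \<open>x + x'\<close>.\<close>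

lemma solution_spread:
  assumes 1: "((x, y), (x', y')) \<in> Sd" and 2: "((z, y), (z', y')) \<in> Sd"
    and l: "1 \<le> 2 * l" "\<bar>real_of_int ((x - x') - (z - z'))\<bar> \<le> 2 * l"
  shows "\<bar>real_of_int (x - z)\<bar> \<le> 64 * K\<^sup>2 / (k1 * k2) * l"
proof -
  define p where "p = x - x'" define p' where "p' = z - z'"
  define q where "q = x + x'" define q' where "q' = z + z'"
  define Y where "Y = y + y'"
  note d = SdD(3-5)[OF 1] SdD(3,4)[OF 2]
  have dd: "\<bar>real_of_int (p * al q Y + d0 * be q Y)\<bar> \<le> 2 * R" "\<bar>real_of_int (p' * al q' Y + d0 * be q' Y)\<bar> \<le> 2 * R"
    "\<bar>real_of_int (al q Y)\<bar> \<le> 4 * K * R" "\<bar>real_of_int (al q' Y)\<bar> \<le> 4 * K * R" "k1 * R \<le> real_of_int Y"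
    using d by (simp_all add: p_def p'_def q_def q'_def Y_def)
  \<comment> \<open>Eliminating \<open>be\<close> from the two approximate relations leaves the
    determinant of the Moebius function. The lower bounds on \<open>d0\<close> and \<open>Y\<close>
    and the nonzero discriminant then turn control of \<open>p - p'\<close> into control of
    \<open>q - q'\<close>.\<close>
  have id: "d0 * (A2\<^sup>2 - 4 * A1 * A3) * Y * (q - q') =
      al q' Y * (p * al q Y + d0 * be q Y) - al q Y * (p' * al q' Y + d0 * be q' Y) - al q Y * al q' Y * (p - p')"
    by (simp add: al_def be_def algebra_simps power2_eq_square)
  have disc1: "1 \<le> \<bar>real_of_int (A2\<^sup>2 - 4 * A1 * A3)\<bar>" using disc by linarith
  have "(k2 * R) * 1 * (k1 * R) * \<bar>real_of_int (q - q')\<bar> \<le>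
      \<bar>real_of_int d0\<bar> * \<bar>real_of_int (A2\<^sup>2 - 4 * A1 * A3)\<bar> * \<bar>real_of_int Y\<bar> * \<bar>real_of_int (q - q')\<bar>"
    using d0 disc1 dd(5) k R by (intro mult_right_mono mult_mono) auto
  also have "\<dots> = \<bar>real_of_int (d0 * (A2\<^sup>2 - 4 * A1 * A3) * Y * (q - q'))\<bar>" by (simp only: abs_mult of_int_mult)
  also have "\<dots> \<le> \<bar>real_of_int (al q' Y)\<bar> * \<bar>real_of_int (p * al q Y + d0 * be q Y)\<bar>
      + \<bar>real_of_int (al q Y)\<bar> * \<bar>real_of_int (p' * al q' Y + d0 * be q' Y)\<bar>
      + \<bar>real_of_int (al q Y)\<bar> * \<bar>real_of_int (al q' Y)\<bar> * \<bar>real_of_int (p - p')\<bar>"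
  proof -
    have tri: "\<bar>real_of_int (u - v - w)\<bar> \<le> \<bar>real_of_int u\<bar> + \<bar>real_of_int v\<bar> + \<bar>real_of_int w\<bar>" for u v w :: int
      by simp
    show ?thesis unfolding id by (rule order_trans[OF tri]) (simp only: abs_mult of_int_mult order_refl)
  qed
  also have "\<dots> \<le> (4 * K * R) * (2 * R) + (4 * K * R) * (2 * R) + (4 * K * R) * (4 * K * R) * (2 * l)"
    using dd l K0 R by (intro add_mono mult_mono) (auto simp: p_def p'_def)
  also have "\<dots> = R\<^sup>2 * (16 * K * 1 + 32 * K * K * l)" by (simp add: power2_eq_square algebra_simps)
  also have "\<dots> \<le> R\<^sup>2 * (32 * K * K * l + 32 * K * K * l)"
  proof (intro mult_left_mono add_mono order_refl)
    have "16 * K * 1 \<le> 16 * K * (2 * l)" using l K0 by (intro mult_left_mono) auto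
    also have "\<dots> \<le> 32 * K * K * l" using K0 l by simp
    finally show "16 * K * 1 \<le> 32 * K * K * l" .
  qed auto
  finally have "R\<^sup>2 * (k1 * k2 * \<bar>real_of_int (q - q')\<bar>) \<le> R\<^sup>2 * (64 * K\<^sup>2 * l)"
    by (simp add: power2_eq_square mult_ac)
  then have "k1 * k2 * \<bar>real_of_int (q - q')\<bar> \<le> 64 * K\<^sup>2 * l" using R by simp
  then have q: "\<bar>real_of_int (q - q')\<bar> \<le> 64 * K\<^sup>2 / (k1 * k2) * l" using k by (simp add: field_simps)
  have "2 * 1 \<le> 64 * K\<^sup>2 / (k1 * k2)"
  proof -
    have "k1 * k2 \<le> 1" "1 \<le> K\<^sup>2" using k K0 by (auto intro: mult_le_one one_le_power)
    then show ?thesis using k by (simp add: le_divide_eq)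
  qed
  then have "2 * l \<le> 64 * K\<^sup>2 / (k1 * k2) * l" using l by (intro mult_right_mono) auto
  moreover have "2 * real_of_int (x - z) = real_of_int ((x - x') - (z - z')) + real_of_int (q - q')"
    by (simp add: q_def q'_def)
  moreover have "\<bar>u\<bar> \<le> M" if "2 * u = v + w" "\<bar>w\<bar> \<le> M" "\<bar>v\<bar> \<le> c" "c \<le> M" for u v w c M :: real
    using that by linarith
  ultimately show ?thesis using q l(2) by blast
qed

text \<open>A solution in \<open>Sd\<close> is determined by \<open>y\<close>, \<open>x\<close> and
  \<open>x'\<close>. For fixed \<open>y\<close>, \<open>solution_spread\<close> confines
  \<open>x\<close> to an interval of length comparable to \<open>l\<close>, which non-concentration
  counts; then \<open>x'\<close> has at most \<open>6 / k1\<close> values. The exponent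
  \<open>e\<close> collects the factors \<open>K\<close> (Frostman),
  \<open>K ^ (2 + m1 + m2)\<close> (from \<open>E1\<close>), \<open>K ^ m1\<close> (from
  \<open>1 / k1\<close>) and one \<open>K\<close> for \<open>64 * 6\<close>.\<close>

lemma card_window:
  assumes l: "1 \<le> 2 * l"
  shows "real (card {((x, y), (x', y')) \<in> Sd. \<bar>real_of_int (x - x') - c\<bar> \<le> l}) \<le> K ^ e * N\<^sup>2 * (2 * l / R) powr s"
proof -
  define W where "W = {((x, y), (x', y')) \<in> Sd. \<bar>real_of_int (x - x') - c\<bar> \<le> l}"
  define E1 where "E1 = 64 * K\<^sup>2 / (k1 * k2)"
  have E1: "1 \<le> E1"
  proof -
    have "k1 * k2 \<le> 1" "1 \<le> K\<^sup>2" using k K0 by (auto intro: mult_le_one one_le_power)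
    then show ?thesis using k by (simp add: E1_def le_divide_eq)
  qed
  have finW: "finite W" using finite_Sd by (auto simp: W_def intro: finite_subset[of _ Sd])
  define m where "m = (K * (2 * (E1 * l) / R) powr s * N) * (6 / k1)"
  have m0: "0 \<le> m" using K0 k by (simp add: m_def)
  have "real (card W) \<le> N * m"
  proof (rule card_le_fibers_inj[of W B "\<lambda>((x, y), (x', y')). y" _ "\<lambda>((x, y), (x', y')). (x, x')"])
    fix p assume p: "p \<in> W"
    obtain x0 y x0' y' where pe: "p = ((x0, y), (x0', y'))" by (metis prod.exhaust)
    have yy: "y' = y - d0" using p SdD(2) by (force simp: W_def pe)
    define V where "V = {(x, x'). ((x, y), (x', y')) \<in> W}"
    have V: "(\<lambda>((x, y), (x', y')). (x, x')) ` {q \<in> W. (\<lambda>((x, y), (x', y')). y) q = (\<lambda>((x, y), (x', y')). y) p} \<subseteq> V"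
    proof (clarsimp simp: pe V_def)
      fix x x' y'' assume "((x, y), (x', y'')) \<in> W"
      moreover from this have "y'' = y'" using SdD(2) yy by (force simp: W_def)
      ultimately show "((x, y), (x', y')) \<in> W" by simp
    qed
    have finV: "finite V"
    proof (rule finite_subset)
      show "V \<subseteq> B \<times> B" by (auto simp: V_def W_def dest!: SdD(1) dest: solD(1,3))
    qed (use B in simp)
    have "real (card V) \<le> real (card (fst ` V)) * (6 / k1)"
    proof (rule card_le_fibers_inj[of V _ fst _ snd])
      fix v assume "v \<in> V"
      show "real (card (snd ` {u \<in> V. fst u = fst v})) \<le> 6 / k1"
      proof (rule card_form_fiber)
        fix z assume "z \<in> snd ` {u \<in> V. fst u = fst v}"
        then have "((fst v, y), (z, y')) \<in> sol" using SdD(1) by (auto simp: V_def W_def)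
        then show "\<bar>real_of_int (form z y') - real_of_int (form (fst v) y)\<bar> < R \<and> k1 * R \<le> \<bar>real_of_int (al z y')\<bar>"
          using solD by (metis abs_minus_commute of_int_diff)
      qed (use finV in auto)
    qed (use finV k in \<open>auto simp: prod_eq_iff\<close>)
    also have "\<dots> \<le> m" unfolding m_def
    proof (rule mult_right_mono)
      have l': "l \<le> E1 * l" using E1 l by simp
      show "real (card (fst ` V)) \<le> K * (2 * (E1 * l) / R) powr s * N"
      proof (rule frostman_abs)
        fix x assume "x \<in> fst ` V"
        then obtain x' where x': "((x, y), (x', y')) \<in> W" by (auto simp: V_def)
        have "\<bar>real_of_int (x - x') - c\<bar> \<le> l" "\<bar>real_of_int (x0 - x0') - c\<bar> \<le> l" using x' p by (auto simp: W_def pe)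
        then have "\<bar>real_of_int ((x - x') - (x0 - x0'))\<bar> \<le> 2 * l" by (simp add: abs_le_iff)
        then have "\<bar>real_of_int (x - x0)\<bar> \<le> E1 * l"
          unfolding E1_def using solution_spread[OF _ _ l] x' p by (auto simp: W_def pe)
        moreover have "((x, y), (x', y')) \<in> Sd" using x' by (simp add: W_def)
        then have "x \<in> B" using solD(1)[OF SdD(1)] by blast
        ultimately show "x \<in> B \<and> \<bar>real_of_int x - real_of_int x0\<bar> \<le> E1 * l" by simp
      qed (use l l' in linarith)
    qed (use k in simp)
    finally have "real (card V) \<le> m" .
    then show "real (card ((\<lambda>((x, y), (x', y')). (x, x')) ` {q \<in> W. (\<lambda>((x, y), (x', y')). y) q = (\<lambda>((x, y), (x', y')). y) p})) \<le> m"
      using card_mono[OF finV V] by linarith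
  next
    fix p q assume pq: "p \<in> W" "q \<in> W" "(\<lambda>((x, y), (x', y')). y) p = (\<lambda>((x, y), (x', y')). y) q"
      "(\<lambda>((x, y), (x', y')). (x, x')) p = (\<lambda>((x, y), (x', y')). (x, x')) q"
    obtain x y x' y' z' where e: "p = ((x, y), (x', y'))" "q = ((x, y), (x', z'))"
      using pq(3,4) by (cases p; cases q) auto
    have "y - y' = d0" "y - z' = d0" using pq(1,2) SdD(2) by (auto simp: W_def e)
    then show "p = q" by (simp add: e)
  qed (use finW B m0 in \<open>auto simp: W_def dest: SdD(1) solD(2)\<close>)
  also have "m \<le> K ^ e * (2 * l / R) powr s * N"
  proof -
    have "(2 * (E1 * l) / R) powr s = E1 powr s * (2 * l / R) powr s"
      using E1 l R by (simp add: powr_mult powr_divide)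
    also have "\<dots> \<le> E1 * (2 * l / R) powr s"
      using E1 s powr_mono[of s 1 E1] by (intro mult_right_mono) auto
    finally have "m \<le> (K * (E1 * (2 * l / R) powr s) * N) * (6 / k1)"
      unfolding m_def using K0 k by (intro mult_right_mono mult_left_mono) auto
    also have "\<dots> = (384 * (K ^ 3 * K ^ (2 * m1 + m2))) * (2 * l / R) powr s * N"
      by (simp add: E1_def k1_def k2_def power_add mult_2 eval_nat_numeral mult_ac)
    also have "\<dots> \<le> (K * (K ^ 3 * K ^ (2 * m1 + m2))) * (2 * l / R) powr s * N"
      using K by (intro mult_right_mono) auto
    also have "K * (K ^ 3 * K ^ (2 * m1 + m2)) = K ^ e" by (simp add: e_def power_add eval_nat_numeral)
    finally show ?thesis .
  qed
  finally show ?thesis using N by (simp add: W_def power2_eq_square mult_ac mult_left_mono)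
qed

lemma finite_D1: "finite D1" unfolding D1_def by (rule finite_dset[OF B(1)])

lemma card_dset: "real (card (dset B n)) \<le> K ^ (2 * n) * N"
  by (rule pluennecke_dset[OF B(1,2) doubling])

lemma card_D1: "real (card D1) \<le> K\<^sup>2 * N"
  using card_dset[of 1] by (simp add: D1_def)

text \<open>The threshold is half of the guaranteed average, \<open>N\<^sup>2 / (8 * K ^ 3)\<close>
  solutions over at most \<open>K\<^sup>2 * N\<close> differences.\<close>

definition "popular = {p \<in> D1. N / (16 * K ^ 5) \<le> real (card {((x, y), (x', y')) \<in> Sd. x - x' = p})}"

text \<open>Unpopular differences carry at most half of the guaranteed solutions. On the rest,
  \<open>card_window\<close> with \<open>l = 1 / 2\<close> shows that no single difference has more
  than \<open>K ^ (e + 1) * N\<close> of them.\<close>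

lemma card_popular: "N \<le> K ^ (e + 5) * real (card popular)"
proof -
  define f where "f = (\<lambda>((x, y :: int), (x', y' :: int)). x - x' :: int)"
  have fib: "{((x, y), (x', y')) \<in> Sd. x - x' = p} = {q \<in> Sd. f q = p}" for p by (auto simp: f_def)
  have fD1: "f q \<in> D1" if "q \<in> Sd" for q
  proof -
    obtain x y x' y' where q: "q = ((x, y), (x', y'))" by (metis prod.exhaust)
    then show ?thesis using that SdD(1) solD(1,3) dset_1[of x B x'] by (simp add: f_def D1_def) blast
  qed
  define P where "P = {q \<in> Sd. f q \<in> popular}"
  define U where "U = {q \<in> Sd. f q \<notin> popular}"
  have fin: "finite P" "finite U" using finite_Sd by (auto simp: P_def U_def)
  have "real (card U) \<le> real (card (f ` U)) * (N / (16 * K ^ 5))"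
  proof (rule card_le_fibers[OF fin(2)])
    fix q assume q: "q \<in> U"
    have le: "card {r \<in> U. f r = f q} \<le> card {r \<in> Sd. f r = f q}"
      using finite_Sd by (intro card_mono) (auto simp: U_def)
    have "real (card {r \<in> Sd. f r = f q}) < N / (16 * K ^ 5)"
    proof -
      have "q \<in> Sd" "f q \<notin> popular" using q by (auto simp: U_def)
      then show ?thesis using fD1[of q] unfolding popular_def fib by simp
    qed
    then show "real (card {r \<in> U. f r = f q}) \<le> N / (16 * K ^ 5)" using le by linarith
  qed
  also have "\<dots> \<le> (K\<^sup>2 * N) * (N / (16 * K ^ 5))"
  proof (rule mult_right_mono)
    have "card (f ` U) \<le> card D1" using fD1 finite_D1 by (intro card_mono) (auto simp: U_def)
    then show "real (card (f ` U)) \<le> K\<^sup>2 * N" using card_D1 by linarith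
  qed (use K0 in auto)
  also have "\<dots> = N\<^sup>2 / (16 * K ^ 3)" using K0 by (simp add: eval_nat_numeral)
  finally have U: "real (card U) \<le> N\<^sup>2 / (16 * K ^ 3)" .
  have finp: "finite popular" using finite_D1 by (simp add: popular_def)
  have P: "real (card P) \<le> real (card popular) * (K ^ (e + 1) * N)"
  proof -
    have "real (card P) \<le> real (card (f ` P)) * (K ^ (e + 1) * N)"
    proof (rule card_le_fibers[OF fin(1)])
      fix q assume "q \<in> P"
      have "{r \<in> P. f r = f q} \<subseteq> {((x, y), (x', y')) \<in> Sd. \<bar>real_of_int (x - x') - real_of_int (f q)\<bar> \<le> 1 / 2}"
        by (auto simp: P_def f_def)
      then have "card {r \<in> P. f r = f q} \<le> card {((x, y), (x', y')) \<in> Sd. \<bar>real_of_int (x - x') - real_of_int (f q)\<bar> \<le> 1 / 2}"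
        using finite_Sd by (intro card_mono) (auto intro: finite_subset[of _ Sd])
      then have "real (card {r \<in> P. f r = f q}) \<le> K ^ e * N\<^sup>2 * (2 * (1 / 2) / R) powr s"
        using card_window[of "1 / 2" "real_of_int (f q)"] by linarith
      also have "\<dots> = K ^ e * N * (N * (1 / R) powr s)" by (simp add: power2_eq_square)
      also have "\<dots> \<le> K ^ e * N * K"
      proof (rule mult_left_mono)
        have "N * (1 / R) powr s \<le> (K * R powr s) * (1 / R) powr s" using card_upper by (intro mult_right_mono) auto
        also have "\<dots> = K" using R by (simp add: powr_divide)
        finally show "N * (1 / R) powr s \<le> K" .
      qed (use K0 in auto)
      finally show "real (card {r \<in> P. f r = f q}) \<le> K ^ (e + 1) * N" by (simp add: mult_ac)
    qed
    also have "\<dots> \<le> real (card popular) * (K ^ (e + 1) * N)"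
      using K0 card_mono[OF finp, of "f ` P"] by (intro mult_right_mono) (auto simp: P_def)
    finally show ?thesis .
  qed
  have "Sd = P \<union> U" by (auto simp: P_def U_def)
  then have "real (card Sd) \<le> real (card P) + real (card U)"
    by (metis card_Un_le of_nat_add of_nat_le_iff)
  moreover have "N\<^sup>2 / (8 * K ^ 3) = N\<^sup>2 / (16 * K ^ 3) + N\<^sup>2 / (16 * K ^ 3)" by simp
  ultimately have "N\<^sup>2 / (16 * K ^ 3) \<le> real (card popular) * (K ^ (e + 1) * N)"
    using many U P unfolding Sd_def[symmetric] by linarith
  then have "N * N \<le> (16 * K ^ 3) * (real (card popular) * (K ^ (e + 1) * N))"
    using K0 by (simp add: divide_le_eq power2_eq_square mult_ac)
  also have "\<dots> = N * (16 * (K ^ 4 * K ^ e * real (card popular)))" by (simp add: eval_nat_numeral)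
  finally have "N \<le> 16 * (K ^ 4 * K ^ e * real (card popular))" using N by simp
  also have "\<dots> \<le> K * (K ^ 4 * K ^ e * real (card popular))" using K by (intro mult_right_mono) auto
  finally show ?thesis by (simp add: power_add eval_nat_numeral mult_ac)
qed

end

lemma card_ge_fibers:
  fixes m :: real
  assumes "finite Z" "finite D" "\<And>p. p \<in> D \<Longrightarrow> m \<le> real (card {z\<in>Z. f z = p})"
  shows "real (card D) * m \<le> real (card Z)"
proof -
  have "real (card D) * m \<le> (\<Sum>p\<in>D. real (card {z\<in>Z. f z = p}))"
    using sum_mono[of D "\<lambda>_. m"] assms(3) by simp
  also have "\<dots> = real (card (\<Union>p\<in>D. {z\<in>Z. f z = p}))"
    using assms by (subst card_UN_disjoint) auto
  also have "\<dots> \<le> real (card Z)" using assms by (intro of_nat_mono card_mono) auto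
  finally show ?thesis .
qed

section \<open>Multiplication of difference sets by slopes\<close>

context form_direction
begin

lemma D1_eq: "D1 = {b - b' | b b'. b \<in> B \<and> b' \<in> B}"
  by (simp add: D1_def)

text \<open>Smallness of \<open>B + t B\<close> in covering form: up to an error \<open>c\<close>,
  multiplication by \<open>t\<close> sends \<open>B - B\<close> into \<open>M\<close> translates of
  \<open>n B - n B\<close>. This form is chosen because it is stable under sums and negatives of
  slopes.\<close>

definition "covers t M n c \<longleftrightarrow> (\<exists>T :: real set. finite T \<and> real (card T) \<le> M \<and>
  (\<forall>b\<in>D1. \<exists>\<tau>\<in>T. \<exists>w\<in>dset B n. \<bar>t * real_of_int b - \<tau> - real_of_int w\<bar> \<le> c))"

lemma covers_add:
  assumes "covers t M n c" "covers t' M' n' c'"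
  shows "covers (t + t') (M * M') (n + n') (c + c')"
proof -
  obtain T where T: "finite T" "real (card T) \<le> M"
    "\<And>b. b \<in> D1 \<Longrightarrow> \<exists>\<tau>\<in>T. \<exists>w\<in>dset B n. \<bar>t * real_of_int b - \<tau> - real_of_int w\<bar> \<le> c"
    using assms(1) unfolding covers_def by blast
  obtain T' where T': "finite T'" "real (card T') \<le> M'"
    "\<And>b. b \<in> D1 \<Longrightarrow> \<exists>\<tau>\<in>T'. \<exists>w\<in>dset B n'. \<bar>t' * real_of_int b - \<tau> - real_of_int w\<bar> \<le> c'"
    using assms(2) unfolding covers_def by blast
  define T2 where "T2 = (\<lambda>(x, y). x + y) ` (T \<times> T')"
  have "card T2 \<le> card (T \<times> T')" unfolding T2_def using T T' by (intro card_image_le) auto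
  then have "real (card T2) \<le> real (card T) * real (card T')" by (simp add: card_cartesian_product flip: of_nat_mult)
  also have "\<dots> \<le> M * M'" using T(2) T'(2) order_trans[OF of_nat_0_le_iff T(2)] by (intro mult_mono) auto
  finally have 1: "real (card T2) \<le> M * M'" .
  have 2: "\<exists>\<tau>\<in>T2. \<exists>w\<in>dset B (n + n'). \<bar>(t + t') * real_of_int b - \<tau> - real_of_int w\<bar> \<le> c + c'" if b: "b \<in> D1" for b
  proof -
    obtain \<tau> w where x: "\<tau> \<in> T" "w \<in> dset B n" "\<bar>t * real_of_int b - \<tau> - real_of_int w\<bar> \<le> c" using T(3)[OF b] by blast
    obtain \<tau>' w' where y: "\<tau>' \<in> T'" "w' \<in> dset B n'" "\<bar>t' * real_of_int b - \<tau>' - real_of_int w'\<bar> \<le> c'" using T'(3)[OF b] by blast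
    have "\<bar>(t + t') * real_of_int b - (\<tau> + \<tau>') - real_of_int (w + w')\<bar> \<le> c + c'"
      using x(3) y(3) by (simp add: distrib_right abs_le_iff)
    moreover have "\<tau> + \<tau>' \<in> T2" using x(1) y(1) by (force simp: T2_def)
    ultimately show ?thesis using dset_add[OF x(2) y(2)] by blast
  qed
  show ?thesis unfolding covers_def using 1 2 T(1) T'(1) by (intro exI[of _ T2]) (auto simp: T2_def)
qed

lemma covers_uminus:
  assumes "covers t M n c"
  shows "covers (- t) M n c"
proof -
  obtain T where T: "finite T" "real (card T) \<le> M"
    "\<And>b. b \<in> D1 \<Longrightarrow> \<exists>\<tau>\<in>T. \<exists>w\<in>dset B n. \<bar>t * real_of_int b - \<tau> - real_of_int w\<bar> \<le> c"
    using assms(1) unfolding covers_def by blast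
  have "\<exists>\<tau>\<in>uminus ` T. \<exists>w\<in>dset B n. \<bar>- t * real_of_int b - \<tau> - real_of_int w\<bar> \<le> c" if b: "b \<in> D1" for b
  proof -
    obtain \<tau> w where x: "\<tau> \<in> T" "w \<in> dset B n" "\<bar>t * real_of_int b - \<tau> - real_of_int w\<bar> \<le> c" using T(3)[OF b] by blast
    have "\<bar>- t * real_of_int b - (- \<tau>) - real_of_int (- w)\<bar> \<le> c" using x(3) by (simp add: abs_le_iff)
    then show ?thesis using x(1) dset_uminus[OF x(2)] by blast
  qed
  moreover have "card (uminus ` T) = card T" by (intro card_image) (auto simp: inj_on_def)
  ultimately show ?thesis unfolding covers_def using T(1,2) by (intro exI[of _ "uminus ` T"]) auto
qed

definition "g = 8 * a + 8 + m2"

text \<open>Subtracting the value at \<open>(2 * b, 2 * b)\<close> leaves an integer combination of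
  two elements of \<open>2 B - 2 B\<close>, with coefficients controlled by
  \<open>a\<close>.\<close>

lemma al_be_in_dset:
  assumes "x \<in> B" "y \<in> B" "x' \<in> B" "y' \<in> B" "b \<in> B"
  shows "al (x + x') (y + y') - al (2 * b) (2 * b) \<in> dset B (4 * a)"
    "be (x + x') (y + y') - be (2 * b) (2 * b) \<in> dset B (4 * a)"
proof -
  define u where "u = (x - b) + (x' - b)" define v where "v = (y - b) + (y' - b)"
  have uv: "u \<in> dset B 2" "v \<in> dset B 2"
    using dset_add[OF dset_1 dset_1, of x B b x' b] dset_add[OF dset_1 dset_1, of y B b y' b] assms
    by (auto simp: u_def v_def numeral_2_eq_2)
  have *: "c * u + d * v \<in> dset B (4 * a)" if "nat \<bar>c\<bar> * 2 + nat \<bar>d\<bar> * 2 \<le> 4 * a" for c d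
    using dset_add[OF dset_mult_int[OF uv(1)] dset_mult_int[OF uv(2)], of c d] dset_mono[OF B(2) that] by blast
  have e: "al (x + x') (y + y') - al (2 * b) (2 * b) = (2 * A1) * u + A2 * v"
    "be (x + x') (y + y') - be (2 * b) (2 * b) = A2 * u + (2 * A3) * v"
    by (simp_all add: al_def be_def u_def v_def algebra_simps)
  show "al (x + x') (y + y') - al (2 * b) (2 * b) \<in> dset B (4 * a)"
    unfolding e by (rule *) (use coeffs(1) in linarith)
  show "be (x + x') (y + y') - be (2 * b) (2 * b) \<in> dset B (4 * a)"
    unfolding e by (rule *) (use coeffs(1) in linarith)
qed

text \<open>The line \<open>p al + d0 be = O(R)\<close> carries many points \<open>(al, be)\<close> of bounded sumsets of \<open>B\<close>.
  Ruzsa covering by the set \<open>X\<close> of their first coordinates gives \<open>B \<subseteq> T + X - X\<close>, and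
  multiplication by the slope \<open>- be / al = p / d0\<close> turns \<open>X - X\<close> back into differences of \<open>B\<close>.\<close>

lemma popular_covers:
  assumes p: "p \<in> popular"
  shows "covers (real_of_int p / H) (K ^ (2 * g)) (16 * a) (8 * K ^ m2)"
proof -
  define t where "t = real_of_int p / H"
  define U where "U = {((x, y), (x', y')) \<in> Sd. x - x' = p}"
  define fa where "fa = (\<lambda>((x, y), (x', y')). al (x + x') (y + y'))"
  define fb where "fb = (\<lambda>((x, y), (x', y')). be (x + x') (y + y'))"
  define X where "X = fa ` U"
  have finU: "finite U" using finite_Sd by (auto simp: U_def intro: finite_subset[of _ Sd])
  have U: "N / (16 * K ^ 5) \<le> real (card U)" using p by (simp add: popular_def U_def)
  have lin: "\<bar>real_of_int p * real_of_int (fa q) + real_of_int d0 * real_of_int (fb q)\<bar> \<le> 2 * R" if "q \<in> U" for q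
  proof -
    obtain x y x' y' where q: "q = ((x, y), (x', y'))" by (metis prod.exhaust)
    then have "q \<in> Sd" "x - x' = p" using that by (auto simp: U_def)
    then show ?thesis using SdD(3)[of x y x' y'] by (simp add: q fa_def fb_def)
  qed
  \<comment> \<open>The line relation makes \<open>fb\<close> almost a function of
    \<open>fa\<close>, since \<open>d0\<close> is at least \<open>k2 * R\<close> in absolute value.
    This is why \<open>X\<close> is nearly as large as \<open>U\<close>.\<close>
  have near: "\<bar>real_of_int (fb q - fb r)\<bar> \<le> 4 * K ^ m2" if "q \<in> U" "r \<in> U" "fa q = fa r" for q r
  proof -
    have "\<bar>real_of_int d0 * real_of_int (fb q - fb r)\<bar> \<le> 4 * R"
      using lin[OF that(1)] lin[OF that(2)] that(3) by (simp add: right_diff_distrib abs_le_iff)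
    then have "\<bar>real_of_int d0\<bar> * \<bar>real_of_int (fb q - fb r)\<bar> \<le> 4 * R" by (simp only: abs_mult)
    moreover have "(k2 * R) * \<bar>real_of_int (fb q - fb r)\<bar> \<le> \<bar>real_of_int d0\<bar> * \<bar>real_of_int (fb q - fb r)\<bar>"
      using d0 by (intro mult_right_mono) auto
    ultimately have "R * (k2 * \<bar>real_of_int (fb q - fb r)\<bar>) \<le> R * 4" by (simp add: mult_ac)
    then have "k2 * \<bar>real_of_int (fb q - fb r)\<bar> \<le> 4" using R by simp
    then have "\<bar>real_of_int (fb q - fb r)\<bar> \<le> 4 / k2" using k by (simp add: le_divide_eq mult.commute)
    then show ?thesis by (simp add: k2_def)
  qed
  have "real (card U) \<le> real (card X) * (5 * K ^ m2)"
  proof (rule card_le_fibers_inj[of U X fa _ fb])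
    fix q assume q: "q \<in> U"
    have "real (card (fb ` {r \<in> U. fa r = fa q})) \<le> 4 * K ^ m2 + 1"
      by (rule card_int_diameter) (use near K0 in auto)
    also have "\<dots> \<le> 5 * K ^ m2" using one_le_power[OF K0(2), of m2] by simp
    finally show "real (card (fb ` {r \<in> U. fa r = fa q})) \<le> 5 * K ^ m2" .
  next
    fix q r assume qr: "q \<in> U" "r \<in> U" "fa q = fa r" "fb q = fb r"
    obtain x y x' y' where q: "q = ((x, y), (x', y'))" by (metis prod.exhaust)
    obtain z w z' w' where r: "r = ((z, w), (z', w'))" by (metis prod.exhaust)
    \<comment> \<open>Inverting the gradient map: with a nonzero discriminant, \<open>al\<close> and
      \<open>be\<close> determine the sums \<open>x + x'\<close> and \<open>y + y'\<close>, and
      \<open>p\<close> and \<open>d0\<close> supply the differences.\<close>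
    have id: "(A2\<^sup>2 - 4 * A1 * A3) * u = A2 * be u v - 2 * A3 * al u v"
      "(A2\<^sup>2 - 4 * A1 * A3) * v = A2 * al u v - 2 * A1 * be u v" for u v
      by (simp_all add: al_def be_def algebra_simps power2_eq_square)
    have ab: "al (x + x') (y + y') = al (z + z') (w + w')" "be (x + x') (y + y') = be (z + z') (w + w')"
      using qr(3,4) by (simp_all add: q r fa_def fb_def)
    have "(A2\<^sup>2 - 4 * A1 * A3) * (x + x') = (A2\<^sup>2 - 4 * A1 * A3) * (z + z')"
      by (simp only: id(1)[of "x + x'" "y + y'"] id(1)[of "z + z'" "w + w'"] ab)
    moreover have "(A2\<^sup>2 - 4 * A1 * A3) * (y + y') = (A2\<^sup>2 - 4 * A1 * A3) * (w + w')"
      by (simp only: id(2)[of "y + y'" "x + x'"] id(2)[of "w + w'" "z + z'"] ab)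
    ultimately have "x + x' = z + z'" "y + y' = w + w'" using disc by auto
    moreover have "x - x' = p" "z - z' = p" "y - y' = d0" "w - w' = d0"
      using qr(1,2) SdD(2) by (auto simp: U_def q r)
    ultimately show "q = r" by (simp add: q r)
  qed (use finU K0 in \<open>auto simp: X_def\<close>)
  then have "N / (16 * K ^ 5) \<le> real (card X) * (5 * K ^ m2)" using U by linarith
  then have NX: "N \<le> 80 * K ^ (5 + m2) * real (card X)"
    using K0 by (simp add: divide_le_eq power_add mult_ac)
  have X: "finite X" "X \<noteq> {}" using finU NX N by (auto simp: X_def)
  obtain b0 where b0: "b0 \<in> B" using B by auto
  have UB: "x \<in> B \<and> y \<in> B \<and> x' \<in> B \<and> y' \<in> B" if "((x, y), (x', y')) \<in> U" for x y x' y'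
    using that SdD(1) solD(1-4) by (simp add: U_def) blast
  have fd: "fa q - al (2 * b0) (2 * b0) \<in> dset B (4 * a)" "fb q - be (2 * b0) (2 * b0) \<in> dset B (4 * a)" if "q \<in> U" for q
  proof -
    obtain x y x' y' where q: "q = ((x, y), (x', y'))" by (metis prod.exhaust)
    show "fa q - al (2 * b0) (2 * b0) \<in> dset B (4 * a)" "fb q - be (2 * b0) (2 * b0) \<in> dset B (4 * a)"
      using al_be_in_dset[OF _ _ _ _ b0] UB that by (auto simp: q fa_def fb_def)
  qed
  have "B + X \<subseteq> {b0 + al (2 * b0) (2 * b0)} + dset B (1 + 4 * a)"
  proof
    fix z assume "z \<in> B + X"
    then obtain b q where b: "b \<in> B" "q \<in> U" "z = b + fa q" by (auto simp: set_plus_def X_def)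
    have "(b - b0) + (fa q - al (2 * b0) (2 * b0)) \<in> dset B (1 + 4 * a)"
      by (rule dset_add[OF dset_1[OF b(1) b0] fd(1)[OF b(2)]])
    then show "z \<in> {b0 + al (2 * b0) (2 * b0)} + dset B (1 + 4 * a)"
      unfolding set_plus_def b(3) by (intro CollectI bexI[of _ "b0 + al (2 * b0) (2 * b0)"] bexI[rotated]) auto
  qed
  then have "card (B + X) \<le> card (dset B (1 + 4 * a))"
    using card_mono[OF finite_set_plus[OF _ finite_dset[OF B(1)]]] by (metis card_sum_singleton finite.emptyI finite.insertI)
  then have BX: "real (card (B + X)) \<le> K ^ (2 * (1 + 4 * a)) * N"
    using card_dset[of "1 + 4 * a"] by linarith
  obtain T where T: "T \<subseteq> B" "card T * card X \<le> card (B + X)"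
    and cov: "\<And>b. b \<in> B \<Longrightarrow> \<exists>t\<in>T. \<exists>x\<in>X. \<exists>y\<in>X. b = t + (x - y)"
    using ruzsa_covering[OF B(1) X] by blast
  have finT: "finite T" using T B finite_subset by blast
  have cX: "0 < real (card X)" using X by (simp add: card_gt_0_iff)
  have "real (card T) * real (card X) \<le> real (card (B + X))" using T(2) by (metis of_nat_le_iff of_nat_mult)
  also have "\<dots> \<le> K ^ (2 * (1 + 4 * a)) * (80 * K ^ (5 + m2) * real (card X))"
    using NX K0 by (intro order_trans[OF BX] mult_left_mono) auto
  finally have "real (card T) \<le> K ^ (2 * (1 + 4 * a)) * (80 * K ^ (5 + m2))" using cX by (simp add: mult_ac)
  also have "\<dots> = 80 * K ^ (8 * a + 7 + m2)" by (simp add: power_add power_mult mult_ac eval_nat_numeral)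
  also have "\<dots> \<le> K * K ^ (8 * a + 7 + m2)" using K by (intro mult_right_mono) auto
  also have "\<dots> = K ^ g" by (simp add: g_def power_add eval_nat_numeral)
  finally have cT: "real (card T) \<le> K ^ g" .
  have base: "\<exists>\<tau>\<in>T. \<exists>w\<in>dset B (8 * a). \<bar>t * real_of_int b - t * real_of_int \<tau> - real_of_int w\<bar> \<le> 4 * K ^ m2" if b: "b \<in> B" for b
  proof -
    obtain \<tau> q r where *: "\<tau> \<in> T" "q \<in> U" "r \<in> U" "b = \<tau> + (fa q - fa r)" using cov[OF b] by (auto simp: X_def)
    define E where "E = (real_of_int p * real_of_int (fa q) + real_of_int d0 * real_of_int (fb q))
      - (real_of_int p * real_of_int (fa r) + real_of_int d0 * real_of_int (fb r))"
    have E: "\<bar>E\<bar> \<le> 4 * R" unfolding E_def using lin[OF *(2)] lin[OF *(3)] by linarith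
    have fbd: "fb q - fb r \<in> dset B (8 * a)"
      using dset_diff[OF fd(2)[OF *(2)] fd(2)[OF *(3)]] by (simp add: mult.commute)
    \<comment> \<open>The slope is \<open>p / H\<close> with \<open>H\<close> the absolute value of
      \<open>d0\<close>, so the sign of \<open>d0\<close> decides the order.\<close>
    define w where "w = (if 0 < d0 then fb r - fb q else fb q - fb r)"
    have w: "w \<in> dset B (8 * a)" using fbd dset_uminus[OF fbd] by (simp add: w_def)
    define z where "z = t * real_of_int b - t * real_of_int \<tau> - real_of_int w"
    have "H * real_of_int w = - (real_of_int d0 * real_of_int (fb q - fb r))"
      by (auto simp: w_def H_def algebra_simps)
    then have "H * z = E"
      unfolding z_def *(4) using H(1) by (simp add: t_def E_def algebra_simps)
    then have "H * \<bar>z\<bar> \<le> 4 * R"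
      using E H(1) by (metis abs_mult abs_of_pos less_trans zero_less_one)
    moreover have "(k2 * R) * \<bar>z\<bar> \<le> H * \<bar>z\<bar>"
      using H(3) by (intro mult_right_mono) auto
    ultimately have "R * (k2 * \<bar>z\<bar>) \<le> R * 4" by (simp add: mult_ac)
    then have "k2 * \<bar>z\<bar> \<le> 4" using R by simp
    then have "\<bar>z\<bar> \<le> 4 / k2" using k by (simp add: le_divide_eq mult.commute)
    then show ?thesis using *(1) w by (auto simp: z_def k2_def)
  qed
  define T2 where "T2 = (\<lambda>(x, y). t * real_of_int x - t * real_of_int y) ` (T \<times> T)"
  have "card T2 \<le> card (T \<times> T)" unfolding T2_def using finT by (intro card_image_le) auto
  then have "real (card T2) \<le> real (card T) * real (card T)" by (simp add: card_cartesian_product flip: of_nat_mult)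
  also have "\<dots> \<le> K ^ g * K ^ g" using cT K0 by (intro mult_mono) auto
  finally have c2: "real (card T2) \<le> K ^ (2 * g)" by (simp add: mult_2 power_add)
  have "\<exists>\<tau>\<in>T2. \<exists>w\<in>dset B (16 * a). \<bar>t * real_of_int d - \<tau> - real_of_int w\<bar> \<le> 8 * K ^ m2" if dD1: "d \<in> D1" for d
  proof -
    obtain b b' where d: "b \<in> B" "b' \<in> B" "d = b - b'" using dD1 unfolding D1_eq by blast
    obtain \<tau> w where 1: "\<tau> \<in> T" "w \<in> dset B (8 * a)" "\<bar>t * real_of_int b - t * real_of_int \<tau> - real_of_int w\<bar> \<le> 4 * K ^ m2"
      using base[OF d(1)] by blast
    obtain \<tau>' w' where 2: "\<tau>' \<in> T" "w' \<in> dset B (8 * a)" "\<bar>t * real_of_int b' - t * real_of_int \<tau>' - real_of_int w'\<bar> \<le> 4 * K ^ m2"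
      using base[OF d(2)] by blast
    have "\<bar>t * real_of_int d - (t * real_of_int \<tau> - t * real_of_int \<tau>') - real_of_int (w - w')\<bar> \<le> 8 * K ^ m2"
      using 1(3) 2(3) unfolding d(3) by (simp add: right_diff_distrib abs_le_iff)
    moreover have "t * real_of_int \<tau> - t * real_of_int \<tau>' \<in> T2" using 1(1) 2(1) by (force simp: T2_def)
    moreover have "w - w' \<in> dset B (16 * a)" using dset_diff[OF 1(2) 2(2)] by simp
    ultimately show ?thesis by blast
  qed
  then show ?thesis unfolding covers_def t_def[symmetric] using c2 finT by (intro exI[of _ T2]) (auto simp: T2_def)
qed

lemma covers_four:
  assumes "{p1, p2, p3, p4} \<subseteq> popular"
  shows "covers ((real_of_int p1 / H - real_of_int p2 / H) + (real_of_int p3 / H - real_of_int p4 / H))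
    (K ^ (8 * g)) (64 * a) (32 * K ^ m2)"
proof -
  have *: "covers (real_of_int p / H - real_of_int q / H) (K ^ (4 * g)) (32 * a) (16 * K ^ m2)"
    if "p \<in> popular" "q \<in> popular" for p q
    using covers_add[OF popular_covers[OF that(1)] covers_uminus[OF popular_covers[OF that(2)]]]
    by (simp add: power_add[symmetric])
  show ?thesis using covers_add[OF *[of p1 p2] *[of p3 p4]] assms by (simp add: power_add[symmetric])
qed

lemma card_floor_slopes:
  assumes v: "covers v (K ^ (8 * g)) (64 * a) (32 * K ^ m2)" and u: "covers u (K ^ (8 * g)) (64 * a) (32 * K ^ m2)"
    and Y: "\<And>y. y \<in> Y \<Longrightarrow> \<exists>p\<in>D1. \<exists>p'\<in>D1. \<exists>p''\<in>D1. y = c0 + real_of_int p + v * real_of_int p' + u * real_of_int p''"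
  shows "real (card (floor ` Y)) \<le> K ^ (16 * g + 256 * a + m2 + 3) * N"
proof -
  obtain T where T: "finite T" "real (card T) \<le> K ^ (8 * g)"
    "\<And>b. b \<in> D1 \<Longrightarrow> \<exists>\<tau>\<in>T. \<exists>w\<in>dset B (64 * a). \<bar>v * real_of_int b - \<tau> - real_of_int w\<bar> \<le> 32 * K ^ m2"
    using v unfolding covers_def by blast
  obtain T' where T': "finite T'" "real (card T') \<le> K ^ (8 * g)"
    "\<And>b. b \<in> D1 \<Longrightarrow> \<exists>\<tau>\<in>T'. \<exists>w\<in>dset B (64 * a). \<bar>u * real_of_int b - \<tau> - real_of_int w\<bar> \<le> 32 * K ^ m2"
    using u unfolding covers_def by blast
  define T2 where "T2 = (\<lambda>(x, y). c0 + x + y) ` (T \<times> T')"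
  have finT2: "finite T2" using T T' by (simp add: T2_def)
  have "card T2 \<le> card (T \<times> T')" unfolding T2_def using T T' by (intro card_image_le) auto
  then have "real (card T2) \<le> real (card T) * real (card T')" by (simp add: card_cartesian_product flip: of_nat_mult)
  also have "\<dots> \<le> K ^ (8 * g) * K ^ (8 * g)" using T(2) T'(2) K0 by (intro mult_mono) auto
  finally have c2: "real (card T2) \<le> K ^ (16 * g)" by (simp add: power_add[symmetric])
  have "\<exists>\<tau>\<in>T2. \<exists>w\<in>dset B (1 + 128 * a). \<bar>y - \<tau> - real_of_int w\<bar> \<le> 64 * K ^ m2" if y: "y \<in> Y" for y
  proof -
    obtain p p' p'' where p: "p \<in> D1" "p' \<in> D1" "p'' \<in> D1" "y = c0 + real_of_int p + v * real_of_int p' + u * real_of_int p''"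
      using Y[OF y] by blast
    obtain \<tau> w where 1: "\<tau> \<in> T" "w \<in> dset B (64 * a)" "\<bar>v * real_of_int p' - \<tau> - real_of_int w\<bar> \<le> 32 * K ^ m2"
      using T(3)[OF p(2)] by blast
    obtain \<tau>' w' where 2: "\<tau>' \<in> T'" "w' \<in> dset B (64 * a)" "\<bar>u * real_of_int p'' - \<tau>' - real_of_int w'\<bar> \<le> 32 * K ^ m2"
      using T'(3)[OF p(3)] by blast
    have "\<bar>y - (c0 + \<tau> + \<tau>') - real_of_int (p + (w + w'))\<bar> \<le> 64 * K ^ m2"
      using 1(3) 2(3) unfolding p(4) by (simp add: abs_le_iff)
    moreover have "c0 + \<tau> + \<tau>' \<in> T2" using 1(1) 2(1) by (force simp: T2_def)
    moreover have "p + (w + w') \<in> dset B (1 + 128 * a)"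
      using dset_add[OF p(1)[unfolded D1_def] dset_add[OF 1(2) 2(2)]] by simp
    ultimately show ?thesis by blast
  qed
  then have "real (card (floor ` Y)) \<le> real (card T2) * real (card (dset B (1 + 128 * a))) * (2 * (64 * K ^ m2) + 2)"
    using K0 by (intro card_floor_le[OF finT2 finite_dset[OF B(1)]]) (simp, blast)
  also have "\<dots> \<le> K ^ (16 * g) * (K ^ (2 * (1 + 128 * a)) * N) * (K * K ^ m2)"
  proof (intro mult_mono c2 card_dset)
    have "2 * (64 * K ^ m2) + 2 \<le> 130 * K ^ m2" using one_le_power[OF K0(2), of m2] by simp
    also have "\<dots> \<le> K * K ^ m2" using K by (intro mult_right_mono) auto
    finally show "2 * (64 * K ^ m2) + 2 \<le> K * K ^ m2" .
  qed (use K0 in auto)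
  also have "\<dots> = K ^ (16 * g + 256 * a + m2 + 3) * N"
    by (simp add: power_add eval_nat_numeral mult_ac)
  finally show ?thesis .
qed

section \<open>The popular slopes as a slope configuration\<close>

definition "E0 = 2 * e + 2 * m2 + 16 * g + 256 * a + 12"

text \<open>The popular slopes \<open>p / H\<close> that lie in one unit interval, translated to
  \<open>[0, 1]\<close>, form a \<open>slope_config\<close> with \<open>\<delta> = 1 / H\<close>;
  they are separated because the \<open>p\<close> are integers. Since
  \<open>R / H \<le> K ^ m2\<close>, few unit intervals occur and the fullest one keeps a large
  share. \<open>E0\<close> dominates the exponents of the three bounds required: size,
  non-concentration and sums along slopes.\<close>

lemma scale_bound: "H powr (s * (1 - s) / 10) \<le> 1000000 * K ^ (7 * E0)"
proof -
  have H0: "0 < H" using H by simp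
  have finp: "finite popular" using finite_D1 by (simp add: popular_def)
  have "0 < K ^ (e + 5) * real (card popular)" using N card_popular by linarith
  then have nep: "popular \<noteq> {}" by auto
  have D1R: "\<bar>real_of_int p\<bar> \<le> R" if "p \<in> D1" for p
  proof -
    obtain b b' where b: "b \<in> B" "b' \<in> B" "p = b - b'" using \<open>p \<in> D1\<close> unfolding D1_eq by blast
    have "0 \<le> real_of_int b" "real_of_int b \<le> R" "0 \<le> real_of_int b'" "real_of_int b' \<le> R" using B(3) b by auto
    then show ?thesis unfolding b(3) by (simp add: abs_le_iff)
  qed
  define f where "f = (\<lambda>p. \<lfloor>real_of_int p / H\<rfloor>)"
  define C where "C = {\<lfloor>- (R / H)\<rfloor>..\<lfloor>R / H\<rfloor>}"
  have "f ` popular \<subseteq> C"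
  proof
    fix i assume "i \<in> f ` popular"
    then obtain p where p: "p \<in> D1" "i = f p" by (auto simp: popular_def)
    have "- (R / H) \<le> real_of_int p / H" "real_of_int p / H \<le> R / H"
      using D1R[OF p(1)] H0 by (auto simp: abs_le_iff divide_right_mono minus_divide_left simp del: minus_divide_left[symmetric] intro!: divide_right_mono)
    then show "i \<in> C" unfolding p(2) f_def C_def by (auto intro: floor_mono)
  qed
  then obtain p0 where p0: "p0 \<in> popular" "card popular \<le> card C * card {p\<in>popular. f p = f p0}"
    using pigeonhole_fiber[of popular C f] finp nep by (auto simp: C_def)
  define D where "D = {p\<in>popular. f p = f p0}"
  have "popular \<subseteq> D1" by (auto simp: popular_def)
  moreover have "D \<subseteq> popular" by (auto simp: D_def)
  ultimately have D: "D \<subseteq> popular" "D \<subseteq> D1" "finite D" "p0 \<in> D"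
    using p0(1) finp finite_subset by (auto simp: D_def)
  have RH: "R / H \<le> K ^ m2"
  proof -
    have "R * k2 \<le> H" using H(3) by (simp add: mult.commute)
    then have "R \<le> H / k2" using k by (simp add: le_divide_eq)
    then show ?thesis using H0 by (simp add: k2_def field_simps)
  qed
  have "real (card C) \<le> 2 * (R / H) + 2" 
  proof -
    have "0 \<le> R / H" using R H0 by simp
    then have "0 \<le> \<lfloor>R / H\<rfloor>" "\<lfloor>- (R / H)\<rfloor> \<le> 0" by linarith+
    then have "real (card C) = real_of_int (\<lfloor>R / H\<rfloor> - \<lfloor>- (R / H)\<rfloor> + 1)"
      unfolding C_def card_atLeastAtMost_int by linarith
    then show ?thesis by linarith
  qed
  also have "\<dots> \<le> 4 * K ^ m2" using RH one_le_power[OF K0(2), of m2] by linarith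
  finally have cC: "real (card C) \<le> 4 * K ^ m2" .
  have "real (card popular) \<le> real (card C) * real (card D)" using p0(2) by (simp add: D_def flip: of_nat_mult)
  also have "\<dots> \<le> (4 * K ^ m2) * real (card D)" using cC by (intro mult_right_mono) auto
  also have "\<dots> \<le> (K * K ^ m2) * real (card D)" using K by (intro mult_right_mono) auto
  finally have "K ^ (e + 5) * real (card popular) \<le> K ^ (e + 5) * ((K * K ^ m2) * real (card D))"
    using K0 by (intro mult_left_mono) auto
  then have ND: "N \<le> K ^ (e + m2 + 6) * real (card D)"
    using card_popular by (simp add: power_add eval_nat_numeral mult_ac)
  define j where "j = real_of_int (f p0)"
  define h where "h = (\<lambda>p. real_of_int p / H - j)"
  have hdiff: "h p - h q = real_of_int p / H - real_of_int q / H" for p q by (simp add: h_def)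
  have injh: "inj_on h D" using H0 by (auto simp: inj_on_def h_def)
  define S where "S = h ` D"
  have cS: "card S = card D" unfolding S_def by (rule card_image[OF injh])
  define L where "L = K ^ E0"
  have pw: "K ^ i \<le> L" if "i \<le> E0" for i unfolding L_def using that K0 by (intro power_increasing) auto
  have L1: "1 \<le> L" using pw[of 0] by simp
  interpret slope_config S "1 / H" s L
  proof
    show "S \<subseteq> {0..1}"
    proof
      fix x assume "x \<in> S"
      then obtain p where p: "p \<in> D" "x = h p" by (auto simp: S_def)
      have "f p = f p0" using p by (simp add: D_def)
      then have "j \<le> real_of_int p / H" "real_of_int p / H \<le> j + 1" unfolding j_def f_def by linarith+
      then show "x \<in> {0..1}" by (simp add: p(2) h_def)
    qed
    show "separated (1 / H) S" unfolding separated_def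
    proof (intro ballI impI)
      fix x y assume "x \<in> S" "y \<in> S" "x \<noteq> y"
      then obtain p q where pq: "x = h p" "y = h q" "p \<noteq> q" by (auto simp: S_def)
      have "1 \<le> \<bar>real_of_int (p - q)\<bar>" using pq(3) by linarith
      then have "1 / H \<le> \<bar>real_of_int (p - q)\<bar> / H" using H0 by (intro divide_right_mono) auto
      also have "\<dots> = \<bar>x - y\<bar>" unfolding pq hdiff using H0 by (simp add: diff_divide_distrib[symmetric])
      finally show "1 / H \<le> \<bar>x - y\<bar>" .
    qed
    show "real (card S) \<le> L * (1 / H) powr (- s)"
    proof -
      have "card D \<le> card D1" using D finite_D1 by (intro card_mono) auto
      then have "real (card S) \<le> K\<^sup>2 * N" using card_D1 cS by linarith
      also have "\<dots> \<le> K\<^sup>2 * (K * R powr s)" using card_upper K0 by (intro mult_left_mono) auto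
      also have "R powr s \<le> (H * K ^ m2) powr s" using RH R H0 s by (intro powr_mono2) (auto simp: field_simps)
      also have "(H * K ^ m2) powr s = H powr s * (K ^ m2) powr s" using H0 K0 by (simp add: powr_mult)
      also have "\<dots> \<le> H powr s * K ^ m2"
        using s powr_mono[of s 1 "K ^ m2"] one_le_power[OF K0(2), of m2] by (intro mult_left_mono) auto
      finally have "real (card S) \<le> K ^ (3 + m2) * H powr s"
        using K0 by (simp add: power_add eval_nat_numeral mult_ac)
      also have "\<dots> \<le> L * H powr s" by (intro mult_right_mono pw) (auto simp: E0_def)
      also have "H powr s = (1 / H) powr (- s)" using H0 by (simp add: powr_minus powr_divide)
      finally show ?thesis .
    qed
    show "real (card (S \<inter> {x..x + l})) \<le> L * l powr s * real (card S)" if l: "1 / H \<le> l" for x l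
    proof -
      define D' where "D' = {p\<in>D. x \<le> h p \<and> h p \<le> x + l}"
      define c where "c = (x + j + l / 2) * H"
      define Z where "Z = {((x, y), (x', y')) \<in> Sd. \<bar>real_of_int (x - x') - c\<bar> \<le> l * H / 2}"
      have l0: "0 < l" using l H0 by (smt (verit) zero_less_divide_1_iff)
      have lH: "1 \<le> 2 * (l * H / 2)" using l H0 by (simp add: divide_le_eq)
      have "S \<inter> {x..x + l} = h ` D'" by (auto simp: S_def D'_def)
      then have eq: "card (S \<inter> {x..x + l}) = card D'"
        using card_image inj_on_subset[OF injh, of D'] by (auto simp: D'_def)
      \<comment> \<open>Each popular difference in the window brings many solutions, so the bound of
        \<open>card_window\<close> on solutions becomes a bound on slopes: non-concentration passes
        from \<open>B\<close> to \<open>S\<close>.\<close>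
      have "real (card D') * (N / (16 * K ^ 5)) \<le> real (card Z)"
      proof (rule card_ge_fibers)
        show "finite Z" using finite_Sd by (auto simp: Z_def intro: finite_subset[of _ Sd])
        show "finite D'" using D by (simp add: D'_def)
        fix p assume p: "p \<in> D'"
        have "\<bar>real_of_int p - c\<bar> \<le> l * H / 2"
          using p H0 by (simp add: D'_def h_def c_def abs_le_iff field_simps)
        then have "{((x, y), (x', y')) \<in> Sd. x - x' = p} = {z \<in> Z. (\<lambda>((x, y), (x', y')). x - x') z = p}"
          by (auto simp: Z_def)
        then show "N / (16 * K ^ 5) \<le> real (card {z \<in> Z. (\<lambda>((x, y), (x', y')). x - x') z = p})"
          using p D(1) by (auto simp: D'_def popular_def)
      qed
      also have "\<dots> \<le> K ^ e * N\<^sup>2 * (2 * (l * H / 2) / R) powr s" unfolding Z_def by (rule card_window[OF lH])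
      also have "\<dots> \<le> K ^ e * N\<^sup>2 * l powr s"
      proof (intro mult_left_mono powr_mono2)
        have "l * H \<le> l * R" using H(2) l0 by (intro mult_left_mono) auto
        then show "2 * (l * H / 2) / R \<le> l" using R by (simp add: divide_le_eq)
      qed (use l0 H0 R s K0 in auto)
      finally have "real (card D') * N \<le> K ^ e * N\<^sup>2 * l powr s * (16 * K ^ 5)"
        using K0 by (simp add: divide_le_eq)
      then have "N * real (card D') \<le> N * (16 * K ^ (e + 5) * l powr s * N)"
        by (simp add: power_add power2_eq_square mult_ac)
      then have "real (card D') \<le> 16 * K ^ (e + 5) * l powr s * N" using N by simp
      also have "\<dots> \<le> K * K ^ (e + 5) * l powr s * (K ^ (e + m2 + 6) * real (card D))"
        using K ND by (intro mult_mono) auto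
      also have "\<dots> = K ^ (2 * e + m2 + 12) * (l powr s * real (card D))"
        by (simp add: power_add eval_nat_numeral mult_2 mult_ac)
      also have "\<dots> \<le> L * (l powr s * real (card D))" by (intro mult_right_mono pw) (auto simp: E0_def)
      finally show ?thesis unfolding eq cS by (simp add: mult.assoc)
    qed
    show "real (cov (1 / H) {x + (((d1 - d2) + (d3 - d4)) * y + ((d5 - d6) + (d7 - d8)) * z) | x y z.
        x \<in> S \<and> y \<in> S \<and> z \<in> S}) \<le> L * real (card S)" (is "real (cov _ ?Z) \<le> _")
      if d: "{d1, d2, d3, d4, d5, d6, d7, d8} \<subseteq> S" for d1 d2 d3 d4 d5 d6 d7 d8
    proof -
      define hi where "hi = inv_into D h"
      have hi: "hi d \<in> D" "h (hi d) = d" if "d \<in> S" for d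
        using that by (auto simp: hi_def S_def inv_into_into f_inv_into_f)
      define v where "v = (d1 - d2) + (d3 - d4)"
      define u where "u = (d5 - d6) + (d7 - d8)"
      have cover: "covers ((e1 - e2) + (e3 - e4)) (K ^ (8 * g)) (64 * a) (32 * K ^ m2)"
        if e: "e1 \<in> S" "e2 \<in> S" "e3 \<in> S" "e4 \<in> S" for e1 e2 e3 e4
      proof -
        have "(e1 - e2) + (e3 - e4) = (h (hi e1) - h (hi e2)) + (h (hi e3) - h (hi e4))"
          by (simp only: hi(2)[OF e(1)] hi(2)[OF e(2)] hi(2)[OF e(3)] hi(2)[OF e(4)])
        moreover have "{hi e1, hi e2, hi e3, hi e4} \<subseteq> popular" using hi(1) e D(1) by blast
        ultimately show ?thesis using covers_four unfolding hdiff by metis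
      qed
      have cv: "covers v (K ^ (8 * g)) (64 * a) (32 * K ^ m2)"
        unfolding v_def by (rule cover) (use d in auto)
      have cu: "covers u (K ^ (8 * g)) (64 * a) (32 * K ^ m2)"
        unfolding u_def by (rule cover) (use d in auto)
      \<comment> \<open>The translation of the slopes by \<open>j\<close> in all three summands,
        multiplied by \<open>H\<close>.\<close>
      define c0 where "c0 = - (j * H) * (1 + v + u)"
      have "real (card (floor ` (\<lambda>x. x / (1 / H)) ` ?Z)) \<le> K ^ (16 * g + 256 * a + m2 + 3) * N"
      proof (rule card_floor_slopes[OF cv cu])
        fix y assume "y \<in> (\<lambda>x. x / (1 / H)) ` ?Z"
        then obtain q q' q'' where q: "q \<in> D" "q' \<in> D" "q'' \<in> D" "y = (h q + (v * h q' + u * h q'')) / (1 / H)"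
          by (auto simp: S_def v_def u_def)
        have "y = c0 + real_of_int q + v * real_of_int q' + u * real_of_int q''"
          unfolding q(4) c0_def h_def using H0 by (simp add: field_simps)
        then show "\<exists>p\<in>D1. \<exists>p'\<in>D1. \<exists>p''\<in>D1. y = c0 + real_of_int p + v * real_of_int p' + u * real_of_int p''"
          using q(1-3) D(2) by blast
      qed
      then have "real (cov (1 / H) ?Z) \<le> K ^ (16 * g + 256 * a + m2 + 3) * N"
        by (simp only: cov_def image_image)
      also have "\<dots> \<le> K ^ (16 * g + 256 * a + m2 + 3) * (K ^ (e + m2 + 6) * real (card D))"
        using ND K0 by (intro mult_left_mono) auto
      also have "\<dots> = K ^ ((16 * g + 256 * a + m2 + 3) + (e + m2 + 6)) * real (card D)"
        by (simp only: power_add mult.assoc)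
      also have "\<dots> \<le> L * real (card D)" by (intro mult_right_mono pw) (auto simp: E0_def)
      finally show ?thesis by (simp add: cS)
    qed
  qed (use s H(1) L1 D S_def in auto)
  have "(1 / H) powr (- (s * (1 - s) / 10)) \<le> 1000000 * L ^ 7" by (rule constant_lower_bound)
  also have "(1 / H) powr (- (s * (1 - s) / 10)) = H powr (s * (1 - s) / 10)"
    using H0 by (simp add: powr_minus powr_divide)
  also have "L ^ 7 = K ^ (7 * E0)" by (simp add: L_def power_mult[symmetric] mult.commute)
  finally show ?thesis .
qed

end

text \<open>Pigeonhole: at least \<open>N ^ 3 / (8 * K)\<close> far solutions are distributed over
  the at most \<open>K\<^sup>2 * N\<close> differences \<open>y - y'\<close>.\<close>

lemma (in form_config) exists_direction:
  assumes kR: "1 \<le> k1 * R" "1 < k2 * R"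
  obtains d0 where "form_direction B A1 A2 A3 a R K s d0"
proof -
  define far where "far = {((x, y), (x', y')) \<in> sol. k2 * R \<le> \<bar>real_of_int (y - y')\<bar>}"
  have far: "N ^ 3 / (8 * K) \<le> real (card far)" unfolding far_def by (rule card_sol_far) (use kR in auto)
  define f where "f = (\<lambda>((x :: int, y), (x' :: int, y')). y - y' :: int)"
  have "finite far" using finite_sol by (auto simp: far_def intro: finite_subset[of _ sol])
  moreover have "0 < N ^ 3 / (8 * K)" using N K0 by simp
  then have "far \<noteq> {}" using far by (metis card.empty not_le of_nat_0)
  moreover have "finite (dset B 1)" by (rule finite_dset[OF B(1)])
  moreover have "f ` far \<subseteq> dset B 1"
  proof
    fix d assume "d \<in> f ` far"
    then obtain x y x' y' where *: "((x, y), (x', y')) \<in> sol" "d = y - y'" by (auto simp: far_def f_def)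
    show "d \<in> dset B 1" unfolding *(2) by (rule dset_1[OF solD(2,4)[OF *(1)]])
  qed
  ultimately obtain q where q: "q \<in> far" "card far \<le> card (dset B 1) * card {r \<in> far. f r = f q}"
    by (rule pigeonhole_fiber)
  have "form_direction_axioms B A1 A2 A3 R K s (f q)"
  proof
    show "1 \<le> k1 * R" "1 < k2 * R" by fact+
    show "k2 * R \<le> \<bar>real_of_int (f q)\<bar>" using q(1) by (auto simp: far_def f_def)
    have "{r \<in> far. f r = f q} \<subseteq> {((x, y), (x', y')) \<in> sol. y - y' = f q}" by (auto simp: far_def f_def)
    then have "card {r \<in> far. f r = f q} \<le> card {((x, y), (x', y')) \<in> sol. y - y' = f q}"
      using finite_sol by (intro card_mono) (auto intro: finite_subset[of _ sol])
    then have "real (card (dset B 1)) * real (card {r \<in> far. f r = f q})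
        \<le> (K ^ (2 * 1) * N) * real (card {((x, y), (x', y')) \<in> sol. y - y' = f q})"
      by (rule mult_mono[OF pluennecke_dset[OF B(1,2) doubling] of_nat_mono]) (use K0 in simp_all)
    moreover have "real (card far) \<le> real (card (dset B 1)) * real (card {r \<in> far. f r = f q})"
      using q(2) by (simp only: of_nat_mult[symmetric] of_nat_le_iff)
    ultimately have "N ^ 3 / (8 * K) \<le> K ^ 2 * N * real (card {((x, y), (x', y')) \<in> sol. y - y' = f q})"
      using far by (simp only: mult_1_right)
    then have "N * N\<^sup>2 \<le> N * (K ^ 2 * real (card {((x, y), (x', y')) \<in> sol. y - y' = f q}) * (8 * K))"
      using K0 by (simp add: divide_le_eq eval_nat_numeral mult_ac)
    then have "N\<^sup>2 \<le> K ^ 2 * real (card {((x, y), (x', y')) \<in> sol. y - y' = f q}) * (8 * K)" using N by simp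
    then show "N\<^sup>2 / (8 * K ^ 3) \<le> real (card {((x, y), (x', y')) \<in> sol. y - y' = f q})"
      using K0 by (simp add: divide_le_eq eval_nat_numeral mult_ac)
  qed
  then show thesis using that form_direction.intro form_config_axioms by blast
qed

text \<open>The exponent depends on \<open>s\<close> and \<open>a\<close> only, so
  \<open>\<epsilon>\<close> can be chosen after it. If \<open>k1 * R\<close> or
  \<open>k2 * R\<close> is too small, \<open>R\<close> is already below a power of \<open>K\<close>;
  otherwise \<open>H \<ge> k2 * R\<close> carries \<open>scale_bound\<close> over to
  \<open>R\<close>.\<close>

lemma form_config_lower_bound:
  fixes s :: real and a :: nat
  obtains E :: nat where
    "\<And>B A1 A2 A3 R K. form_config B A1 A2 A3 a R K s \<Longrightarrow> R powr (s * (1 - s) / 10) \<le> K ^ E"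
proof
  fix B A1 A2 A3 R K assume "form_config B A1 A2 A3 a R K s"
  then interpret form_config B A1 A2 A3 a R K s .
  define x where "x = s * (1 - s) / 10"
  have x: "0 \<le> x" "x \<le> 1"
  proof -
    have "0 \<le> s * (1 - s)" "s * (1 - s) \<le> 1 * 1" using s mult_mono[of s 1 "1 - s" 1] by auto
    then show "0 \<le> x" "x \<le> 1" by (auto simp: x_def)
  qed
  have xp: "t powr x \<le> t" if "1 \<le> t" for t :: real using powr_mono[OF x(2) that] that by simp
  show "R powr x \<le> K ^ (7 * form_direction.E0 a s + 2 + form_config.m1 s + form_config.m2 s)"
  proof (cases "1 \<le> k1 * R \<and> 1 < k2 * R")
    case True
    then obtain d0 where "form_direction B A1 A2 A3 a R K s d0" using exists_direction by blast
    then interpret form_direction B A1 A2 A3 a R K s d0 .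
    have "R \<le> H / k2" using H(3) k by (simp add: le_divide_eq mult.commute)
    then have "R \<le> H * K ^ m2" by (simp add: k2_def)
    then have "R powr x \<le> (H * K ^ m2) powr x" using R x by (intro powr_mono2) auto
    also have "\<dots> = H powr x * (K ^ m2) powr x" using H(1) K0 by (simp add: powr_mult)
    also have "\<dots> \<le> (1000000 * K ^ (7 * E0)) * K ^ m2"
      using scale_bound xp[of "K ^ m2"] one_le_power[OF K0(2), of m2] K0 by (intro mult_mono) (auto simp: x_def)
    also have "\<dots> \<le> (K ^ 2 * K ^ (7 * E0)) * K ^ m2"
      using power_mono[OF K, of 2] K0 by (intro mult_right_mono) auto
    also have "\<dots> = K ^ (7 * E0 + 2 + m2)" by (simp only: power_add mult_ac)
    also have "\<dots> \<le> K ^ (7 * E0 + 2 + m1 + m2)" using K0 by (intro power_increasing) auto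
    finally show ?thesis .
  next
    case False
    then have "R \<le> K ^ m1 \<or> R \<le> K ^ m2" using K0 by (auto simp: k1_def k2_def not_le not_less)
    moreover have "K ^ m1 \<le> K ^ (7 * form_direction.E0 a s + 2 + m1 + m2)"
      "K ^ m2 \<le> K ^ (7 * form_direction.E0 a s + 2 + m1 + m2)" using K0 by (intro power_increasing; simp)+
    ultimately show ?thesis using xp[OF R] by linarith
  qed
qed

section \<open>Discretization\<close>

lemma covering_number_attained:
  assumes "finite E" "0 \<le> \<delta>"
  obtains F where "finite F" "card F = covering_number \<delta> E" "E \<subseteq> (\<Union>x\<in>F. {x..x + \<delta>})"
proof -
  have "\<exists>n. \<exists>F. finite F \<and> card F = n \<and> E \<subseteq> (\<Union>x\<in>F. {x..x + \<delta>})"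
    using assms by (intro exI[of _ "card E"] exI[of _ E]) force
  from LeastI_ex[OF this] show ?thesis unfolding covering_number_def[symmetric] using that by blast
qed

lemma covering_number_pos:
  assumes "finite E" "E \<noteq> {}" "0 \<le> \<delta>"
  shows "1 \<le> covering_number \<delta> E"
proof -
  obtain F where F: "finite F" "card F = covering_number \<delta> E" "E \<subseteq> (\<Union>x\<in>F. {x..x + \<delta>})"
    using covering_number_attained assms by metis
  then have "F \<noteq> {}" using assms(2) by auto
  then show ?thesis using F by (metis One_nat_def Suc_leI card_gt_0_iff)
qed

lemma finite_sumset: "finite B \<Longrightarrow> finite (sumset B)"
  unfolding sumset_def by (intro finite_image_set2) auto

lemma finite_form_image: "finite B \<Longrightarrow> finite (form_image \<phi> B)"
  unfolding form_image_def by (intro finite_image_set2) auto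

definition grid :: "real \<Rightarrow> real set \<Rightarrow> int set" where
  "grid R B = (\<lambda>b. \<lfloor>b * R\<rfloor>) ` B"

lemma floor_mult_inj:
  assumes "delta_separated (1 / R) A" "0 < R" "x \<in> A" "y \<in> A" "\<lfloor>x * R\<rfloor> = \<lfloor>y * R\<rfloor>"
  shows "x = y"
proof (rule ccontr)
  assume "x \<noteq> y"
  then have "1 / R \<le> \<bar>x - y\<bar>" using assms by (auto simp: delta_separated_def)
  then have "1 \<le> \<bar>x * R - y * R\<bar>" using assms(2) by (simp add: divide_le_eq abs_mult left_diff_distrib[symmetric])
  then show False using assms(5) by linarith
qed

lemma card_grid:
  assumes "delta_separated (1 / R) A" "0 < R" "B \<subseteq> A"
  shows "card (grid R B) = card B"
  unfolding grid_def using floor_mult_inj[OF assms(1,2)] assms(3) by (intro card_image inj_onI) blast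

text \<open>After scaling, a covering interval has length 1 and the two roundings together lose less
  than 2. Relative to \<open>\<lfloor>x * R\<rfloor>\<close> this leaves only the offsets -1, 0 and
  1.\<close>

lemma card_grid_sum:
  assumes "finite B" "0 < R"
  shows "card (grid R B + grid R B) \<le> 3 * covering_number (1 / R) (sumset B)"
proof -
  obtain F where F: "finite F" "card F = covering_number (1 / R) (sumset B)" "sumset B \<subseteq> (\<Union>x\<in>F. {x..x + 1 / R})"
    using covering_number_attained[OF finite_sumset[OF assms(1)], of "1 / R"] assms(2) by auto
  have "grid R B + grid R B \<subseteq> (\<lambda>(x, i). \<lfloor>x * R\<rfloor> + i) ` (F \<times> {-1..1})"
  proof
    fix z assume "z \<in> grid R B + grid R B"
    then obtain b b' where b: "b \<in> B" "b' \<in> B" "z = \<lfloor>b * R\<rfloor> + \<lfloor>b' * R\<rfloor>" by (auto simp: set_plus_def grid_def)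
    then obtain x where x: "x \<in> F" "x \<le> b + b'" "b + b' \<le> x + 1 / R" using F(3) by (fastforce simp: sumset_def)
    have "x * R \<le> b * R + b' * R" "b * R + b' * R \<le> x * R + 1"
      using mult_right_mono[OF x(2), of R] mult_right_mono[OF x(3), of R] assms(2) by (simp_all add: distrib_right)
    then have "z - \<lfloor>x * R\<rfloor> \<in> {-1..1}" unfolding b(3) atLeastAtMost_iff by linarith
    then show "z \<in> (\<lambda>(x, i). \<lfloor>x * R\<rfloor> + i) ` (F \<times> {-1..1})" using x(1) by force
  qed
  then have "card (grid R B + grid R B) \<le> card (F \<times> {-1..1::int})"
    by (rule surj_card_le[rotated]) (use F in simp)
  then show ?thesis using F(2) by (simp add: card_cartesian_product)
qed

text \<open>Rounding arguments of size at most \<open>R\<close> by at most 1 changes the integral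
  form by at most \<open>3 * a * R\<close>. After division by \<open>R\<close> its values are
  therefore within \<open>3 * a\<close> of \<open>m * R\<close> times the original ones, and a
  covering interval of length \<open>1 / R\<close> becomes one of length \<open>m\<close>.\<close>

lemma card_grid_form:
  fixes A1 A2 A3 :: int and m a :: nat
  assumes B: "finite B" "B \<subseteq> {0..1}" and R: "1 \<le> R"
    and A: "real_of_int A1 = real m * a1" "real_of_int A2 = real m * a2" "real_of_int A3 = real m * a3"
    and a: "\<bar>A1\<bar> + \<bar>A2\<bar> + \<bar>A3\<bar> \<le> int a"
  shows "real (cov R ((\<lambda>(x, y). real_of_int (A1 * x\<^sup>2 + A2 * x * y + A3 * y\<^sup>2)) ` (grid R B \<times> grid R B)))
    \<le> real (covering_number (1 / R) (form_image (quad_form a1 a2 a3) B)) * (2 * (real m + 3 * real a) + 2)"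
proof -
  define E where "E = form_image (quad_form a1 a2 a3) B"
  obtain F where F: "finite F" "card F = covering_number (1 / R) E" "E \<subseteq> (\<Union>x\<in>F. {x..x + 1 / R})"
    using covering_number_attained[OF finite_form_image[OF B(1)], of "1 / R"] R unfolding E_def by auto
  define f where "f = (\<lambda>(x, y). real_of_int (A1 * x\<^sup>2 + A2 * x * y + A3 * y\<^sup>2))"
  define Y where "Y = (\<lambda>x. x / R) ` f ` (grid R B \<times> grid R B)"
  define T where "T = (\<lambda>x. real m * x * R) ` F"
  have "\<exists>t\<in>T. \<exists>w\<in>{0::int}. \<bar>y - t - real_of_int w\<bar> \<le> real m + 3 * real a" if yY: "y \<in> Y" for y
  proof -
    obtain b b' where b: "b \<in> B" "b' \<in> B" and y: "y = f (\<lfloor>b * R\<rfloor>, \<lfloor>b' * R\<rfloor>) / R"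
      using yY by (auto simp: Y_def grid_def)
    define n n' where "n = real_of_int \<lfloor>b * R\<rfloor>" and "n' = real_of_int \<lfloor>b' * R\<rfloor>"
    define t t' where "t = b * R - n" and "t' = b' * R - n'"
    have t: "0 \<le> t" "t \<le> 1" "0 \<le> t'" "t' \<le> 1" unfolding t_def t'_def n_def n'_def by linarith+
    have b01: "0 \<le> b" "b \<le> 1" "0 \<le> b'" "b' \<le> 1" using B(2) b by auto
    have bR: "0 \<le> b * R" "b * R \<le> R" "0 \<le> b' * R" "b' * R \<le> R"
      using b01 R mult_right_mono[of b 1 R] mult_right_mono[of b' 1 R] by auto
    have n: "0 \<le> n" "n \<le> R" "0 \<le> n'" "n' \<le> R" unfolding n_def n'_def using bR by (simp, linarith, simp, linarith)
    obtain x where x: "x \<in> F" "x \<le> quad_form a1 a2 a3 b b'" "quad_form a1 a2 a3 b b' \<le> x + 1 / R"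
      using F(3) b by (fastforce simp: E_def form_image_def)
    define q where "q = real m * quad_form a1 a2 a3 b b' * R"
    have q1: "real m * x * R \<le> q" "q \<le> real m * x * R + real m"
    proof -
      show "real m * x * R \<le> q" unfolding q_def using x(2) R by (intro mult_right_mono mult_left_mono) auto
      have "q \<le> real m * (x + 1 / R) * R" unfolding q_def using x(3) R by (intro mult_right_mono mult_left_mono) auto
      also have "\<dots> = real m * x * R + real m" using R by (simp add: distrib_left distrib_right)
      finally show "q \<le> real m * x * R + real m" .
    qed
    have bn: "b * R = n + t" "b' * R = n' + t'" by (simp_all add: t_def t'_def)
    have "q * R = A1 * (b * R)\<^sup>2 + A2 * (b * R) * (b' * R) + A3 * (b' * R)\<^sup>2"
      unfolding q_def quad_form_def A by (simp add: power2_eq_square algebra_simps)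
    moreover have "y * R = A1 * n\<^sup>2 + A2 * n * n' + A3 * n'\<^sup>2"
      using R by (simp add: y f_def n_def n'_def)
    ultimately have diff: "(q - y) * R = A1 * ((2 * n + t) * t) + A2 * (n * t' + n' * t + t * t') + A3 * ((2 * n' + t') * t')"
      unfolding bn by (simp add: power2_eq_square algebra_simps)
    have e1: "0 \<le> (2 * n + t) * t" "(2 * n + t) * t \<le> (3 * R) * 1" "0 \<le> (2 * n' + t') * t'" "(2 * n' + t') * t' \<le> (3 * R) * 1"
      using n t R mult_mono[of "2 * n + t" "3 * R" t 1] mult_mono[of "2 * n' + t'" "3 * R" t' 1] by auto
    have e2: "0 \<le> n * t' + n' * t + t * t'" "n * t' + n' * t + t * t' \<le> R * 1 + R * 1 + 1 * R"
      using n t R mult_mono[of n R t' 1] mult_mono[of n' R t 1] mult_mono[of t 1 t' R] by auto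
    have "\<bar>(q - y) * R\<bar> \<le> \<bar>real_of_int A1\<bar> * \<bar>(2 * n + t) * t\<bar> + \<bar>real_of_int A2\<bar> * \<bar>n * t' + n' * t + t * t'\<bar> + \<bar>real_of_int A3\<bar> * \<bar>(2 * n' + t') * t'\<bar>"
      unfolding diff abs_mult[symmetric] by linarith
    also have "\<dots> \<le> \<bar>real_of_int A1\<bar> * (3 * R) + \<bar>real_of_int A2\<bar> * (3 * R) + \<bar>real_of_int A3\<bar> * (3 * R)"
      using e1 e2 by (intro add_mono mult_left_mono) auto
    also have "\<dots> = real_of_int (\<bar>A1\<bar> + \<bar>A2\<bar> + \<bar>A3\<bar>) * (3 * R)" by (simp add: algebra_simps)
    also have "\<dots> \<le> real_of_int (int a) * (3 * R)" using a R by (intro mult_right_mono) (simp_all only: of_int_le_iff)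
    finally have "\<bar>q - y\<bar> * R \<le> (3 * real a) * R" using R by (simp add: abs_mult mult_ac)
    then have "\<bar>q - y\<bar> \<le> 3 * real a" using R by simp
    then have "\<bar>y - real m * x * R\<bar> \<le> real m + 3 * real a" using q1 by linarith
    then show ?thesis using x(1) by (auto simp: T_def)
  qed
  then have "real (card (floor ` Y)) \<le> real (card T) * real (card {0::int}) * (2 * (real m + 3 * real a) + 2)"
    using F by (intro card_floor_le) (auto simp: T_def)
  also have "\<dots> \<le> real (card F) * (2 * (real m + 3 * real a) + 2)"
    using card_image_le[OF F(1)] by (simp add: T_def mult_right_mono)
  finally show ?thesis by (simp add: F(2) E_def Y_def f_def cov_def image_image)
qed

lemma rational_common_denominator:
  fixes a1 a2 a3 :: real
  assumes "a1 \<in> \<rat>" "a2 \<in> \<rat>" "a3 \<in> \<rat>"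
  obtains m :: nat and A1 A2 A3 :: int where "0 < m"
    "real_of_int A1 = real m * a1" "real_of_int A2 = real m * a2" "real_of_int A3 = real m * a3"
proof -
  have *: "\<exists>n::nat. 0 < n \<and> (\<exists>i::int. real_of_int i = real n * x)" if xQ: "x \<in> \<rat>" for x :: real
  proof -
    obtain i n where "0 < n" "x = real_of_int i / real_of_int n" using Rats_cases'[OF xQ] by metis
    then show ?thesis by (intro exI[of _ "nat n"] conjI exI[of _ i]) auto
  qed
  obtain n1 i1 n2 i2 n3 i3 where n: "0 < n1" "real_of_int i1 = real n1 * a1" "0 < n2" "real_of_int i2 = real n2 * a2"
    "0 < n3" "real_of_int i3 = real n3 * a3" using *[OF assms(1)] *[OF assms(2)] *[OF assms(3)] by metis
  show thesis
    by (rule that[of "n1 * n2 * n3" "int n2 * int n3 * i1" "int n1 * int n3 * i2" "int n1 * int n2 * i3"]) (use n in auto)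
qed


text \<open>The exponent \<open>3 * \<epsilon>\<close> is forced by non-concentration:
  \<open>2 * \<epsilon>\<close> for \<open>C\<close> and \<open>\<epsilon>\<close> for comparing
  \<open>card A\<close> with \<open>card B\<close>. Doubling and form values cost only
  \<open>2 * \<epsilon>\<close>. The prefactor covers the constant of \<open>card_grid_form\<close>
  and the lower bound \<open>1000\<close>.\<close>

lemma grid_form_config:
  fixes A1 A2 A3 :: int and m a :: nat and \<epsilon> C :: real
  assumes s: "0 < s" "s < 1" and R: "1 < R" and eps: "0 < \<epsilon>"
    and A: "A \<subseteq> {0..1}" "finite A" "delta_separated (1 / R) A" "real (card A) = of_int \<lceil>R powr s\<rceil>"
    and frost: "\<And>x l. 1 / R \<le> l \<Longrightarrow> real (card (A \<inter> {x..x + l})) \<le> C * l powr s * real (card A)"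
    and B: "B \<subseteq> A" "B \<noteq> {}" "R powr (- \<epsilon>) * real (card A) \<le> real (card B)"
    and C: "1 \<le> C" "C \<le> R powr (2 * \<epsilon>)"
    and small: "real (covering_number (1 / R) (sumset B)) \<le> R powr \<epsilon> * real (card A)"
      "real (covering_number (1 / R) (form_image (quad_form a1 a2 a3) B)) \<le> R powr \<epsilon> * real (card A)"
    and coeffs: "real_of_int A1 = real m * a1" "real_of_int A2 = real m * a2" "real_of_int A3 = real m * a3"
      "\<bar>A1\<bar> + \<bar>A2\<bar> + \<bar>A3\<bar> \<le> int a" "A2\<^sup>2 \<noteq> 4 * A1 * A3"
  shows "form_config (grid R B) A1 A2 A3 a R ((1000 + 2 * real m + 6 * real a) * R powr (3 * \<epsilon>)) s"
proof -
  define k0 where "k0 = 1000 + 2 * real m + 6 * real a"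
  define K where "K = k0 * R powr (3 * \<epsilon>)"
  have finB: "finite B" using A B finite_subset by blast
  have cg: "card (grid R B) = card B" by (rule card_grid[OF A(3) _ B(1)]) (use R in auto)
  have Rp: "1 \<le> R powr e" if "0 \<le> e" for e using R that by (simp add: ge_one_powr_ge_zero)
  have AB: "real (card A) \<le> R powr \<epsilon> * real (card B)"
  proof -
    have "R powr \<epsilon> * (R powr (- \<epsilon>) * real (card A)) \<le> R powr \<epsilon> * real (card B)"
      using B(3) by (intro mult_left_mono) auto
    then show ?thesis using R by (simp add: mult.assoc[symmetric] powr_add[symmetric])
  qed
  have K3: "c * R powr e * real (card B) \<le> K * real (card B)" if "0 \<le> c" "c \<le> k0" "e \<le> 3 * \<epsilon>" for c e
    unfolding K_def using that R by (intro mult_right_mono mult_mono powr_mono) auto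
  have small': "R powr \<epsilon> * real (card A) \<le> R powr (2 * \<epsilon>) * real (card B)"
    using mult_left_mono[OF AB, of "R powr \<epsilon>"] by (simp add: mult.assoc[symmetric] powr_add[symmetric])
  have "form_config (grid R B) A1 A2 A3 a R K s"
  proof
    have "1000 * 1 \<le> k0 * R powr (3 * \<epsilon>)" using Rp[of "3 * \<epsilon>"] eps by (intro mult_mono) (auto simp: k0_def)
    then show "1000 \<le> K" by (simp add: K_def)
    have "real a * 1 \<le> k0 * R powr (3 * \<epsilon>)" using Rp[of "3 * \<epsilon>"] eps by (intro mult_mono) (auto simp: k0_def)
    then show "real a \<le> K" by (simp add: K_def)
    show "0 \<le> n \<and> real_of_int n \<le> R" if n: "n \<in> grid R B" for n
    proof -
      obtain b where b: "b \<in> B" "n = \<lfloor>b * R\<rfloor>" using n by (auto simp: grid_def)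
      have "0 \<le> b" "b \<le> 1" using b A(1) B(1) by auto
      then have "0 \<le> b * R" "b * R \<le> 1 * R" using R by (auto intro: mult_right_mono)
      then show ?thesis unfolding b(2) by (simp, linarith)
    qed
    have "real (card (grid R B + grid R B)) \<le> 3 * real (covering_number (1 / R) (sumset B))"
      using card_grid_sum[OF finB, of R] R by linarith
    also have "\<dots> \<le> 3 * R powr (2 * \<epsilon>) * real (card B)" using small(1) small' by simp
    also have "\<dots> \<le> K * real (card B)" using eps by (intro K3) (auto simp: k0_def)
    finally show "real (card (grid R B + grid R B)) \<le> K * real (card (grid R B))" by (simp add: cg)
    show "real (card {b \<in> grid R B. x \<le> real_of_int b \<and> real_of_int b \<le> x + l}) \<le> K * (l / R) powr s * real (card (grid R B))"
      if l: "1 \<le> l" for x l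
    proof -
      \<comment> \<open>The length is \<open>l + 1\<close> because
        \<open>\<lfloor>b * R\<rfloor> \<le> x + l\<close> only bounds \<open>b * R\<close> by
        \<open>x + l + 1\<close>.\<close>
      define I where "I = A \<inter> {x / R..x / R + (l + 1) / R}"
      have "{b \<in> grid R B. x \<le> real_of_int b \<and> real_of_int b \<le> x + l} \<subseteq> (\<lambda>b. \<lfloor>b * R\<rfloor>) ` I"
      proof
        fix n assume n: "n \<in> {b \<in> grid R B. x \<le> real_of_int b \<and> real_of_int b \<le> x + l}"
        then obtain b where b: "b \<in> B" "n = \<lfloor>b * R\<rfloor>" by (auto simp: grid_def)
        have "x \<le> b * R" "b * R \<le> x + (l + 1)" using n unfolding b(2) by (simp_all, linarith+)
        then have "x / R \<le> b" "b \<le> x / R + (l + 1) / R"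
          using R by (simp_all add: divide_le_eq le_divide_eq add_divide_distrib[symmetric])
        then show "n \<in> (\<lambda>b. \<lfloor>b * R\<rfloor>) ` I" using b B(1) by (auto simp: I_def)
      qed
      then have "card {b \<in> grid R B. x \<le> real_of_int b \<and> real_of_int b \<le> x + l} \<le> card I"
        by (rule surj_card_le[rotated]) (use A in \<open>simp add: I_def\<close>)
      also have "real (card I) \<le> C * ((l + 1) / R) powr s * real (card A)"
        unfolding I_def by (rule frost) (use l R in \<open>auto simp: divide_right_mono\<close>)
      also have "((l + 1) / R) powr s \<le> (2 * (l / R)) powr s"
        using l R s by (intro powr_mono2) (auto simp: divide_right_mono)
      also have "(2 * (l / R)) powr s = 2 powr s * (l / R) powr s" by (rule powr_mult)
      also have "\<dots> \<le> 2 * (l / R) powr s" using s powr_mono[of s 1 "2::real"] by (intro mult_right_mono) auto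
      finally have "real (card {b \<in> grid R B. x \<le> real_of_int b \<and> real_of_int b \<le> x + l})
          \<le> C * (2 * (l / R) powr s) * real (card A)" using C by (simp add: mult_left_mono mult_right_mono)
      also have "\<dots> \<le> R powr (2 * \<epsilon>) * (2 * (l / R) powr s) * (R powr \<epsilon> * real (card B))"
        using C AB by (intro mult_mono) auto
      also have "\<dots> = (2 * (R powr (2 * \<epsilon>) * R powr \<epsilon>) * real (card B)) * (l / R) powr s" by simp
      also have "R powr (2 * \<epsilon>) * R powr \<epsilon> = R powr (3 * \<epsilon>)" by (simp add: powr_add[symmetric])
      also have "(2 * R powr (3 * \<epsilon>) * real (card B)) * (l / R) powr s \<le> (K * real (card B)) * (l / R) powr s"
        by (rule mult_right_mono[OF K3]) (auto simp: k0_def)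
      finally show ?thesis by (simp add: cg mult_ac)
    qed
    have "real (card B) \<le> real (card A)" using card_mono[OF A(2) B(1)] by simp
    also have "\<dots> \<le> R powr s + 1" unfolding A(4) by linarith
    also have "\<dots> \<le> 2 * R powr s" using Rp[of s] s by simp
    also have "\<dots> \<le> K * R powr s" using \<open>1000 \<le> K\<close> by (intro mult_right_mono) auto
    finally show "real (card (grid R B)) \<le> K * R powr s" by (simp add: cg)
    have "real (cov R ((\<lambda>(x, y). real_of_int (A1 * x\<^sup>2 + A2 * x * y + A3 * y\<^sup>2)) ` (grid R B \<times> grid R B)))
        \<le> real (covering_number (1 / R) (form_image (quad_form a1 a2 a3) B)) * (2 * (real m + 3 * real a) + 2)"
      by (rule card_grid_form[OF finB _ _ coeffs(1-4)]) (use A B R in auto)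
    also have "\<dots> \<le> (R powr (2 * \<epsilon>) * real (card B)) * (2 * (real m + 3 * real a) + 2)"
      using small(2) small' by (intro mult_right_mono) auto
    also have "\<dots> = (2 * (real m + 3 * real a) + 2) * R powr (2 * \<epsilon>) * real (card B)" by simp
    also have "\<dots> \<le> K * real (card B)" using eps by (intro K3) (auto simp: k0_def)
    finally show "real (cov R ((\<lambda>(x, y). real_of_int (A1 * x\<^sup>2 + A2 * x * y + A3 * y\<^sup>2)) ` (grid R B \<times> grid R B)))
        \<le> K * real (card (grid R B))" by (simp add: cg)
  qed (use s R finB B coeffs in \<open>auto simp: grid_def\<close>)
  then show ?thesis by (simp add: K_def k0_def)
qed

theorem theorem1p7:
  fixes s :: real
  assumes "0 < s" and "s < 1"
  shows "\<exists>K>0. \<forall>a1 a2 a3 :: real.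
           a1 \<in> \<rat> \<longrightarrow> a2 \<in> \<rat> \<longrightarrow> a3 \<in> \<rat> \<longrightarrow> a2^2 - 4 * a1 * a3 \<noteq> 0 \<longrightarrow>
           (\<exists>\<epsilon>>0. \<exists>c0>0. \<forall>C::real. C \<ge> 1 \<longrightarrow>
             (\<forall>\<delta>>0. \<forall>A :: real set.
                A \<subseteq> {0..1} \<longrightarrow> finite A \<longrightarrow> delta_separated \<delta> A \<longrightarrow>
                real (card A) = of_int \<lceil>\<delta> powr (-s)\<rceil> \<longrightarrow>
                (\<forall>x l. l \<ge> \<delta> \<longrightarrow> real (card (A \<inter> {x..x+l})) \<le> C * l powr s * real (card A)) \<longrightarrow>
                (\<forall>B. B \<subseteq> A \<longrightarrow> real (card B) \<ge> \<delta> powr \<epsilon> * real (card A) \<longrightarrow>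
                   real (covering_number \<delta> (sumset B))
                   + real (covering_number \<delta> (form_image (quad_form a1 a2 a3) B))
                   \<ge> c0 * C powr (-K) * \<delta> powr (-\<epsilon>) * real (card A))))"
proof (rule exI[of _ 1], intro conjI allI impI)
  \<comment> \<open>\<open>K = 1\<close> suffices: if \<open>C > \<delta> powr (- 2 \<epsilon>)\<close>, already the trivial bound for \<open>B + B\<close> is enough.\<close>
  fix a1 a2 a3 :: real
  assume rat: "a1 \<in> \<rat>" "a2 \<in> \<rat>" "a3 \<in> \<rat>" and disc: "a2^2 - 4 * a1 * a3 \<noteq> 0"
  obtain m :: nat and A1 A2 A3 :: int where m: "0 < m"
    and mA: "real_of_int A1 = real m * a1" "real_of_int A2 = real m * a2" "real_of_int A3 = real m * a3"
    using rational_common_denominator[OF rat] by metis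
  define a where "a = nat (\<bar>A1\<bar> + \<bar>A2\<bar> + \<bar>A3\<bar>)"
  have a: "\<bar>A1\<bar> + \<bar>A2\<bar> + \<bar>A3\<bar> \<le> int a" by (simp add: a_def)
  have discA: "A2\<^sup>2 \<noteq> 4 * A1 * A3"
  proof
    assume "A2\<^sup>2 = 4 * A1 * A3"
    then have "(real_of_int A2)\<^sup>2 = 4 * real_of_int A1 * real_of_int A3"
      by (metis of_int_mult of_int_numeral of_int_power)
    then have "(real m)\<^sup>2 * (a2^2 - 4 * a1 * a3) = 0" unfolding mA by (simp add: algebra_simps power2_eq_square)
    then show False using disc m by simp
  qed
  obtain E :: nat where E: "\<And>B A1 A2 A3 R K. form_config B A1 A2 A3 a R K s \<Longrightarrow> R powr (s * (1 - s) / 10) \<le> K ^ E"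
    using form_config_lower_bound[of a s] by blast
  define x where "x = s * (1 - s) / 10"
  have x: "0 < x" using assms by (simp add: x_def)
  \<comment> \<open>Chosen so that \<open>3 * \<epsilon> * E \<le> x / 2\<close>: half of the
    exponent \<open>x\<close> survives against \<open>k0 ^ E\<close>.\<close>
  define \<epsilon> where "\<epsilon> = x / (6 * (real E + 1))"
  have eps: "0 < \<epsilon>" using x by (simp add: \<epsilon>_def)
  define k0 where "k0 = 1000 + 2 * real m + 6 * real a"
  have k0: "1 \<le> k0" by (simp add: k0_def)
  \<comment> \<open>The threshold where \<open>R powr (x / 2)\<close> reaches
    \<open>k0 ^ E\<close>.\<close>
  define R1 where "R1 = (k0 ^ E) powr (2 / x)"
  have R1: "1 \<le> R1" unfolding R1_def using k0 x by (simp add: ge_one_powr_ge_zero one_le_power)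
  \<comment> \<open>For \<open>R \<le> R1\<close> this makes the right-hand side at most 1, while
    \<open>B + B\<close> needs at least one interval. The factor 3 matches the one in
    \<open>card_grid_sum\<close>.\<close>
  define c0 where "c0 = 1 / (3 * R1 powr (\<epsilon> + s))"
  have c0: "0 < c0" "c0 \<le> 1 / 3"
    using R1 ge_one_powr_ge_zero[OF R1, of "\<epsilon> + s"] eps assms by (auto simp: c0_def field_simps)
  show "\<exists>\<epsilon>>0. \<exists>c0>0. \<forall>C::real. C \<ge> 1 \<longrightarrow>
             (\<forall>\<delta>>0. \<forall>A :: real set.
                A \<subseteq> {0..1} \<longrightarrow> finite A \<longrightarrow> delta_separated \<delta> A \<longrightarrow>
                real (card A) = of_int \<lceil>\<delta> powr (-s)\<rceil> \<longrightarrow>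
                (\<forall>x l. l \<ge> \<delta> \<longrightarrow> real (card (A \<inter> {x..x+l})) \<le> C * l powr s * real (card A)) \<longrightarrow>
                (\<forall>B. B \<subseteq> A \<longrightarrow> real (card B) \<ge> \<delta> powr \<epsilon> * real (card A) \<longrightarrow>
                   real (covering_number \<delta> (sumset B))
                   + real (covering_number \<delta> (form_image (quad_form a1 a2 a3) B))
                   \<ge> c0 * C powr (-1) * \<delta> powr (-\<epsilon>) * real (card A)))"
  proof (rule exI[of _ \<epsilon>], intro conjI eps, rule exI[of _ c0], intro conjI c0(1) allI impI)
    fix C \<delta> :: real and A B :: "real set"
    assume C: "1 \<le> C" and \<delta>: "0 < \<delta>" and A: "A \<subseteq> {0..1}" "finite A" "delta_separated \<delta> A"
      and cA: "real (card A) = of_int \<lceil>\<delta> powr (-s)\<rceil>"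
      and frost: "\<forall>x l. l \<ge> \<delta> \<longrightarrow> real (card (A \<inter> {x..x+l})) \<le> C * l powr s * real (card A)"
      and B: "B \<subseteq> A" "\<delta> powr \<epsilon> * real (card A) \<le> real (card B)"
    define cs where "cs = real (covering_number \<delta> (sumset B))"
    define cf where "cf = real (covering_number \<delta> (form_image (quad_form a1 a2 a3) B))"
    have cA1: "1 \<le> real (card A)" unfolding cA using \<delta> by simp
    have "0 < \<delta> powr \<epsilon> * real (card A)" using \<delta> cA1 by simp
    then have cB: "0 < real (card B)" using B(2) by linarith
    then have neB: "B \<noteq> {}" by auto
    have finB: "finite B" using A B finite_subset by blast
    have "sumset B \<noteq> {}" using neB by (auto simp: sumset_def)
    then have cs1: "1 \<le> cs" unfolding cs_def
      using covering_number_pos[OF finite_sumset[OF finB], of \<delta>] \<delta> by simp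
    have cf0: "0 \<le> cf" by (simp add: cf_def)
    have Cinv: "C powr (-1) = 1 / C" "1 / C \<le> 1" using C by (auto simp: powr_minus_divide)
    show "c0 * C powr (-1) * \<delta> powr (-\<epsilon>) * real (card A) \<le> cs + cf"
    proof (cases "1 \<le> \<delta>")
      case True
      have "\<delta> powr (-s) \<le> 1" "\<delta> powr (-\<epsilon>) \<le> 1" using True assms eps powr_mono[of _ 0 \<delta>] by auto
      moreover from this(1) have "real (card A) \<le> 1" unfolding cA by (simp add: ceiling_le_iff)
      ultimately have "c0 * C powr (-1) * \<delta> powr (-\<epsilon>) * real (card A) \<le> 1 * 1 * 1 * 1"
        using c0 Cinv C by (intro mult_mono) auto
      then show ?thesis using cs1 cf0 by linarith
    next
      case False
      define R where "R = 1 / \<delta>"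
      have R: "1 < R" "\<delta> = 1 / R" using False \<delta> by (auto simp: R_def)
      have \<delta>R: "\<delta> powr (- e) = R powr e" "\<delta> powr e = R powr (- e)" for e
        using \<delta> by (auto simp: R_def powr_divide powr_minus_divide)
      have cA2: "real (card A) \<le> 2 * R powr s"
      proof -
        have "real (card A) \<le> R powr s + 1" unfolding cA \<delta>R(1) by linarith
        moreover have "1 \<le> R powr s" using R assms by (simp add: ge_one_powr_ge_zero)
        ultimately show ?thesis by simp
      qed
      show ?thesis
      proof (cases "R \<le> R1")
        case True
        have "c0 * C powr (-1) * \<delta> powr (-\<epsilon>) * real (card A) \<le> c0 * 1 * R powr \<epsilon> * (2 * R powr s)"
          unfolding \<delta>R(1) using c0 Cinv C cA2 by (intro mult_mono) auto
        also have "\<dots> = c0 * (2 * R powr (\<epsilon> + s))" by (simp add: powr_add)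
        also have "\<dots> \<le> c0 * (2 * R1 powr (\<epsilon> + s))"
          using c0 True R eps assms by (intro mult_left_mono powr_mono2) auto
        also have "\<dots> \<le> 1" using R1 by (simp add: c0_def)
        finally show ?thesis using cs1 cf0 by linarith
      next
        case R1R: False
        show ?thesis
        proof (rule ccontr)
          assume "\<not> ?thesis"
          then have lt: "cs + cf < c0 * (1 / C) * R powr \<epsilon> * real (card A)" unfolding \<delta>R(1) Cinv(1) by simp
          have R0: "0 < R" using R by simp
          have "real (card B) \<le> 3 * cs"
          proof -
            have "card (grid R B) \<le> card (grid R B + grid R B)"
              using finB neB by (intro card_le_card_plus) (auto simp: grid_def)
            then have "card B \<le> 3 * covering_number (1 / R) (sumset B)"
              using card_grid_sum[OF finB R0] card_grid[OF A(3)[unfolded R(2)] R0 B(1)] by linarith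
            then show ?thesis by (simp add: cs_def R(2))
          qed
          then have "R powr (- \<epsilon>) * real (card A) < 3 * (c0 * (1 / C) * R powr \<epsilon> * real (card A))"
            using B(2) lt cf0 unfolding \<delta>R(2) by linarith
          also have "\<dots> = (3 * c0 * (1 / C) * R powr \<epsilon>) * real (card A)" by simp
          also have "\<dots> \<le> (1 * (1 / C) * R powr \<epsilon>) * real (card A)"
            using c0 C by (intro mult_right_mono) auto
          finally have "R powr (- \<epsilon>) < 1 * (1 / C) * R powr \<epsilon>" by (rule mult_right_less_imp_less) simp
          then have "C * R powr (- \<epsilon>) < R powr \<epsilon>" using C by (simp add: field_simps)
          then have "C * R powr (- \<epsilon>) * R powr \<epsilon> < R powr \<epsilon> * R powr \<epsilon>" using R0 by (intro mult_strict_right_mono) auto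
          then have CR: "C \<le> R powr (2 * \<epsilon>)" using R0 by (simp add: mult.assoc powr_add[symmetric])
          have "c0 * (1 / C) * R powr \<epsilon> * real (card A) \<le> 1 * 1 * R powr \<epsilon> * real (card A)"
            using c0 Cinv C by (intro mult_right_mono mult_mono) auto
          then have small: "cs \<le> R powr \<epsilon> * real (card A)" "cf \<le> R powr \<epsilon> * real (card A)"
            using lt cs1 cf0 by auto
          have "form_config (grid R B) A1 A2 A3 a R ((1000 + 2 * real m + 6 * real a) * R powr (3 * \<epsilon>)) s"
          proof (rule grid_form_config[OF assms R(1) eps A(1,2) _ _ _ B(1) neB _ C CR _ _ mA a discA])
            show "delta_separated (1 / R) A" using A(3) R(2) by simp
            show "real (card A) = of_int \<lceil>R powr s\<rceil>" using cA unfolding \<delta>R(1) .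
            show "real (card (A \<inter> {x..x + l})) \<le> C * l powr s * real (card A)" if "1 / R \<le> l" for x l
              using frost that R(2) by simp
            show "R powr (- \<epsilon>) * real (card A) \<le> real (card B)" using B(2) unfolding \<delta>R(2) .
            show "real (covering_number (1 / R) (sumset B)) \<le> R powr \<epsilon> * real (card A)"
              "real (covering_number (1 / R) (form_image (quad_form a1 a2 a3) B)) \<le> R powr \<epsilon> * real (card A)"
              using small by (simp_all add: cs_def cf_def R(2))
          qed
          then have "R powr x \<le> (k0 * R powr (3 * \<epsilon>)) ^ E" unfolding x_def k0_def by (rule E)
          also have "\<dots> = k0 ^ E * R powr (3 * \<epsilon> * real E)"
            using R0 by (simp add: power_mult_distrib powr_powr powr_realpow[symmetric])
          also have "\<dots> \<le> k0 ^ E * R powr (x / 2)"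
          proof (intro mult_left_mono powr_mono)
            have "3 * \<epsilon> * real E \<le> 3 * \<epsilon> * (real E + 1)" using eps by (intro mult_left_mono) auto
            also have "\<dots> = x / 2" by (simp add: \<epsilon>_def field_simps)
            finally show "3 * \<epsilon> * real E \<le> x / 2" .
          qed (use R k0 in auto)
          finally have "R powr (x / 2) * R powr (x / 2) \<le> k0 ^ E * R powr (x / 2)"
            using R0 by (simp add: powr_add[symmetric])
          then have "R powr (x / 2) \<le> k0 ^ E" using R0 by simp
          then have "(R powr (x / 2)) powr (2 / x) \<le> (k0 ^ E) powr (2 / x)" using x by (intro powr_mono2) auto
          then have "R \<le> R1" using R0 x by (simp add: powr_powr R1_def)
          then show False using R1R by simp
        qed
      qed
    qed
  qed
qed simp

end
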